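(* Let $r\ge 2$ and $n\ge 1$, and let $\phi_0,\ldots,\phi_n$ be the Foulkes characters of $G_n=G(r,1,n)$. For $0\le i,j,k\le n$, $$[\phi_i\phi_j,\phi_k]=\sum_{\substack{0\le u\le i\\ 0\le v\le j}}(-1)^{i-u}(-1)^{j-v}\binom{n+1}{i-u}\binom{n+1}{j-v}\binom{ruv+u+v+n-k}{n}.$$
   Context: Fix an integer $r>1$, a primitive $r$-th root of unity $\zeta$, and $Z=\langle\zeta\rangle$. $G_n=G(r,1,n)$ is the group of $n\times n$ complex matrices with exactly one nonzero entry in each row and column, all nonzero entries lying in $Z$. Each $x\in G_n$ is $x=D A_\pi$ with $D$ diagonal and $A_\pi=(\delta_{i\pi(j)})$, $\pi\in S_n$. The type of $x$ is the $r$-tuple of partitions $\lambda=(\lambda^0,\ldots,\lambda^{r-1})$, where the parts of $\lambda^j$ are the lengths of the cycles $(i_1\,i_2\,\ldots\,i_k)$ of $\pi$ with $x_{i_1i_2}x_{i_2i_3}\cdots x_{i_ki_1}=\zeta^j$; conjugacy classes correspond to types, and $K_\lambda$ is the class of elements of type $\lambda$. $\ell(x)$ is the number of parts of $\lambda^0$ (equivalently $\ell(x)=\dim\ker(x-1)$), and $C_i=\{x\in G_n\mid\ell(x)=i\}$, $0\le i\le n$. $\mathrm{CF}_\ell(G_n)$ is the complex vector space of functions $G_n\to\mathbb{C}$ depending only on $\ell$; $\vartheta(C_i)$ is the common value of such a $\vartheta$ on $C_i$. Products of characters are pointwise. The Foulkes characters $\phi_0,\ldots,\phi_n$ of $G_n$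 are given by $\phi_i(x)=\sum_{j=0}^{n}(-1)^{i-j}\binom{n+1}{i-j}(rj+1)^{\ell(x)}$, with $\binom{a}{b}=0$ for $b<0$. The inner product on $\mathrm{CF}_\ell(G_n)$ is $[\vartheta,\psi]=\frac{1}{|G_n|}\sum_{i,j=0}^{n}\vartheta(C_i)\overline{\psi(C_j)}\mu(C_i,C_j)$, with $\mu$ as follows. For a sequence $\mathfrak a=(K_1,\ldots,K_m)$ of conjugacy classes of $G_n$, let $\mu_{\mathfrak a}(C_i,C_j)=\mathbf{E}\,|k_1k_2\cdots k_m C_i\cap C_j|$, where $k_1,\ldots,k_m$ are independent and $k_u$ is uniformly random in $K_u$. Let $\mathfrak a_1=(K_{((n),\emptyset,\ldots,\emptyset)},K_{((n),\emptyset,\ldots,\emptyset)})$, $\mathfrak a_2=(K_{((n),\emptyset,\ldots,\emptyset)},K_{(\emptyset,(n),\emptyset,\ldots,\emptyset)})$, $\mathfrak a_3=(K_{((n),\emptyset,\ldots,\emptyset)},K_{((n-1),(1),\emptyset,\ldots,\emptyset)})$, $\mathfrak a_4=(K_{((n),\emptyset,\ldots,\emptyset)},K_{((n),\emptyset,\ldots,\emptyset)},K_{((n-1,1),\emptyset,\ldots,\emptyset)},K_{((n-1,1),\emptyset,\ldots,\emptyset)})$, $\mathfrak a_5=(K_{((n),\emptyset,\ldots,\emptyset)},K_{((n),\emptyset,\ldots,\emptyset)},K_{((n-1),(1),\emptyset,\ldots,\emptyset)},K_{((n-1,1),\emptyset,\ldots,\emptyset)})$, and $\mu_i=\mu_{\mathfrak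 a_i}$. If $n=1$, $\mu=\frac{2}{r}\mu_1+\frac{r-2}{r}\mu_2$. If $n\ge 2$, $\mu=\frac1r\mu_1+\frac{r-2}{2r}\mu_2+\frac14\mu_3+\frac1{2r}\mu_4+\frac{r-2}{4r}\mu_5$. *)

theory Defs
  imports
    "HOL-Probability.Product_PMF"
    "HOL-Combinatorics.Orbits"
    "Jordan_Normal_Form.Matrix"
begin

definition primitive_root_unity :: "nat \<Rightarrow> complex \<Rightarrow> bool" where
  "primitive_root_unity r \<zeta> \<longleftrightarrow> 0 < r \<and> \<zeta> ^ r = 1 \<and> (\<forall>m. 0 < m \<and> m < r \<longrightarrow> \<zeta> ^ m \<noteq> 1)"

text \<open>
  The group \<open>G(r,1,n)\<close>, with matrix indices running over \<open>0, \<dots>, n - 1\<close>. The integer \<open>r\<close> enters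
  only through \<open>\<zeta>\<close>, which is meant to be a primitive \<open>r\<close>-th root of unity.
\<close>

definition G_grp :: "complex \<Rightarrow> nat \<Rightarrow> complex mat set" where
  "G_grp \<zeta> n = {x \<in> carrier_mat n n.
     (\<forall>i<n. \<exists>!j. j < n \<and> x $$ (i, j) \<noteq> 0) \<and>
     (\<forall>j<n. \<exists>!i. i < n \<and> x $$ (i, j) \<noteq> 0) \<and>
     (\<forall>i<n. \<forall>j<n. x $$ (i, j) \<noteq> 0 \<longrightarrow> x $$ (i, j) \<in> range (\<lambda>m::nat. \<zeta> ^ m))}"

definition perm_mat :: "nat \<Rightarrow> (nat \<Rightarrow> nat) \<Rightarrow> complex mat" where
  "perm_mat n \<pi> = Matrix.mat n n (\<lambda>(i, j). if i = \<pi> j then 1 else 0)"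

definition perm_part :: "nat \<Rightarrow> complex mat \<Rightarrow> nat \<Rightarrow> nat" where
  "perm_part n x = (THE \<pi>. \<pi> permutes {..<n} \<and>
     (\<exists>D \<in> carrier_mat n n. diagonal_mat D \<and> x = D * perm_mat n \<pi>))"

text \<open>
  A cycle is represented by its set of elements, so fixed points give singletons.
  With the above convention for permutation matrices, the nonzero entry of \<open>x\<close> in column \<open>a\<close> is
  \<open>x $$ (\<pi> a, a)\<close>, and the cycle product is the product of these entries over the cycle.
\<close>

definition mat_cycles :: "nat \<Rightarrow> complex mat \<Rightarrow> nat set set" where
  "mat_cycles n x = orbit (perm_part n x) ` {..<n}"

definition cycle_prod :: "nat \<Rightarrow> complex mat \<Rightarrow> nat set \<Rightarrow> complex" where
  "cycle_prod n x c = (\<Prod>a\<in>c. x $$ (perm_part n x a, a))"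

text \<open>An \<open>r\<close>-tuple of partitions is a list of \<open>r\<close> multisets of parts.\<close>

definition cycle_type :: "nat \<Rightarrow> complex \<Rightarrow> nat \<Rightarrow> complex mat \<Rightarrow> nat multiset list" where
  "cycle_type r \<zeta> n x =
     map (\<lambda>m. image_mset card (mset_set {c \<in> mat_cycles n x. cycle_prod n x c = \<zeta> ^ m})) [0..<r]"

definition K_class :: "nat \<Rightarrow> complex \<Rightarrow> nat \<Rightarrow> nat multiset list \<Rightarrow> complex mat set" where
  "K_class r \<zeta> n \<Lambda> = {x \<in> G_grp \<zeta> n. cycle_type r \<zeta> n x = \<Lambda>}"

definition ell :: "nat \<Rightarrow> complex \<Rightarrow> nat \<Rightarrow> complex mat \<Rightarrow> nat" where
  "ell r \<zeta> n x = size (cycle_type r \<zeta> n x ! 0)"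

definition C_set :: "nat \<Rightarrow> complex \<Rightarrow> nat \<Rightarrow> nat \<Rightarrow> complex mat set" where
  "C_set r \<zeta> n i = {x \<in> G_grp \<zeta> n. ell r \<zeta> n x = i}"

text \<open>The guard \<open>j \<le> i\<close> is the convention that binomial coefficients with negative lower index vanish.\<close>

definition foulkes :: "nat \<Rightarrow> complex \<Rightarrow> nat \<Rightarrow> nat \<Rightarrow> complex mat \<Rightarrow> complex" where
  "foulkes r \<zeta> n i x =
     (\<Sum>j=0..n. if j \<le> i
        then (-1) ^ (i - j) * of_nat ((n + 1) choose (i - j)) * of_nat (r * j + 1) ^ ell r \<zeta> n x
        else 0)"

text \<open>
  The expectation of \<open>|k\<^sub>1 \<cdots> k\<^sub>m C\<^sub>i \<inter> C\<^sub>j|\<close>, where the \<open>k\<^sub>u\<close> are independent and \<open>k\<^sub>u\<close> is uniform on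
  the \<open>u\<close>-th entry of the list \<open>\<aa>\<close>; the default value \<open>undefined\<close> of the product
  distribution is never used.
\<close>

definition mu_seq ::
    "nat \<Rightarrow> complex \<Rightarrow> nat \<Rightarrow> complex mat set list \<Rightarrow> nat \<Rightarrow> nat \<Rightarrow> real" where
  "mu_seq r \<zeta> n \<aa> i j =
     measure_pmf.expectation
       (Pi_pmf {..<length \<aa>} undefined (\<lambda>u. pmf_of_set (\<aa> ! u)))
       (\<lambda>k. real (card
          ((\<lambda>c. foldr (*) (map k [0..<length \<aa>]) (1\<^sub>m n) * c) ` C_set r \<zeta> n i \<inter> C_set r \<zeta> n j)))"

definition mu :: "nat \<Rightarrow> complex \<Rightarrow> nat \<Rightarrow> nat \<Rightarrow> nat \<Rightarrow> real" where
  "mu r \<zeta> n i j =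
    (let K = K_class r \<zeta> n;
         K_n = K ({#n#} # replicate (r - 1) {#});
         K_0_n = K ({#} # {#n#} # replicate (r - 2) {#});
         K_n1_1 = K ({#n - 1#} # {#1#} # replicate (r - 2) {#});
         K_n11 = K ({#n - 1, 1#} # replicate (r - 1) {#});
         \<mu>1 = mu_seq r \<zeta> n [K_n, K_n] i j;
         \<mu>2 = mu_seq r \<zeta> n [K_n, K_0_n] i j;
         \<mu>3 = mu_seq r \<zeta> n [K_n, K_n1_1] i j;
         \<mu>4 = mu_seq r \<zeta> n [K_n, K_n, K_n11, K_n11] i j;
         \<mu>5 = mu_seq r \<zeta> n [K_n, K_n, K_n1_1, K_n11] i j
     in if n = 1
        then 2 / real r * \<mu>1 + (real r - 2) / real r * \<mu>2
        else 1 / real r * \<mu>1 + (real r - 2) / (2 * real r) * \<mu>2 + 1 / 4 * \<mu>3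
             + 1 / (2 * real r) * \<mu>4 + (real r - 2) / (4 * real r) * \<mu>5)"

text \<open>
  The common value of a function on \<open>C\<^sub>i\<close>; meaningful for functions depending only on \<open>ell\<close>
  and \<open>i \<le> n\<close>.
\<close>

definition val_on_C ::
    "nat \<Rightarrow> complex \<Rightarrow> nat \<Rightarrow> (complex mat \<Rightarrow> complex) \<Rightarrow> nat \<Rightarrow> complex" where
  "val_on_C r \<zeta> n \<theta> i = (THE v. \<forall>x \<in> C_set r \<zeta> n i. \<theta> x = v)"

definition CF_inner ::
    "nat \<Rightarrow> complex \<Rightarrow> nat \<Rightarrow> (complex mat \<Rightarrow> complex) \<Rightarrow> (complex mat \<Rightarrow> complex) \<Rightarrow> complex" where
  "CF_inner r \<zeta> n \<theta> \<psi> =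
     1 / of_nat (card (G_grp \<zeta> n)) *
     (\<Sum>i=0..n. \<Sum>j=0..n.
        val_on_C r \<zeta> n \<theta> i * cnj (val_on_C r \<zeta> n \<psi> j) * of_real (mu r \<zeta> n i j))"

end

(*
Since theta_m = (r m + 1)^ell satisfies (r u + 1) (r v + 1) = r (r u v + u + v) + 1, linearity and binomial
inversion reduce the theorem to

  [theta_m, theta_w] = sum_{k=0..n} C(m + n - k, n) C(w + n - k, n).

Multiplying by a uniformly random n-cycle of total label 1 makes the labels of a group element uniform subject
to their product, so that only the underlying permutation and that product matter.  The sum over labels is
evaluated by characters of the cyclic group and leaves sums over the symmetric group.

There two facts are needed.  First, for a permutation p and a random n-cycle s, the generating function of
q^cycles(p s) is a multiple of X / (1 - X)^(n+2) times the product over the cycles C of p of 1 - X^|C|; these products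
encode the hook characters, whose orthogonality gives the contributions of mu_1 and mu_2.  Secondly, the product of a
random n-cycle and a random (n-1)-cycle is uniform on the odd permutations; this gives mu_3, mu_4 and mu_5, which
correct the coefficients of the two extreme hooks.  Both facts are proved by deleting the largest point.
*)

theory Submission
  imports Defs "HOL-Computational_Algebra.Polynomial_FPS"
begin

section \<open>Cycles of permutations\<close>

text \<open>Why the weights of \<open>mu\<close> fit. Every sequence contributes, to the pairing of
  \<open>theta_m\<close> with \<open>theta_w\<close>, the order of the group times
  \<open>B1 + e * B0\<close>. Here \<open>B1\<close> (arguments \<open>m + 1\<close>,
  \<open>w + 1\<close>) comes from the trivial character of the cyclic group, \<open>B0\<close>
  (arguments \<open>m\<close>, \<open>w\<close>) from the \<open>r - 1\<close> others, and
  \<open>e\<close> is \<open>r - 1\<close> or \<open>-1\<close> according to whether the labels of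
  the classes after the first multiply to 1. Let \<open>t k\<close> be the term of index
  \<open>k\<close> of the target sum, which has \<open>n + 1\<close> terms, while there are only
  \<open>n\<close> hooks. For mu_1 and mu_2, \<open>B1\<close> is \<open>t 0 + ... + t (n-1)\<close>
  and \<open>B0\<close> is \<open>t 1 + ... + t n\<close>; their weights produce half of
  \<open>B1 + B0\<close>, so \<open>t 0\<close> and \<open>t n\<close> are each short by one half.
  For the other sequences the permutation part is uniform on the odd (mu_3) or even (mu_4, mu_5)
  permutations, so that \<open>B1\<close> and \<open>B0\<close> are a trivial-character term
  \<open>P\<close> minus or plus a sign term \<open>Q\<close>. Their weights cancel \<open>Q\<close>
  in \<open>B1\<close> and \<open>P\<close> in \<open>B0\<close>, and leave half of
  \<open>t 0 + t n\<close>. For \<open>n = 1\<close> the only hook is trivial and sign character at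
  once; nothing has to be corrected, and the first two weights are doubled.\<close>

abbreviation swap :: "'a \<Rightarrow> 'a \<Rightarrow> 'a \<Rightarrow> 'a" where
  "swap \<equiv> Transposition.transpose"

definition cycs :: "'a set \<Rightarrow> ('a \<Rightarrow> 'a) \<Rightarrow> 'a set set" where
  "cycs A p = orbit p ` A"

definition wt :: "(nat \<Rightarrow> 'b::comm_monoid_mult) \<Rightarrow> 'a set \<Rightarrow> ('a \<Rightarrow> 'a) \<Rightarrow> 'b" where
  "wt f A p = (\<Prod>C\<in>cycs A p. f (card C))"

lemma self_in_orbit_permutes:
  assumes "p permutes A" "finite A"
  shows "x \<in> orbit p x"
  by (rule permutation_self_in_orbit[OF permutes_imp_permutation[OF assms(2,1)]])

lemma orbit_eq_permutes:
  assumes "p permutes A" "finite A" "y \<in> orbit p x"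
  shows "orbit p y = orbit p x"
  using orbit_cyclic_eq3[OF cyclic_on_orbit[OF assms(1,2)] assms(3)] .

lemma orbit_disjoint_permutes:
  assumes "p permutes A" "finite A" "y \<notin> orbit p x"
  shows "orbit p x \<inter> orbit p y = {}"
proof (rule ccontr)
  assume "orbit p x \<inter> orbit p y \<noteq> {}"
  then obtain z where "z \<in> orbit p x" "z \<in> orbit p y" by auto
  then have "orbit p x = orbit p y" using orbit_eq_permutes[OF assms(1,2)] by metis
  then show False using assms self_in_orbit_permutes by metis
qed

lemma finite_cycs [simp, intro]: "finite A \<Longrightarrow> finite (cycs A p)"
  by (simp add: cycs_def)

lemma Union_cycs:
  assumes "p permutes A" "finite A"
  shows "\<Union>(cycs A p) = A"
  using permutes_orbit_subset[OF assms(1)] self_in_orbit_permutes[OF assms] by (auto simp: cycs_def)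

lemma cycs_subset: "p permutes A \<Longrightarrow> C \<in> cycs A p \<Longrightarrow> C \<subseteq> A"
  using permutes_orbit_subset[of p A] by (auto simp: cycs_def)

lemma partition_on_cycs:
  assumes "p permutes A" "finite A"
  shows "partition_on A (cycs A p)"
proof (rule partition_onI)
  show "\<Union>(cycs A p) = A" by (rule Union_cycs[OF assms])
next
  fix C D assume "C \<in> cycs A p" "D \<in> cycs A p" "C \<noteq> D"
  then obtain x y where xy: "C = orbit p x" "D = orbit p y" by (auto simp: cycs_def)
  with \<open>C \<noteq> D\<close> have "y \<notin> orbit p x" using orbit_eq_permutes[OF assms, of y x] by auto
  then show "disjnt C D" using orbit_disjoint_permutes[OF assms, of y x] xy by (simp add: disjnt_def)
next
  show "{} \<notin> cycs A p" using orbit_nonempty[of p] by (auto simp: cycs_def)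
qed

text \<open>Put \<open>q = p o swap j k\<close>. Since \<open>q k = p j\<close>, the walk of
  \<open>q\<close> from \<open>k\<close> runs through the whole \<open>p\<close>-cycle of
  \<open>j\<close>, and then \<open>q j = p k\<close> leads it into the cycle of \<open>k\<close>.
  The transposition thus merges two cycles and leaves the others alone.\<close>

lemma orbit_comp_swap:
  assumes p: "p permutes A" "finite A" and k: "k \<notin> orbit p j"
  shows "orbit (p \<circ> swap j k) x =
    (if x \<in> orbit p j \<union> orbit p k then orbit p j \<union> orbit p k else orbit p x)"
proof -
  let ?q = "p \<circ> swap j k" and ?U = "orbit p j \<union> orbit p k"
  note self = self_in_orbit_permutes[OF p]
  have jk: "j \<noteq> k" using self[of j] k by auto
  have dis: "orbit p j \<inter> orbit p k = {}" by (rule orbit_disjoint_permutes[OF p k])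
  \<comment> \<open>Stated for arbitrary points because it is used twice, with the roles of
    \<open>j\<close> and \<open>k\<close> exchanged.\<close>
  have sub: "orbit p a \<subseteq> orbit (p \<circ> swap a b) b" if ab: "b \<notin> orbit p a" for a b
  proof
    fix y assume "y \<in> orbit p a"
    then show "y \<in> orbit (p \<circ> swap a b) b"
    proof (induction rule: orbit.induct)
      case base
      have "p a = (p \<circ> swap a b) b" by simp
      then show ?case by (metis orbit.base)
    next
      case (step y)
      show ?case
      proof (cases "y = a")
        case True
        have "p a = (p \<circ> swap a b) b" by simp
        then show ?thesis using True by (metis orbit.base)
      next
        case False
        have "y \<noteq> b" using step.hyps ab by auto
        then have "p y = (p \<circ> swap a b) y" using False by simp
        then show ?thesis using step.IH by (metis orbit.step)
      qed
    qed
  qed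
  have k': "j \<notin> orbit p k" using dis self[of j] by auto
  have s1: "orbit p j \<subseteq> orbit ?q k" using sub[OF k] .
  have s2: "orbit p k \<subseteq> orbit ?q j" using sub[OF k'] by (simp add: transpose_commute)
  have qclosed: "?q y \<in> ?U" if "y \<in> ?U" for y
  proof -
    have "?q y = p j \<or> ?q y = p k \<or> ?q y = p y" by (simp add: Transposition.transpose_def)
    then show ?thesis using that orbit.base[of p j] orbit.base[of p k] orbit.step[of y p j] orbit.step[of y p k]
      by (metis Un_iff)
  qed
  have ub: "orbit ?q x \<subseteq> ?U" if "x \<in> ?U" for x
  proof
    fix y assume "y \<in> orbit ?q x"
    then show "y \<in> ?U"
    proof (induction rule: orbit.induct)
      case base show ?case by (rule qclosed[OF that])
    next
      case (step y) show ?case by (rule qclosed[OF step.IH])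
    qed
  qed
  have q: "permutation ?q"
    by (intro permutation_compose permutation_swap_id permutes_imp_permutation[OF p(2,1)])
  have qeq: "orbit ?q y = orbit ?q x" if "y \<in> orbit ?q x" for x y
    using orbit_cyclic_eq3[OF cyclic_on_orbit'[OF q] that] .
  have jk_eq: "orbit ?q j = orbit ?q k" using qeq s1 self[of j] by blast
  have lb: "orbit ?q j = ?U" using ub[of j] self[of j] s1 s2 jk_eq by blast
  show ?thesis
  proof (cases "x \<in> ?U")
    case True
    then have "x \<in> orbit ?q j" using lb by simp
    then show ?thesis using True qeq[of x j] lb by simp
  next
    case False
    have "orbit ?q x = orbit p x"
    proof (rule orbit_cong[OF self])
      fix s assume "s \<in> orbit p x"
      then have "orbit p s = orbit p x" using orbit_eq_permutes[OF p] by blast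
      then have "s \<noteq> j" "s \<noteq> k" using False self[of x] by auto
      then show "?q s = p s" by simp
    qed
    then show ?thesis using False by simp
  qed
qed

lemma cycs_comp_swap:
  assumes p: "p permutes A" "finite A" and jk: "j \<in> A" "k \<in> A" and k: "k \<notin> orbit p j"
  shows "cycs A (p \<circ> swap j k) =
      insert (orbit p j \<union> orbit p k) (cycs A p - {orbit p j, orbit p k})"
    (is "?L = ?R")
proof -
  note o = orbit_comp_swap[OF p k]
  note self = self_in_orbit_permutes[OF p]
  show ?thesis
  proof (intro equalityI subsetI)
    fix C assume "C \<in> ?L"
    then obtain x where x: "x \<in> A" "C = orbit (p \<circ> swap j k) x" by (auto simp: cycs_def)
    show "C \<in> ?R"
    proof (cases "x \<in> orbit p j \<union> orbit p k")
      case True then show ?thesis using x o by simp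
    next
      case False
      then have "orbit p x \<noteq> orbit p j" "orbit p x \<noteq> orbit p k" using self[of x] by auto
      then show ?thesis using x o[of x] False by (simp add: cycs_def)
    qed
  next
    fix C assume "C \<in> ?R"
    then consider "C = orbit p j \<union> orbit p k"
      | x where "x \<in> A" "C = orbit p x" "C \<noteq> orbit p j" "C \<noteq> orbit p k" by (auto simp: cycs_def)
    then show "C \<in> ?L"
    proof cases
      case 1
      then have "C = orbit (p \<circ> swap j k) j" using o[of j] self[of j] by simp
      then show ?thesis using jk by (simp add: cycs_def)
    next
      case 2
      then have "x \<notin> orbit p j \<union> orbit p k" using orbit_eq_permutes[OF p] by blast
      then show ?thesis using 2 o[of x] by (auto simp: cycs_def)
    qed
  qed
qed

lemma wt_comp_swap:
  assumes p: "p permutes A" "finite A" and jk: "j \<in> A" "k \<in> A" and k: "k \<notin> orbit p j"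
  shows "wt f A (p \<circ> swap j k) =
    f (card (orbit p j) + card (orbit p k)) * (\<Prod>C\<in>cycs A p - {orbit p j, orbit p k}. f (card C))"
proof -
  note self = self_in_orbit_permutes[OF p]
  have dis: "orbit p j \<inter> orbit p k = {}" by (rule orbit_disjoint_permutes[OF p k])
  have fin: "finite (orbit p x)" for x using finite_orbit[OF self] .
  \<comment> \<open>\<open>wt\<close> is a product over a set of cycles, so a merged cycle that
    coincided with an old one would lose its factor.\<close>
  have "orbit p j \<union> orbit p k \<notin> cycs A p - {orbit p j, orbit p k}"
  proof
    assume "orbit p j \<union> orbit p k \<in> cycs A p - {orbit p j, orbit p k}"
    then obtain x where "orbit p j \<union> orbit p k = orbit p x" by (auto simp: cycs_def)
    then have "orbit p j = orbit p x" "orbit p k = orbit p x"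
      using orbit_eq_permutes[OF p] self by blast+
    then show False using k self[of k] by simp
  qed
  then show ?thesis
    unfolding wt_def cycs_comp_swap[OF assms] using p(2)
    by (subst prod.insert) (simp_all add: card_Un_disjoint[OF fin fin dis])
qed

text \<open>\<open>p o q\<close> is the conjugate of \<open>q o p\<close> by \<open>p\<close>, so
  \<open>p\<close> carries the cycles of the latter to those of the former.\<close>

lemma cycs_conj:
  assumes p: "p permutes A" "q permutes A" "finite A"
  shows "cycs A (p \<circ> q) = (`) p ` cycs A (q \<circ> p)"
proof -
  have qp: "q \<circ> p permutes A" using p permutes_compose by blast
  have *: "orbit (p \<circ> q) (p x) = p ` orbit (q \<circ> p) x" for x
    by (rule orbit_inverse[symmetric]) (simp_all add: self_in_orbit_permutes[OF qp p(3)] del: o_apply, simp)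
  have "cycs A (p \<circ> q) = orbit (p \<circ> q) ` (p ` A)"
    unfolding cycs_def using permutes_image[OF p(1)] by simp
  also have "\<dots> = (`) p ` cycs A (q \<circ> p)" by (simp add: cycs_def image_image *)
  finally show ?thesis .
qed

lemma cycs_insert_fix:
  assumes p: "p permutes A" "a \<notin> A"
  shows "cycs (insert a A) p = insert {a} (cycs A p)"
proof -
  have "p a = a" using p permutes_not_in by metis
  then have "orbit p a = {a}" by (simp add: orbit_eq_singleton_iff)
  then show ?thesis by (simp add: cycs_def)
qed

lemma singleton_notin_cycs:
  assumes p: "p permutes A" "a \<notin> A"
  shows "{a} \<notin> cycs A p"
  using cycs_subset[OF p(1), of "{a}"] p(2) by blast

lemma wt_insert_fix:
  assumes p: "p permutes A" "a \<notin> A" "finite A"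
  shows "wt f (insert a A) p = f 1 * wt f A p"
  unfolding wt_def cycs_insert_fix[OF p(1,2)]
  using singleton_notin_cycs[OF p(1,2)] p(3) by simp

text \<open>The point \<open>a\<close> is a cycle of length 1 of \<open>p\<close>; merging it with
  the cycle of \<open>k\<close> inserts it there and lengthens that cycle by one.\<close>

lemma wt_insert_swap:
  assumes p: "p permutes A" "a \<notin> A" "finite A" and k: "k \<in> A"
  shows "wt f (insert a A) (p \<circ> swap k a) =
    f (Suc (card (orbit p k))) * (\<Prod>C\<in>cycs A p - {orbit p k}. f (card C))"
proof -
  have "p a = a" using p permutes_not_in by metis
  then have oa: "orbit p a = {a}" by (simp add: orbit_eq_singleton_iff)
  have ok: "orbit p k \<subseteq> A" using permutes_orbit_subset[OF p(1) k] .
  then have "a \<notin> orbit p k" using p by auto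
  moreover have "p permutes insert a A" using p permutes_imp_permutes_insert by metis
  moreover have "cycs (insert a A) p - {orbit p k, {a}} = cycs A p - {orbit p k}"
    using cycs_insert_fix[OF p(1,2)] singleton_notin_cycs[OF p(1,2)] by auto
  ultimately show ?thesis
    using wt_comp_swap[of p "insert a A" k a f] p k by (simp add: oa)
qed

definition ncyc :: "'a set \<Rightarrow> ('a \<Rightarrow> 'a) \<Rightarrow> nat" where
  "ncyc A p = card (cycs A p)"

lemma ncyc_conj:
  assumes p: "p permutes A" "q permutes A" "finite A"
  shows "ncyc A (p \<circ> q) = ncyc A (q \<circ> p)"
proof -
  have "inj_on ((`) p) (cycs A (q \<circ> p))"
    using permutes_inj[OF p(1)] by (meson inj_image_eq_iff inj_on_def)
  then show ?thesis unfolding ncyc_def cycs_conj[OF p] by (rule card_image)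
qed

lemma ncyc_insert_fix:
  assumes p: "p permutes A" "a \<notin> A" "finite A"
  shows "ncyc (insert a A) p = Suc (ncyc A p)"
  unfolding ncyc_def cycs_insert_fix[OF p(1,2)]
  using singleton_notin_cycs[OF p(1,2)] p(3) by simp

lemma ncyc_comp_swap:
  assumes p: "p permutes A" "finite A" and jk: "j \<in> A" "k \<in> A" and k: "k \<notin> orbit p j"
  shows "Suc (ncyc A (p \<circ> swap j k)) = ncyc A p"
proof -
  note self = self_in_orbit_permutes[OF p]
  have ne: "orbit p j \<noteq> orbit p k" using k self[of k] by auto
  have "orbit p j \<union> orbit p k \<notin> cycs A p - {orbit p j, orbit p k}"
  proof
    assume "orbit p j \<union> orbit p k \<in> cycs A p - {orbit p j, orbit p k}"
    then obtain x where "orbit p j \<union> orbit p k = orbit p x" by (auto simp: cycs_def)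
    then have "orbit p j = orbit p x" "orbit p k = orbit p x"
      using orbit_eq_permutes[OF p] self by blast+
    then show False using ne by simp
  qed
  then have 1: "ncyc A (p \<circ> swap j k) = Suc (card (cycs A p - {orbit p j, orbit p k}))"
    unfolding ncyc_def cycs_comp_swap[OF assms] using p(2) by simp
  have "{orbit p j, orbit p k} \<subseteq> cycs A p" using jk by (auto simp: cycs_def)
  then have "card (cycs A p) = card (cycs A p - {orbit p j, orbit p k}) + card {orbit p j, orbit p k}"
    
    using card_mono[OF finite_cycs[OF p(2)] \<open>{orbit p j, orbit p k} \<subseteq> cycs A p\<close>] by (simp add: card_Diff_subset)
  then show ?thesis using 1 ne by (simp add: ncyc_def)
qed

lemma ncyc_insert_swap:
  assumes p: "p permutes A" "a \<notin> A" "finite A" and k: "k \<in> A"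
  shows "ncyc (insert a A) (p \<circ> swap k a) = ncyc A p"
proof -
  have "orbit p k \<subseteq> A" using permutes_orbit_subset[OF p(1) k] .
  then have "a \<notin> orbit p k" using p by auto
  moreover have "p permutes insert a A" using p permutes_imp_permutes_insert by metis
  ultimately have "Suc (ncyc (insert a A) (p \<circ> swap k a)) = ncyc (insert a A) p"
    using p k by (intro ncyc_comp_swap) auto
  then show ?thesis using ncyc_insert_fix[OF p] by simp
qed

text \<open>Conjugation moves a transposition past \<open>p\<close>; this converts an insertion of a
  point from the left into one from the right.\<close>

lemma comp_transpose_fix:
  assumes p: "p permutes A"
  shows "swap a b \<circ> p = p \<circ> swap (inv_into UNIV p a) (inv_into UNIV p b)"
  using transpose_comp_eq[OF permutes_bij[OF p]] by simp

lemma ncyc_insert_swap_left: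
  assumes p: "p permutes A" "a \<notin> A" "finite A" and k: "k \<in> A"
  shows "ncyc (insert a A) (swap k a \<circ> p) = ncyc A p"
proof -
  have "inv_into UNIV p a = a" "inv_into UNIV p k \<in> A"
    using p k permutes_inv[OF p(1)] permutes_not_in[of "inv_into UNIV p" A a] permutes_in_image by fastforce+
  then show ?thesis using ncyc_insert_swap[OF p] comp_transpose_fix[OF p(1), of k a] by simp
qed

section \<open>Permutations of an initial segment\<close>

text \<open>The permutations act on all of \<open>nat\<close> and fix everything from
  \<open>n\<close> on, so \<open>perms n\<close> is literally a subset of
  \<open>perms (Suc n)\<close> and deleting the point \<open>n\<close> needs no embedding.\<close>

definition perms :: "nat \<Rightarrow> (nat \<Rightarrow> nat) set" where
  "perms n = {p. p permutes {..<n}}"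

abbreviation nc :: "nat \<Rightarrow> (nat \<Rightarrow> nat) \<Rightarrow> nat" where
  "nc n \<equiv> ncyc {..<n}"

lemma finite_perms [simp, intro]: "finite (perms n)"
  by (simp add: perms_def finite_permutations)

lemma card_perms: "card (perms n) = fact n"
  by (simp add: perms_def card_permutations)

lemma perms_0 [simp]: "perms 0 = {id}"
  by (simp add: perms_def)

lemma perms_comp: "p \<in> perms n \<Longrightarrow> q \<in> perms n \<Longrightarrow> p \<circ> q \<in> perms n"
  by (simp add: perms_def permutes_compose)

lemma perms_inv: "p \<in> perms n \<Longrightarrow> inv_into UNIV p \<in> perms n"
  by (simp add: perms_def permutes_inv)

lemma perms_transpose: "i < n \<Longrightarrow> j < n \<Longrightarrow> swap i j \<in> perms n"
  by (simp add: perms_def permutes_swap_id)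

lemma perms_Suc: "p \<in> perms n \<Longrightarrow> p \<in> perms (Suc n)"
  unfolding perms_def lessThan_Suc by (simp add: permutes_imp_permutes_insert)

lemma perms_fix: "p \<in> perms n \<Longrightarrow> n \<le> a \<Longrightarrow> p a = a"
  unfolding perms_def using permutes_not_in by fastforce

lemma perms_less: "p \<in> perms n \<Longrightarrow> a < n \<Longrightarrow> p a < n"
  unfolding perms_def using permutes_in_image[of p "{..<n}" a] by simp

lemma perms_inv_apply [simp]: "p \<in> perms n \<Longrightarrow> p (inv_into UNIV p a) = a" "p \<in> perms n \<Longrightarrow> inv_into UNIV p (p a) = a"
  unfolding perms_def using permutes_inverses by auto

lemma perms_inj_iff: "p \<in> perms n \<Longrightarrow> p a = p b \<longleftrightarrow> a = b"
  by (metis perms_inv_apply(2))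

lemma perms_bij: "p \<in> perms n \<Longrightarrow> bij_betw p {..<n} {..<n}"
  by (simp add: perms_def permutes_imp_bij)

lemma perms_permutation: "p \<in> perms n \<Longrightarrow> permutation p"
  unfolding perms_def using permutes_imp_permutation by blast

text \<open>A permutation of \<open>n + 1\<close> points that moves \<open>n\<close> is uniquely
  \<open>swap i n o p\<close> with \<open>p\<close> in \<open>perms n\<close>, where
  \<open>i\<close> is the image of \<open>n\<close>. This is the recursion behind the inductions
  that delete the largest point.\<close>

lemma sum_perms_Suc:
  "(\<Sum>p\<in>perms (Suc n). f p) = (\<Sum>p\<in>perms n. f p) + (\<Sum>p\<in>perms n. \<Sum>i<n. f (swap i n \<circ> p))"
proof -
  have "(\<Sum>p\<in>perms (Suc n). f p) = (\<Sum>b\<in>insert n {..<n}. \<Sum>q\<in>perms n. f (swap n b \<circ> q))"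
    unfolding perms_def lessThan_Suc by (rule sum_over_permutations_insert) auto
  also have "\<dots> = (\<Sum>q\<in>perms n. f q) + (\<Sum>b<n. \<Sum>q\<in>perms n. f (swap n b \<circ> q))"
    by (simp add: transpose_commute)
  also have "(\<Sum>b<n. \<Sum>q\<in>perms n. f (swap n b \<circ> q)) = (\<Sum>p\<in>perms n. \<Sum>i<n. f (swap i n \<circ> p))"
    by (subst sum.swap) (simp add: transpose_commute)
  finally show ?thesis .
qed

lemma sum_perms_inv: "(\<Sum>p\<in>perms n. f (inv_into UNIV p)) = (\<Sum>p\<in>perms n. f p)"
  unfolding perms_def by (rule sum_permutations_inverse[symmetric])

lemma sum_perms_right: "q \<in> perms n \<Longrightarrow> (\<Sum>p\<in>perms n. f (p \<circ> q)) = (\<Sum>p\<in>perms n. f p)"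
  unfolding perms_def by (rule sum_permutations_compose_right[symmetric]) simp

lemma sum_perms_left: "q \<in> perms n \<Longrightarrow> (\<Sum>p\<in>perms n. f (q \<circ> p)) = (\<Sum>p\<in>perms n. f p)"
  unfolding perms_def by (rule setum_permutations_compose_left[symmetric]) simp

lemma transpose_comp_perms:
  assumes "p \<in> perms n"
  shows "swap i n \<circ> p = p \<circ> swap (inv_into UNIV p i) n"
  using comp_transpose_fix[of p "{..<n}" i n] perms_fix[OF perms_inv[OF assms], of n] assms
  by (simp add: perms_def)

lemma sum_perms_Suc_right:
  "(\<Sum>p\<in>perms (Suc n). f p) = (\<Sum>p\<in>perms n. f p) + (\<Sum>p\<in>perms n. \<Sum>i<n. f (p \<circ> swap i n))"
proof -
  have "(\<Sum>i<n. f (swap i n \<circ> p)) = (\<Sum>i<n. f (p \<circ> swap i n))" if p: "p \<in> perms n" for p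
    unfolding transpose_comp_perms[OF p]
    by (rule sum.reindex_bij_betw[OF perms_bij[OF perms_inv[OF p]], of "\<lambda>i. f (p \<circ> swap i n)"])
  then show ?thesis by (simp add: sum_perms_Suc)
qed

lemma perms_Suc_cases:
  assumes "p \<in> perms (Suc n)"
  obtains "p \<in> perms n" | q j where "q \<in> perms n" "j < n" "p = q \<circ> swap j n"
proof -
  have "{p. p permutes insert n {..<n}} = (\<lambda>(b, p). swap n b \<circ> p) ` {(b, p). b \<in> insert n {..<n} \<and> p \<in> {p. p permutes {..<n}}}"
    by (rule permutes_insert)
  then obtain b q where q: "p = swap n b \<circ> q" "b \<le> n" "q \<in> perms n"
    using assms unfolding perms_def lessThan_Suc by force
  show thesis
  proof (cases "b = n")
    case True then show thesis using q that(1) by simp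
  next
    case False
    then have "b < n" using q by simp
    moreover have "p = q \<circ> swap (inv_into UNIV q b) n"
      using transpose_comp_perms[OF q(3), of b] q(1) by (simp add: transpose_commute)
    ultimately show thesis using that(2)[OF q(3), of "inv_into UNIV q b"] perms_less[OF perms_inv[OF q(3)]] by blast
  qed
qed

lemma nc_0 [simp]: "ncyc {} p = 0"
  by (simp add: ncyc_def cycs_def)

lemma nc_conj: "p \<in> perms n \<Longrightarrow> q \<in> perms n \<Longrightarrow> nc n (p \<circ> q) = nc n (q \<circ> p)"
  by (simp add: perms_def ncyc_conj)

lemma nc_inv: "p \<in> perms n \<Longrightarrow> nc n (inv_into UNIV p) = nc n p"
  unfolding ncyc_def cycs_def using orbit_inv_eq[OF perms_permutation] by (metis image_cong)

lemma nc_Suc: "p \<in> perms n \<Longrightarrow> nc (Suc n) p = Suc (nc n p)"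
  by (simp add: perms_def lessThan_Suc ncyc_insert_fix)

lemma nc_Suc_swap: "p \<in> perms n \<Longrightarrow> j < n \<Longrightarrow> nc (Suc n) (p \<circ> swap j n) = nc n p"
  by (simp add: perms_def lessThan_Suc ncyc_insert_swap)

lemma nc_Suc_swap_left: "p \<in> perms n \<Longrightarrow> j < n \<Longrightarrow> nc (Suc n) (swap j n \<circ> p) = nc n p"
  by (simp add: perms_def lessThan_Suc ncyc_insert_swap_left)

lemma nc_pos: "0 < n \<Longrightarrow> 0 < nc n p"
  by (auto simp: ncyc_def cycs_def card_gt_0_iff)

lemma nc_le: "nc n p \<le> n"
  unfolding ncyc_def cycs_def using card_image_le[of "{..<n}" "orbit p"] by simp

section \<open>Sign and generating function of the number of cycles\<close>

text \<open>A new fixed point raises both \<open>n\<close> and the number of cycles; inserting the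
  new point into a cycle raises only \<open>n\<close> and costs one transposition.\<close>

lemma sign_perms:
  assumes "p \<in> perms n"
  shows "sign p = (-1) ^ (n + nc n p)"
  using assms
proof (induction n arbitrary: p)
  case (Suc n)
  from Suc.prems show ?case
  proof (cases rule: perms_Suc_cases)
    case 1
    then show ?thesis using Suc.IH[OF 1] by (simp add: nc_Suc)
  next
    case (2 q j)
    have "sign p = sign q * sign (swap j n)"
      unfolding 2 by (intro sign_compose perms_permutation[OF 2(1)] permutation_swap_id)
    moreover have "nc (Suc n) p = nc n q" unfolding 2 by (rule nc_Suc_swap[OF 2(1,2)])
    ultimately show ?thesis using Suc.IH[OF 2(1)] 2(2) by (simp add: sign_swap_id)
  qed
qed simp

text \<open>The new point either forms its own cycle, with factor \<open>x\<close>, or is inserted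
  after one of the \<open>n\<close> old points. This is the generating function of the Stirling
  numbers of the first kind.\<close>

lemma sum_power_nc:
  fixes x :: "'a::comm_ring_1"
  shows "(\<Sum>p\<in>perms n. x ^ nc n p) = (\<Prod>i<n. x + of_nat i)"
proof (induction n)
  case (Suc n)
  have "(\<Sum>p\<in>perms (Suc n). x ^ nc (Suc n) p) = (x + of_nat n) * (\<Sum>p\<in>perms n. x ^ nc n p)"
    by (simp add: sum_perms_Suc_right nc_Suc nc_Suc_swap sum_distrib_left[symmetric] sum_distrib_right[symmetric] algebra_simps)
  then show ?case using Suc by (simp add: mult.commute)
qed simp

text \<open>By \<open>sign_perms\<close> the sign replaces \<open>x\<close> by \<open>-x\<close> up
  to a global sign, which turns the rising factorial into the falling one.\<close>

lemma sum_sign_power_nc: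
  fixes x :: "'a::comm_ring_1"
  shows "(\<Sum>p\<in>perms n. of_int (sign p) * x ^ nc n p) = (\<Prod>i<n. x - of_nat i)"
proof -
  have "of_int (sign p) * x ^ nc n p = (-1) ^ n * (- x) ^ nc n p" if "p \<in> perms n" for p
    using sign_perms[OF that] by (simp add: power_add power_minus[of x] mult.assoc)
  then have "(\<Sum>p\<in>perms n. of_int (sign p) * x ^ nc n p) = (-1) ^ n * (\<Prod>i<n. - x + of_nat i)"
    by (simp add: sum_distrib_left[symmetric] sum_power_nc)
  also have "\<dots> = (\<Prod>i<n. (-1) * (- x + of_nat i))"
    by (simp only: prod.distrib prod_constant card_lessThan)
  finally show ?thesis by simp
qed

section \<open>The product of an \<open>n\<close>-cycle and an \<open>(n - 1)\<close>-cycle\<close>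

definition one_cyc :: "nat \<Rightarrow> (nat \<Rightarrow> nat) \<Rightarrow> real" where
  "one_cyc n p = of_bool (nc n p = 1)"

text \<open>\<open>near_cyc\<close> counts pairs of an \<open>(n - 1)\<close>-cycle and the point that it omits; for \<open>n = 2\<close> the
  identity is counted twice.\<close>

definition near_cyc :: "nat \<Rightarrow> (nat \<Rightarrow> nat) \<Rightarrow> real" where
  "near_cyc n p = (if nc n p = 2 then of_nat (card {a. a < n \<and> p a = a}) else 0)"

text \<open>For \<open>0 < n\<close> a permutation that fixes \<open>n\<close> has at least two
  cycles, and inserting \<open>n\<close> keeps the number of cycles; so every
  \<open>(n + 1)\<close>-cycle is an \<open>n\<close>-cycle with \<open>n\<close> inserted.\<close>

lemma sum_one_cyc_Suc:
  fixes f :: "(nat \<Rightarrow> nat) \<Rightarrow> real"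
  assumes n: "0 < n"
  shows "(\<Sum>p\<in>perms (Suc n). one_cyc (Suc n) p * f p) =
    (\<Sum>p\<in>perms n. one_cyc n p * (\<Sum>i<n. f (swap i n \<circ> p)))"
proof -
  have 1: "one_cyc (Suc n) p = (0::real)" if "p \<in> perms n" for p
    using that nc_pos[OF n, of p] by (simp add: one_cyc_def nc_Suc)
  have 2: "one_cyc (Suc n) (swap i n \<circ> p) = (one_cyc n p::real)" if "p \<in> perms n" "i < n" for p i
    unfolding one_cyc_def nc_Suc_swap_left[OF that] ..
  show ?thesis unfolding sum_perms_Suc
    by (simp add: 1 2 sum_distrib_left del: o_apply)
qed

lemma nc_fix_ge_2:
  assumes "p \<in> perms n" "2 \<le> n" "a < n" "p a = a"
  shows "2 \<le> nc n p"
proof -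
  obtain b where b: "b < n" "b \<noteq> a"
    using assms(2,3) by (cases "a = 0") (auto intro: that[of 0] that[of 1])
  have "orbit p a = {a}" using assms by (simp add: orbit_eq_singleton_iff)
  moreover have "b \<in> orbit p b" using assms(1) self_in_orbit_permutes[of p "{..<n}"] by (simp add: perms_def)
  ultimately have "orbit p a \<noteq> orbit p b" using b by auto
  moreover have "{orbit p a, orbit p b} \<subseteq> cycs {..<n} p" using b assms by (auto simp: cycs_def)
  then have "card {orbit p a, orbit p b} \<le> nc n p"
    unfolding ncyc_def by (intro card_mono finite_cycs) simp
  ultimately show ?thesis by simp
qed

text \<open>Seen on \<open>n + 1\<close> points, \<open>p\<close> has the additional cycle formed by
  \<open>n\<close>, so it has two cycles exactly when it was an \<open>n\<close>-cycle;
  \<open>2 \<le> n\<close> ensures that an \<open>n\<close>-cycle has no further fixed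
  point.\<close>

lemma near_cyc_Suc:
  assumes p: "p \<in> perms n" and n: "2 \<le> n"
  shows "near_cyc (Suc n) p = one_cyc n p"
proof (cases "nc n p = 1")
  case True
  then have "{a. a < Suc n \<and> p a = a} = {n}"
    using perms_fix[OF p, of n] nc_fix_ge_2[OF p n] by (force simp: less_Suc_eq)
  then show ?thesis using True by (simp add: near_cyc_def one_cyc_def nc_Suc[OF p])
qed (simp add: near_cyc_def one_cyc_def nc_Suc[OF p])

text \<open>Inserting the new point into the cycle of \<open>j\<close> keeps the number of cycles
  and destroys at most one fixed point, namely \<open>j\<close>.\<close>

lemma near_cyc_Suc_swap:
  assumes p: "p \<in> perms n" and j: "j < n"
  shows "near_cyc (Suc n) (p \<circ> swap j n) = near_cyc n p - of_bool (nc n p = 2 \<and> p j = j)"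
proof -
  have "{a. a < Suc n \<and> (p \<circ> swap j n) a = a} = {a. a < n \<and> p a = a} - {j}"
  proof (rule Set.set_eqI)
    fix a
    show "a \<in> {a. a < Suc n \<and> (p \<circ> swap j n) a = a} \<longleftrightarrow> a \<in> {a. a < n \<and> p a = a} - {j}"
      using perms_fix[OF p, of n] perms_less[OF p j] j
      by (cases "a = j"; cases "a = n") auto
  qed
  moreover have "card {a. a < n \<and> p a = a} = Suc (card ({a. a < n \<and> p a = a} - {j}))" if "p j = j"
    using that j by (intro card.remove) auto
  ultimately show ?thesis
    unfolding near_cyc_def nc_Suc_swap[OF p j] by (cases "p j = j") simp_all
qed

text \<open>The transposition cuts \<open>j\<close> out of its cycle and makes it a fixed point.
  Merging \<open>j\<close> back with the same transposition returns \<open>p\<close>, so the count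
  follows from \<open>ncyc_comp_swap\<close>.\<close>

lemma nc_comp_swap_fix:
  assumes p: "p \<in> perms n" and ij: "i < n" "j < n" "i \<noteq> j" "p i = j"
  shows "nc n (p \<circ> swap i j) = Suc (nc n p)"
proof -
  let ?q = "p \<circ> swap i j"
  have q: "?q \<in> perms n" using p ij by (simp add: perms_comp perms_transpose)
  have "?q j = j" using ij by simp
  then have "orbit ?q j = {j}" by (simp only: orbit_eq_singleton_iff)
  then have "i \<notin> orbit ?q j" using ij by simp
  then have "Suc (nc n (?q \<circ> swap j i)) = nc n ?q"
    using q ij by (intro ncyc_comp_swap) (auto simp: perms_def)
  moreover have "?q \<circ> swap j i = p" by (simp add: transpose_commute[of j i] o_assoc[symmetric])
  ultimately show ?thesis by simp
qed

lemma swap_cancel: "p \<circ> swap j n \<circ> (swap j n \<circ> s) = p \<circ> s"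
  by (simp add: fun_eq_iff)

text \<open>The identity \<open>swap j n o swap i n = swap i j o swap j n\<close> leaves a single
  transposition that involves \<open>n\<close>, and conjugation by \<open>s\<close> moves it to the
  right end, where it is an insertion into a permutation of \<open>n\<close> points.\<close>

lemma swap_swap_comp:
  assumes "s \<in> perms n" "i < n" "j < n" "i \<noteq> j"
  shows "p \<circ> swap j n \<circ> (swap i n \<circ> s) = p \<circ> swap i j \<circ> s \<circ> swap (inv_into UNIV s j) n"
proof -
  have "swap j n \<circ> swap i n = swap i j \<circ> swap j n"
    using assms by (auto simp: fun_eq_iff Transposition.transpose_def)
  then have "p \<circ> (swap j n \<circ> swap i n) \<circ> s = p \<circ> swap i j \<circ> (swap j n \<circ> s)"
    by (simp add: o_assoc)
  then show ?thesis unfolding transpose_comp_perms[OF assms(1), of j] by (simp add: o_assoc)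
qed

text \<open>The product of a uniformly random \<open>n\<close>-cycle and a uniformly random \<open>(n - 1)\<close>-cycle is uniformly
  distributed on the odd permutations. The induction deletes the largest point; the error terms cancel
  because an \<open>n\<close>-cycle \<open>\<kappa>\<close> yields an \<open>(n - 1)\<close>-cycle fixing \<open>j\<close> after composition with
  exactly one transposition \<open>(i j)\<close>, the one with \<open>\<kappa> i = j\<close>.\<close>

lemma sum_one_cyc_near_cyc:
  assumes "2 \<le> n" "p \<in> perms n"
  shows "(\<Sum>s\<in>perms n. one_cyc n s * near_cyc n (p \<circ> s)) = (fact (n - 2) * (1 - of_int (sign p)) :: real)"
  using assms
proof (induction n arbitrary: p rule: nat_induct_at_least)
  case base
  have p1: "perms 1 = {id}"
    by (simp add: perms_def lessThan_Suc)
  have id1: "id \<in> perms 1" using p1 by blast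
  have nc1: "nc 1 id = 1" using nc_Suc[of id 0] by simp
  have nc2: "nc 2 id = 2" using nc_Suc[OF id1] nc1 by (simp add: numeral_2_eq_2)
  have nct: "nc 2 (swap 0 1) = 1" using nc_Suc_swap[OF id1, of 0] nc1 by (simp add: numeral_2_eq_2)
  have L: "(\<Sum>s\<in>perms 2. one_cyc 2 s * near_cyc 2 (p \<circ> s)) = near_cyc 2 (p \<circ> swap 0 1)"
    using sum_one_cyc_Suc[of 1 "\<lambda>s. near_cyc 2 (p \<circ> s)"] nc1 p1
    by (simp add: one_cyc_def numeral_2_eq_2)
  have "p \<in> perms (Suc 1)" using base by (simp add: numeral_2_eq_2)
  then consider "p = id" | "p = swap 0 1"
    by (cases rule: perms_Suc_cases) (auto simp: p1[simplified])
  then show ?case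
  proof cases
    case 1
    then show ?thesis unfolding L using nct by (simp add: near_cyc_def)
  next
    case 2
    then show ?thesis unfolding L using nc2 by (simp add: near_cyc_def sign_swap_id)
  qed
next
  case (Suc n)
  have n0: "0 < n" using Suc.hyps by simp
  from Suc.prems show ?case
  proof (cases rule: perms_Suc_cases)
    case 1
    \<comment> \<open>Over all \<open>i\<close>, the insertion destroys each fixed point of
      \<open>p o s\<close> exactly once; this takes one copy of \<open>near_cyc\<close> away from
      \<open>n\<close> copies.\<close>
    have "(\<Sum>i<n. near_cyc (Suc n) (p \<circ> (swap i n \<circ> s))) = of_nat (n - 1) * (near_cyc n (p \<circ> s)::real)"
      if s: "s \<in> perms n" for s
    proof -
      let ?k = "p \<circ> s"
      have k: "?k \<in> perms n" using 1 s by (rule perms_comp)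
      have "(\<Sum>i<n. near_cyc (Suc n) (p \<circ> (swap i n \<circ> s))) =
          (\<Sum>i<n. near_cyc (Suc n) (?k \<circ> swap (inv_into UNIV s i) n) :: real)"
        unfolding transpose_comp_perms[OF s] by (simp add: o_assoc)
      also have "\<dots> = (\<Sum>i<n. near_cyc (Suc n) (?k \<circ> swap i n))"
        by (rule sum.reindex_bij_betw[OF perms_bij[OF perms_inv[OF s]]])
      also have "\<dots> = (\<Sum>i<n. near_cyc n ?k - of_bool (nc n ?k = 2 \<and> ?k i = i))"
        by (intro sum.cong refl near_cyc_Suc_swap[OF k]) simp
      also have "\<dots> = of_nat n * near_cyc n ?k - (\<Sum>i<n. of_bool (nc n ?k = 2 \<and> ?k i = i))"
        by (simp add: sum_subtractf)
      also have "(\<Sum>i<n. of_bool (nc n ?k = 2 \<and> ?k i = i)) = (near_cyc n ?k :: real)"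
        unfolding near_cyc_def by (simp add: Int_def of_bool_def sum.If_cases conj_commute)
      finally show ?thesis using n0 by (simp add: of_nat_diff algebra_simps o_def)
    qed
    then have "(\<Sum>s\<in>perms (Suc n). one_cyc (Suc n) s * near_cyc (Suc n) (p \<circ> s)) =
        (of_nat (n - 1) * (\<Sum>s\<in>perms n. one_cyc n s * near_cyc n (p \<circ> s)) :: real)"
      unfolding sum_one_cyc_Suc[OF n0] by (simp add: sum_distrib_left mult_ac del: o_apply)
    also have "\<dots> = fact (Suc n - 2) * (1 - of_int (sign p))"
      unfolding Suc.IH[OF 1] using Suc.hyps fact_reduce[of "n - 1", where ?'a = real]
      by (simp add: mult.assoc numeral_2_eq_2 Suc_diff_Suc)
    finally show ?thesis .
  next
    case (2 q j)
    note q = 2(1) and j = 2(2)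
    have swap: "q \<circ> swap i j \<in> perms n" if "i < n" for i
      using q j that by (simp add: perms_comp perms_transpose)
    have "(\<Sum>i<n. near_cyc (Suc n) (p \<circ> (swap i n \<circ> s))) =
        (\<Sum>i\<in>{..<n} - {j}. near_cyc n (q \<circ> swap i j \<circ> s) :: real)" if s: "s \<in> perms n" for s
    proof -
      define j' where "j' = inv_into UNIV s j"
      have j': "j' < n" "s j' = j" using perms_less[OF perms_inv[OF s] j] s by (simp_all add: j'_def)
      have A: "near_cyc (Suc n) (p \<circ> (swap j n \<circ> s)) = (one_cyc n (q \<circ> s) :: real)"
      proof -
        have "p \<circ> (swap j n \<circ> s) = q \<circ> s" unfolding 2(3) by (rule swap_cancel)
        then show ?thesis using near_cyc_Suc[OF perms_comp[OF q s] Suc.hyps] by simp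
      qed
      have B: "near_cyc (Suc n) (p \<circ> (swap i n \<circ> s)) =
          near_cyc n (q \<circ> swap i j \<circ> s) - (of_bool (nc n (q \<circ> swap i j \<circ> s) = 2 \<and> q i = j') :: real)"
        if i: "i < n" "i \<noteq> j" for i
      proof -
        have e: "p \<circ> (swap i n \<circ> s) = (q \<circ> swap i j \<circ> s) \<circ> swap j' n"
          unfolding 2(3) j'_def by (rule swap_swap_comp[OF s i(1) j i(2)])
        have "(q \<circ> swap i j \<circ> s) j' = q i" using j' by simp
        then show ?thesis unfolding e
          using near_cyc_Suc_swap[OF perms_comp[OF swap[OF i(1)] s] j'(1)] by simp
      qed
      define k where "k = s \<circ> q"
      have k: "k \<in> perms n" using s q by (simp add: k_def perms_comp)
      \<comment> \<open>Only one index \<open>i0\<close> has \<open>q i0 = j'\<close>, that is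
        \<open>k i0 = j\<close>. If \<open>i0 = j\<close>, then \<open>k\<close> fixes
        \<open>j\<close> and is no \<open>n\<close>-cycle; otherwise the transposition cuts
        \<open>j\<close> out of \<open>k\<close> and adds one cycle. Since \<open>k\<close> and
        \<open>q o s\<close> are conjugate, the sum tests whether \<open>q o s\<close> is an
        \<open>n\<close>-cycle and cancels the term \<open>A\<close>.\<close>
      have C: "(\<Sum>i\<in>{..<n} - {j}. of_bool (nc n (q \<circ> swap i j \<circ> s) = 2 \<and> q i = j')) = (one_cyc n (q \<circ> s) :: real)"
      proof -
        define i0 where "i0 = inv_into UNIV q j'"
        have i0: "i0 < n" "q i0 = j'" using perms_less[OF perms_inv[OF q] j'(1)] q by (simp_all add: i0_def)
        have i0_iff: "q i = j' \<longleftrightarrow> i = i0" for i using i0 perms_inj_iff[OF q] by metis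
        have ki0: "k i0 = j" using i0 j' by (simp add: k_def)
        have eq: "nc n (q \<circ> s) = nc n k" unfolding k_def using nc_conj[OF q s] .
        have L: "(\<Sum>i\<in>{..<n} - {j}. of_bool (nc n (q \<circ> swap i j \<circ> s) = 2 \<and> q i = j')) =
            (if i0 \<noteq> j then of_bool (nc n (q \<circ> swap i0 j \<circ> s) = 2) else 0 :: real)"
        proof -
          have "(\<Sum>i\<in>{..<n} - {j}. of_bool (nc n (q \<circ> swap i j \<circ> s) = 2 \<and> q i = j')) =
            (\<Sum>i\<in>{..<n} - {j}. if i = i0 then of_bool (nc n (q \<circ> swap i0 j \<circ> s) = 2) else 0 :: real)"
            by (intro sum.cong) (auto simp: i0_iff)
          then show ?thesis using i0 by simp
        qed
        show ?thesis
        proof (cases "i0 = j")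
          case True
          then have "2 \<le> nc n k" using nc_fix_ge_2[OF k Suc.hyps j] ki0 by simp
          then show ?thesis unfolding L one_cyc_def eq using True by simp
        next
          case False
          have "nc n (q \<circ> swap i0 j \<circ> s) = nc n (s \<circ> (q \<circ> swap i0 j))"
            by (rule nc_conj[OF swap[OF i0(1)] s])
          also have "s \<circ> (q \<circ> swap i0 j) = k \<circ> swap i0 j" by (simp add: k_def o_assoc)
          also have "nc n (k \<circ> swap i0 j) = Suc (nc n k)"
            by (rule nc_comp_swap_fix[OF k i0(1) j False ki0])
          finally have e: "nc n (q \<circ> swap i0 j \<circ> s) = Suc (nc n k)" .
          show ?thesis unfolding L one_cyc_def eq e using False by simp
        qed
      qed
      have "(\<Sum>i<n. near_cyc (Suc n) (p \<circ> (swap i n \<circ> s))) =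
          (one_cyc n (q \<circ> s) :: real) + (\<Sum>i\<in>{..<n} - {j}. near_cyc (Suc n) (p \<circ> (swap i n \<circ> s)))"
        using j A by (subst sum.remove[of _ j]) auto
      also have "(\<Sum>i\<in>{..<n} - {j}. near_cyc (Suc n) (p \<circ> (swap i n \<circ> s)) :: real) =
         (\<Sum>i\<in>{..<n} - {j}. near_cyc n (q \<circ> swap i j \<circ> s) -
             of_bool (nc n (q \<circ> swap i j \<circ> s) = 2 \<and> q i = j'))"
        by (intro sum.cong refl B) auto
      finally show ?thesis unfolding sum_subtractf C by (simp add: o_def)
    qed
    then have "(\<Sum>s\<in>perms (Suc n). one_cyc (Suc n) s * near_cyc (Suc n) (p \<circ> s)) =
        (\<Sum>s\<in>perms n. \<Sum>i\<in>{..<n} - {j}. one_cyc n s * near_cyc n (q \<circ> swap i j \<circ> s) :: real)"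
      unfolding sum_one_cyc_Suc[OF n0] by (simp add: sum_distrib_left del: o_apply)
    also have "\<dots> = (\<Sum>i\<in>{..<n} - {j}. fact (n - 2) * (1 - of_int (sign (q \<circ> swap i j))))"
      by (subst sum.swap) (intro sum.cong refl Suc.IH swap, auto)
    \<comment> \<open>For \<open>i\<close> different from \<open>j\<close>,
      \<open>q o swap i j\<close> has the same sign as \<open>p = q o swap j n\<close>, so the
      \<open>n - 1\<close> summands are equal.\<close>
    also have "\<dots> = (\<Sum>i\<in>{..<n} - {j}. fact (n - 2) * (1 - of_int (sign p)))"
    proof (intro sum.cong refl)
      fix i assume i: "i \<in> {..<n} - {j}"
      have "sign (q \<circ> swap i j) = sign q * sign (swap i j)" "sign p = sign q * sign (swap j n)"
        unfolding 2(3) by (intro sign_compose perms_permutation[OF q] permutation_swap_id)+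
      then show "fact (n - 2) * (1 - of_int (sign (q \<circ> swap i j))) = (fact (n - 2) * (1 - of_int (sign p)) :: real)"
        using i j by (simp add: sign_swap_id)
    qed
    also have "\<dots> = of_nat (n - 1) * (fact (n - 2) * (1 - of_int (sign p)))" using j by simp
    also have "\<dots> = fact (Suc n - 2) * (1 - of_int (sign p))"
      using Suc.hyps fact_reduce[of "n - 1", where ?'a = real]
      by (simp add: mult.assoc numeral_2_eq_2 Suc_diff_Suc)
    finally show ?thesis .
  qed
qed

section \<open>Multiplying by a random long cycle\<close>

lemma orbit_funpow_param:
  fixes p :: "'a \<Rightarrow> 'a" and j :: 'a
  assumes p: "p permutes A" "finite A"
  defines "L \<equiv> card (orbit p j)"
  shows "bij_betw (\<lambda>s. (p ^^ s) j) {..<L} (orbit p j)" and "(p ^^ L) j = j" and "0 < L"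
proof -
  let ?d = "funpow_dist1 p j j"
  have self: "j \<in> orbit p j" by (rule self_in_orbit_permutes[OF p])
  have bij: "bij_betw (\<lambda>s. (p ^^ s) j) {0..<?d} (orbit p j)"
    unfolding bij_betw_def using inj_on_funpow_dist1[OF self] orbit_conv_funpow_dist1[OF self] by metis
  then have "L = ?d" unfolding L_def using bij_betw_same_card by fastforce
  then show "bij_betw (\<lambda>s. (p ^^ s) j) {..<L} (orbit p j)" "(p ^^ L) j = j" "0 < L"
    using bij funpow_dist1_prop[OF self] by (simp_all add: atLeast0LessThan)
qed

text \<open>Neither new cycle has to be determined exactly: two sets closed under the new
  permutation bound their lengths by \<open>s\<close> and \<open>L - s\<close>, and since merging
  them again gives back the cycle of length \<open>L\<close>, both bounds are attained.\<close>

lemma wt_split: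
  assumes p: "p permutes A" "finite A" and j: "j \<in> A"
    and s: "0 < s" "s < card (orbit p j)"
  shows "wt f A (p \<circ> swap j ((p ^^ s) j)) =
    f s * f (card (orbit p j) - s) * (\<Prod>C\<in>cycs A p - {orbit p j}. f (card C))"
proof -
  define L where "L = card (orbit p j)"
  define k where "k = (p ^^ s) j"
  define q where "q = p \<circ> swap j k"
  note par = orbit_funpow_param[OF p, of j, folded L_def]
  have kA: "k \<in> A"
    unfolding k_def using p(1) j by (simp add: permutes_in_funpow_image)
  have inj: "(p ^^ a) j = (p ^^ b) j \<longleftrightarrow> a = b" if "a < L" "b < L" for a b
    using inj_onD[OF bij_betw_imp_inj_on[OF par(1)]] that by auto
  have q: "q permutes A" unfolding q_def using p j kA by (simp add: permutes_compose permutes_swap_id)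
  note selfq = self_in_orbit_permutes[OF q p(2)]
  \<comment> \<open>The exponents start at 1 because \<open>q\<close> sends \<open>k\<close> to
    \<open>p j\<close>. The point \<open>j\<close> itself appears as the last power
    \<open>(p ^^ L) j\<close> and so belongs to \<open>T\<close>.\<close>
  define S where "S = (\<lambda>i. (p ^^ i) j) ` {1..s}"
  define T where "T = (\<lambda>i. (p ^^ i) j) ` {s<..L}"
  have sL: "s < L" using s by (simp add: L_def)
  have jk: "j \<noteq> k" using inj[of 0 s] s sL by (simp add: k_def)
  have jS: "j \<notin> S"
  proof
    assume "j \<in> S"
    then obtain i where "1 \<le> i" "i \<le> s" "(p ^^ i) j = (p ^^ 0) j" by (auto simp: S_def)
    then show False using inj[of i 0] sL by simp
  qed
  have kS: "k \<in> S" using s by (auto simp: S_def k_def)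
  have jT: "j \<in> T" using par(2) sL by (force simp: T_def)
  have kT: "k \<notin> T"
  proof
    assume "k \<in> T"
    then obtain i where i: "s < i" "i \<le> L" "(p ^^ i) j = (p ^^ s) j" by (auto simp: T_def k_def)
    show False
    proof (cases "i = L")
      case True
      then show ?thesis using i par(2) inj[of s 0] s sL by simp
    next
      case False
      then show ?thesis using i inj[of i s] sL by simp
    qed
  qed
  have closed: "orbit q x \<subseteq> U" if "x \<in> U" "\<And>y. y \<in> U \<Longrightarrow> q y \<in> U" for x U
  proof
    fix y assume "y \<in> orbit q x"
    then show "y \<in> U"
      by (induction rule: orbit.induct) (use that in blast)+
  qed
  have oS: "orbit q k \<subseteq> S"
  proof (rule closed[OF kS])
    fix y assume "y \<in> S"
    then obtain i where i: "1 \<le> i" "i \<le> s" "y = (p ^^ i) j" by (auto simp: S_def)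
    show "q y \<in> S"
    proof (cases "y = k")
      case True
      then have "q y = (p ^^ 1) j" by (simp add: q_def)
      then show ?thesis unfolding S_def using s by (metis One_nat_def Suc_leI atLeastAtMost_iff image_eqI le_refl)
    next
      case False
      then have "i \<noteq> s" using i by (auto simp: k_def)
      moreover have "y \<noteq> j" using jS \<open>y \<in> S\<close> by auto
      ultimately have "q y = (p ^^ Suc i) j" "Suc i \<le> s" using False i by (simp_all add: q_def)
      then show ?thesis unfolding S_def using i by (metis atLeastAtMost_iff image_eqI le_SucI)
    qed
  qed
  have oT: "orbit q j \<subseteq> T"
  proof (rule closed[OF jT])
    fix y assume "y \<in> T"
    then obtain i where i: "s < i" "i \<le> L" "y = (p ^^ i) j" by (auto simp: T_def)
    show "q y \<in> T"
    proof (cases "y = j")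
      case True
      then have "q y = (p ^^ Suc s) j" by (simp add: q_def k_def)
      then show ?thesis unfolding T_def using sL by (metis Suc_leI greaterThanAtMost_iff image_eqI lessI)
    next
      case False
      then have "i \<noteq> L" using i par(2) by auto
      moreover have "y \<noteq> k" using kT \<open>y \<in> T\<close> by auto
      ultimately have "q y = (p ^^ Suc i) j" "Suc i \<le> L" using False i by (simp_all add: q_def)
      then show ?thesis unfolding T_def using i by (metis greaterThanAtMost_iff image_eqI less_SucI)
    qed
  qed
  have k': "k \<notin> orbit q j" using oT kT by auto
  have pq: "q \<circ> swap j k = p" by (simp add: q_def o_assoc[symmetric])
  have oj: "orbit p j = orbit q j \<union> orbit q k"
    using orbit_comp_swap[OF q p(2) k', of j] selfq[of j] unfolding pq by simp
  have cycs: "cycs A p = insert (orbit p j) (cycs A q - {orbit q j, orbit q k})"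
    using cycs_comp_swap[OF q p(2) j kA k'] unfolding pq oj .
  have dis: "orbit q j \<inter> orbit q k = {}" by (rule orbit_disjoint_permutes[OF q p(2) k'])
  have fin: "finite (orbit q x)" for x using finite_orbit[OF selfq] .
  have L_eq: "L = card (orbit q j) + card (orbit q k)"
    unfolding L_def oj by (rule card_Un_disjoint[OF fin fin dis])
  have "card (orbit q k) \<le> card S" by (rule card_mono[OF _ oS]) (simp add: S_def)
  also have "\<dots> \<le> s" unfolding S_def using card_image_le[of "{1..s}"] by simp
  finally have c1: "card (orbit q k) \<le> s" .
  have "card (orbit q j) \<le> card T" by (rule card_mono[OF _ oT]) (simp add: T_def)
  also have "\<dots> \<le> L - s" unfolding T_def using card_image_le[of "{s<..L}"] by simp
  finally have c2: "card (orbit q j) \<le> L - s" .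
  have cards: "card (orbit q k) = s" "card (orbit q j) = L - s" using c1 c2 L_eq sL by linarith+
  have "orbit p j \<notin> cycs A q - {orbit q j, orbit q k}"
  proof
    assume "orbit p j \<in> cycs A q - {orbit q j, orbit q k}"
    then obtain x where "orbit p j = orbit q x" "orbit q x \<noteq> orbit q j" by (auto simp: cycs_def)
    then show False using oj orbit_eq_permutes[OF q p(2), of j x] selfq[of j] by auto
  qed
  then have rest: "cycs A p - {orbit p j} = cycs A q - {orbit q j, orbit q k}" using cycs by auto
  have "orbit q j \<noteq> orbit q k" using k' selfq[of k] by auto
  then have "wt f A q = f (card (orbit q j)) * (f (card (orbit q k)) * (\<Prod>C\<in>cycs A q - {orbit q j, orbit q k}. f (card C)))"
    unfolding wt_def using p(2) j kA
    by (subst prod.remove[of _ "orbit q j"], simp, simp add: cycs_def, subst prod.remove[of _ "orbit q k"])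
       (auto simp: cycs_def Diff_insert2[symmetric] insert_commute)
  then show ?thesis unfolding rest cards by (simp add: q_def k_def L_def mult_ac)
qed

lemma sum_over_cycs:
  fixes h :: "'a set \<Rightarrow> 'b::comm_semiring_1"
  assumes p: "p permutes A" "finite A"
  shows "(\<Sum>k\<in>A - orbit p j. h (orbit p k)) = (\<Sum>C\<in>cycs A p - {orbit p j}. of_nat (card C) * h C)"
proof -
  note self = self_in_orbit_permutes[OF p]
  have "(\<Sum>k\<in>A - orbit p j. h (orbit p k)) =
      (\<Sum>C\<in>cycs A p - {orbit p j}. \<Sum>k\<in>{k\<in>A - orbit p j. orbit p k = C}. h (orbit p k))"
  proof (rule sum.group[symmetric])
    show "orbit p ` (A - orbit p j) \<subseteq> cycs A p - {orbit p j}"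
      using self by (auto simp: cycs_def)
  qed (use p in auto)
  also have "\<dots> = (\<Sum>C\<in>cycs A p - {orbit p j}. of_nat (card C) * h C)"
  proof (rule sum.cong[OF refl])
    fix C assume C: "C \<in> cycs A p - {orbit p j}"
    then obtain x where x: "x \<in> A" "C = orbit p x" by (auto simp: cycs_def)
    have "{k\<in>A - orbit p j. orbit p k = C} = C"
    proof (intro equalityI subsetI)
      fix k assume "k \<in> {k\<in>A - orbit p j. orbit p k = C}"
      then show "k \<in> C" using self[of k] by auto
    next
      fix k assume k: "k \<in> C"
      then have "orbit p k = C" using x orbit_eq_permutes[OF p] by simp
      moreover have "k \<in> A" using k C cycs_subset[OF p(1)] by auto
      moreover have "k \<notin> orbit p j" using calculation(1) C orbit_eq_permutes[OF p, of k j] by auto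
      ultimately show "k \<in> {k\<in>A - orbit p j. orbit p k = C}" by simp
    qed
    then show "(\<Sum>k\<in>{k\<in>A - orbit p j. orbit p k = C}. h (orbit p k)) = of_nat (card C) * h C"
      by (simp add: sum.cong[of C C "\<lambda>k. h (orbit p k)" "\<lambda>_. h C"] x orbit_eq_permutes[OF p])
  qed
  finally show ?thesis .
qed

section \<open>Generating function of the number of cycles of \<open>p o s\<close>\<close>

text \<open>The ring is left open because \<open>t\<close> is taken to be a real number, the
  variable of a polynomial, and \<open>fps_X\<close>.\<close>

definition cyc_poly :: "'b \<Rightarrow> nat \<Rightarrow> (nat \<Rightarrow> nat) \<Rightarrow> 'b::comm_ring_1" where
  "cyc_poly t n p = wt (\<lambda>l. 1 - t ^ l) {..<n} p"

lemma fps_deriv_prod_sum: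
  fixes f :: "'a \<Rightarrow> 'b::comm_ring_1 fps"
  assumes "finite S"
  shows "fps_deriv (\<Prod>x\<in>S. f x) = (\<Sum>x\<in>S. fps_deriv (f x) * (\<Prod>y\<in>S - {x}. f y))"
  using assms
proof (induction S)
  case (insert x S)
  have "(\<Sum>y\<in>S. fps_deriv (f y) * (\<Prod>z\<in>insert x S - {y}. f z)) =
      (\<Sum>y\<in>S. f x * (fps_deriv (f y) * (\<Prod>z\<in>S - {y}. f z)))"
  proof (rule sum.cong[OF refl])
    fix y assume "y \<in> S"
    then have "insert x S - {y} = insert x (S - {y})" "x \<notin> S - {y}" using insert.hyps by auto
    then show "fps_deriv (f y) * (\<Prod>z\<in>insert x S - {y}. f z) = f x * (fps_deriv (f y) * (\<Prod>z\<in>S - {y}. f z))"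
      using insert.hyps by (simp add: mult_ac)
  qed
  moreover have "insert x S - {x} = S" using insert.hyps by auto
  ultimately show ?case using insert by (simp add: sum_distrib_left add.commute)
qed simp

lemma fps_X_deriv_one_minus:
  "fps_X * fps_deriv (1 - fps_X ^ l) = (- of_nat l * fps_X ^ l :: 'a::comm_ring_1 fps)"
proof -
  have "fps_X * fps_deriv (fps_X ^ l) = (of_nat l * fps_X ^ l :: 'a fps)"
  proof (induction l)
    case (Suc l)
    have "fps_X * fps_deriv (fps_X ^ Suc l) = fps_X * (fps_X * fps_deriv (fps_X ^ l)) + (fps_X ^ Suc l :: 'a fps)"
      by (simp add: distrib_left)
    then show ?case unfolding Suc by (simp add: algebra_simps)
  qed simp
  then show ?thesis by simp
qed

text \<open>Collects the ways to split a cycle of length \<open>L\<close> in two. In each product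
  the powers recombine to \<open>t ^ L\<close>, and the factor \<open>1 - t\<close> sums the
  remaining geometric series without a division.\<close>

lemma geometric_pair_sum:
  fixes t :: "'a::comm_ring_1"
  assumes "0 < L"
  shows "(1 - t) * (\<Sum>s=1..<L. (1 - t ^ s) * (1 - t ^ (L - s))) =
    of_nat (L - 1) * (1 + t ^ L) * (1 - t) - 2 * (t - t ^ L)"
proof -
  have a: "(1 - t) * (\<Sum>s=1..<L. t ^ s) = t - t ^ L"
    using assms
  proof (induction L rule: nat_induct_non_zero)
    case (Suc n)
    have "(1 - t) * (\<Sum>s=1..<Suc n. t ^ s) = (1 - t) * (\<Sum>s=1..<n. t ^ s) + (1 - t) * t ^ n"
      using Suc.hyps by (simp add: distrib_left)
    then show ?case unfolding Suc.IH by (simp add: algebra_simps)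
  qed simp
  have b: "(\<Sum>s=1..<L. t ^ (L - s)) = (\<Sum>s=1..<L. t ^ s)"
    by (rule sum.reindex_bij_witness[of _ "\<lambda>s. L - s" "\<lambda>s. L - s"]) auto
  have "(1 - t ^ s) * (1 - t ^ (L - s)) = 1 + t ^ L - t ^ s - t ^ (L - s)" if "s \<in> {1..<L}" for s
  proof -
    have "t ^ s * t ^ (L - s) = t ^ L" using that by (simp flip: power_add)
    then show ?thesis by (simp add: algebra_simps)
  qed
  then have "(\<Sum>s=1..<L. (1 - t ^ s) * (1 - t ^ (L - s))) =
      of_nat (L - 1) * (1 + t ^ L) - 2 * (\<Sum>s=1..<L. t ^ s)"
    by (simp add: sum_subtractf sum.distrib b[simplified] algebra_simps)
  then have "(1 - t) * (\<Sum>s=1..<L. (1 - t ^ s) * (1 - t ^ (L - s))) =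
      of_nat (L - 1) * (1 + t ^ L) * (1 - t) - 2 * ((1 - t) * (\<Sum>s=1..<L. t ^ s))"
    by (simp only:) (simp only: algebra_simps)
  then show ?thesis unfolding a .
qed

text \<open>A transposition merging the cycle of \<open>j\<close>, of length \<open>L\<close>, with another cycle \<open>C\<close> produces the factor
  \<open>1 - X ^ (L + card C)\<close>; the derivative of the factor of \<open>C\<close> turns this into \<open>1 - X ^ card C\<close>, and so the
  sum depends on the other cycles only through \<open>R\<close>.\<close>

lemma cyc_poly_swap_sum:
  fixes p :: "nat \<Rightarrow> nat" and j n :: nat
  assumes p: "p \<in> perms n" and j: "j < n"
  defines "X \<equiv> fps_X :: real fps" and "L \<equiv> card (orbit p j)"
  defines "R \<equiv> \<Prod>C\<in>cycs {..<n} p - {orbit p j}. 1 - X ^ card C"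
  shows "(\<Sum>k\<in>{..<n} - {j}. cyc_poly X n (p \<circ> swap k j)) + X * fps_deriv (cyc_poly X n p) =
     R * (of_nat (n - L) + (\<Sum>s=1..<L. (1 - X ^ s) * (1 - X ^ (L - s))) - of_nat L * X ^ L)"
proof -
  have pp: "p permutes {..<n}" using p by (simp add: perms_def)
  note par = orbit_funpow_param[OF pp finite_lessThan, of j, folded L_def]
  note self = self_in_orbit_permutes[OF pp finite_lessThan]
  let ?c = "cycs {..<n} p" and ?O = "orbit p j" and ?A = "\<lambda>l. 1 - X ^ l"
  have Oc: "?O \<in> ?c" using j by (auto simp: cycs_def)
  have Osub: "?O \<subseteq> {..<n}" using permutes_orbit_subset[OF pp] j by simp
  have split: "(\<Sum>k\<in>?O - {j}. cyc_poly X n (p \<circ> swap k j)) =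
      R * (\<Sum>s=1..<L. ?A s * ?A (L - s))"
  proof -
    have "(\<lambda>s. (p ^^ s) j) ` ({..<L} - {0}) = ?O - {j}"
      using inj_on_image_set_diff[OF bij_betw_imp_inj_on[OF par(1)], of "{..<L}" "{0}"]
        bij_betw_imp_surj_on[OF par(1)] par(3) by simp
    then have "bij_betw (\<lambda>s. (p ^^ s) j) ({..<L} - {0}) (?O - {j})"
      by (intro bij_betw_subset[OF par(1)]) auto
    moreover have "{..<L} - {0} = {1..<L}" by auto
    ultimately have bij: "bij_betw (\<lambda>s. (p ^^ s) j) {1..<L} (?O - {j})" by simp
    have "(\<Sum>k\<in>?O - {j}. cyc_poly X n (p \<circ> swap k j)) =
        (\<Sum>s=1..<L. cyc_poly X n (p \<circ> swap j ((p ^^ s) j)))"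
      by (subst sum.reindex_bij_betw[OF bij, symmetric]) (simp add: transpose_commute)
    also have "\<dots> = (\<Sum>s=1..<L. ?A s * ?A (L - s) * R)"
      unfolding cyc_poly_def R_def L_def
      by (intro sum.cong refl wt_split[OF pp finite_lessThan]) (use j in auto)
    finally show ?thesis by (simp add: sum_distrib_left mult_ac)
  qed
  define R' where "R' = (\<lambda>C. \<Prod>C'\<in>?c - {?O, C}. ?A (card C'))"
  have RR': "R = ?A (card C) * R' C" if "C \<in> ?c - {?O}" for C
  proof -
    have "?c - {?O} - {C} = ?c - {?O, C}" by auto
    then show ?thesis unfolding R_def R'_def using prod.remove[OF _ that, of "\<lambda>C. ?A (card C)"] by simp
  qed
  have "(\<Sum>k\<in>{..<n} - ?O. cyc_poly X n (p \<circ> swap k j)) =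
      (\<Sum>k\<in>{..<n} - ?O. ?A (L + card (orbit p k)) * R' (orbit p k))"
  proof (rule sum.cong[OF refl])
    fix k assume k: "k \<in> {..<n} - ?O"
    then have "wt ?A {..<n} (p \<circ> swap j k) = ?A (L + card (orbit p k)) * R' (orbit p k)"
      using wt_comp_swap[OF pp finite_lessThan, of j k ?A] j by (simp add: R'_def L_def)
    then show "cyc_poly X n (p \<circ> swap k j) = ?A (L + card (orbit p k)) * R' (orbit p k)"
      by (simp add: cyc_poly_def transpose_commute)
  qed
  also have "\<dots> = (\<Sum>C\<in>?c - {?O}. of_nat (card C) * (?A (L + card C) * R' C))"
    by (rule sum_over_cycs[OF pp finite_lessThan, where h = "\<lambda>C. ?A (L + card C) * R' C"])
  finally have join: "(\<Sum>k\<in>{..<n} - ?O. cyc_poly X n (p \<circ> swap k j)) =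
      (\<Sum>C\<in>?c - {?O}. of_nat (card C) * (?A (L + card C) * R' C))" .
  have "X * fps_deriv (cyc_poly X n p) =
      (\<Sum>C\<in>?c. X * fps_deriv (?A (card C)) * (\<Prod>C'\<in>?c - {C}. ?A (card C')))"
    unfolding cyc_poly_def wt_def by (simp add: fps_deriv_prod_sum sum_distrib_left mult.assoc)
  also have "\<dots> = X * fps_deriv (?A L) * R +
      (\<Sum>C\<in>?c - {?O}. X * fps_deriv (?A (card C)) * (\<Prod>C'\<in>?c - {C}. ?A (card C')))"
    unfolding R_def L_def by (rule sum.remove[OF _ Oc]) simp
  also have "(\<Sum>C\<in>?c - {?O}. X * fps_deriv (?A (card C)) * (\<Prod>C'\<in>?c - {C}. ?A (card C'))) =
      (\<Sum>C\<in>?c - {?O}. - of_nat (card C) * X ^ card C * (?A L * R' C))"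
  proof (rule sum.cong[OF refl])
    fix C assume C: "C \<in> ?c - {?O}"
    have "?c - {C} - {?O} = ?c - {?O, C}" by auto
    then have "(\<Prod>C'\<in>?c - {C}. ?A (card C')) = ?A L * R' C"
      unfolding R'_def L_def using C Oc by (subst prod.remove[of _ ?O]) auto
    then show "X * fps_deriv (?A (card C)) * (\<Prod>C'\<in>?c - {C}. ?A (card C')) = - of_nat (card C) * X ^ card C * (?A L * R' C)"
      using fps_X_deriv_one_minus[of "card C", where ?'a = real] by (simp add: X_def)
  qed
  finally have der: "X * fps_deriv (cyc_poly X n p) = - of_nat L * X ^ L * R +
      (\<Sum>C\<in>?c - {?O}. - of_nat (card C) * X ^ card C * (?A L * R' C))"
    using fps_X_deriv_one_minus[of L, where ?'a = real] by (simp add: X_def)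
  \<comment> \<open>With \<open>c = card C\<close>, termwise
    \<open>(1 - X^(L+c)) - X^c * (1 - X^L) = 1 - X^c\<close>, which is the factor that
    \<open>R' C\<close> lacks compared with \<open>R\<close>; the weights \<open>c\<close> then add
    up to \<open>n - L\<close>.\<close>
  have "(\<Sum>C\<in>?c - {?O}. of_nat (card C) * (?A (L + card C) * R' C)) +
      (\<Sum>C\<in>?c - {?O}. - of_nat (card C) * X ^ card C * (?A L * R' C)) =
      (\<Sum>C\<in>?c - {?O}. of_nat (card C) * R)"
    unfolding sum.distrib[symmetric]
  proof (rule sum.cong[OF refl])
    fix C assume C: "C \<in> ?c - {?O}"
    show "of_nat (card C) * (?A (L + card C) * R' C) + - of_nat (card C) * X ^ card C * (?A L * R' C) = of_nat (card C) * R"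
      unfolding RR'[OF C] by (simp add: algebra_simps power_add)
  qed
  also have "\<dots> = (\<Sum>k\<in>{..<n} - ?O. R)"
    by (rule sum_over_cycs[OF pp finite_lessThan, symmetric, where h = "\<lambda>_. R"])
  also have "\<dots> = of_nat (n - L) * R"
    using Osub by (simp add: card_Diff_subset finite_subset L_def)
  finally have J: "(\<Sum>C\<in>?c - {?O}. of_nat (card C) * (?A (L + card C) * R' C)) +
      (\<Sum>C\<in>?c - {?O}. - of_nat (card C) * X ^ card C * (?A L * R' C)) = of_nat (n - L) * R" .
  have "{..<n} - {j} = ({..<n} - ?O) \<union> (?O - {j})" using Osub self[of j] by auto
  moreover have "finite ?O" using Osub finite_subset by blast
  ultimately have "(\<Sum>k\<in>{..<n} - {j}. cyc_poly X n (p \<circ> swap k j)) =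
      (\<Sum>k\<in>{..<n} - ?O. cyc_poly X n (p \<circ> swap k j)) + (\<Sum>k\<in>?O - {j}. cyc_poly X n (p \<circ> swap k j))"
    by (simp only:) (rule sum.union_disjoint; auto)
  then show ?thesis unfolding join split der using J by (simp add: algebra_simps)
qed

text \<open>The base \<open>q\<close> is a natural number because the values for all
  \<open>q\<close> become the coefficients of one power series in \<open>wsum_gf\<close>.\<close>

definition wsum :: "nat \<Rightarrow> nat \<Rightarrow> (nat \<Rightarrow> nat) \<Rightarrow> real" where
  "wsum n q p = (\<Sum>s\<in>perms n. one_cyc n s * real q ^ nc n (p \<circ> s))"

lemma wsum_Suc:
  assumes p: "p \<in> perms n" and n: "0 < n"
  shows "wsum (Suc n) q p = real n * wsum n q p"
proof -
  have "(\<Sum>i<n. real q ^ nc (Suc n) (p \<circ> (swap i n \<circ> s))) = real n * real q ^ nc n (p \<circ> s)"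
    if s: "s \<in> perms n" for s
  proof -
    have "nc (Suc n) (p \<circ> (swap i n \<circ> s)) = nc n (p \<circ> s)" if "i < n" for i
    proof -
      have "inv_into UNIV s i < n" using perms_less[OF perms_inv[OF s] that] .
      then have "nc (Suc n) ((p \<circ> s) \<circ> swap (inv_into UNIV s i) n) = nc n (p \<circ> s)"
        by (rule nc_Suc_swap[OF perms_comp[OF p s]])
      then show ?thesis unfolding transpose_comp_perms[OF s] by (simp add: o_assoc)
    qed
    then show ?thesis by (simp del: o_apply)
  qed
  then show ?thesis unfolding wsum_def sum_one_cyc_Suc[OF n]
    by (simp add: sum_distrib_left mult_ac)
qed

text \<open>Of the \<open>n\<close> ways to extend \<open>s\<close>, the choice \<open>i = j\<close>
  cancels the transposition and leaves \<open>n\<close> as a cycle of its own, whence the factor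
  \<open>q\<close>; every other choice inserts \<open>n\<close> into a cycle of
  \<open>p o swap i j o s\<close>.\<close>

lemma wsum_Suc_swap:
  assumes p: "p \<in> perms n" and n: "0 < n" and j: "j < n"
  shows "wsum (Suc n) q (p \<circ> swap j n) =
    real q * wsum n q p + (\<Sum>i\<in>{..<n} - {j}. wsum n q (p \<circ> swap i j))"
proof -
  have "(\<Sum>i<n. real q ^ nc (Suc n) (p \<circ> swap j n \<circ> (swap i n \<circ> s))) =
      real q * real q ^ nc n (p \<circ> s) + (\<Sum>i\<in>{..<n} - {j}. real q ^ nc n (p \<circ> swap i j \<circ> s))"
    if s: "s \<in> perms n" for s
  proof -
    have A: "real q ^ nc (Suc n) (p \<circ> swap j n \<circ> (swap j n \<circ> s)) = real q * real q ^ nc n (p \<circ> s)"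
      unfolding swap_cancel nc_Suc[OF perms_comp[OF p s]] by simp
    have B: "nc (Suc n) (p \<circ> swap j n \<circ> (swap i n \<circ> s)) = nc n (p \<circ> swap i j \<circ> s)"
      if i: "i < n" "i \<noteq> j" for i
      unfolding swap_swap_comp[OF s i(1) j i(2)]
      using i j p s by (intro nc_Suc_swap perms_comp perms_transpose perms_less[OF perms_inv])
    have "(\<Sum>i\<in>{..<n} - {j}. real q ^ nc (Suc n) (p \<circ> swap j n \<circ> (swap i n \<circ> s))) =
        (\<Sum>i\<in>{..<n} - {j}. real q ^ nc n (p \<circ> swap i j \<circ> s))"
      by (intro sum.cong refl arg_cong2[of _ _ _ _ power] B) auto
    then show ?thesis using j A by (subst sum.remove[of _ j]) auto
  qed
  then have "wsum (Suc n) q (p \<circ> swap j n) = (\<Sum>s\<in>perms n. one_cyc n s *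
      (real q * real q ^ nc n (p \<circ> s) + (\<Sum>i\<in>{..<n} - {j}. real q ^ nc n (p \<circ> swap i j \<circ> s))))"
    unfolding wsum_def sum_one_cyc_Suc[OF n] by (intro sum.cong refl arg_cong2[of _ _ _ _ times])
  also have "\<dots> = real q * wsum n q p + (\<Sum>s\<in>perms n. \<Sum>i\<in>{..<n} - {j}. one_cyc n s * real q ^ nc n (p \<circ> swap i j \<circ> s))"
    unfolding wsum_def by (simp add: distrib_left sum.distrib sum_distrib_left mult_ac del: o_apply)
  also have "(\<Sum>s\<in>perms n. \<Sum>i\<in>{..<n} - {j}. one_cyc n s * real q ^ nc n (p \<circ> swap i j \<circ> s)) =
      (\<Sum>i\<in>{..<n} - {j}. wsum n q (p \<circ> swap i j))"
    unfolding wsum_def by (rule sum.swap)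
  finally show ?thesis .
qed

text \<open>A fixed top point multiplies the series by \<open>n\<close>. An inserted one produces
  the operator \<open>X d/dX\<close> and a sum over transpositions; the induction hypothesis
  expresses both by \<open>cyc_poly\<close>, and \<open>cyc_poly_swap_sum\<close> evaluates exactly
  the combination that arises.\<close>

lemma wsum_gf:
  assumes "0 < n" "p \<in> perms n"
  shows "Abs_fps (\<lambda>q. wsum n q p) * (1 - fps_X) ^ (n + 2) = fact (n - 1) * fps_X * cyc_poly fps_X n p"
  using assms
proof (induction n arbitrary: p rule: nat_induct_non_zero)
  case 1
  have p1: "perms 1 = {id}" by (simp add: perms_def lessThan_Suc)
  have id0: "id \<in> perms 0" by simp
  have nc1: "nc 1 id = 1" using nc_Suc[OF id0] by simp
  have c: "cyc_poly fps_X 1 id = (1 - fps_X :: real fps)"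
    using wt_insert_fix[of id "{}" 0 "\<lambda>l. 1 - (fps_X :: real fps) ^ l"]
    by (simp add: cyc_poly_def lessThan_Suc wt_def cycs_def)
  have w: "wsum 1 q id = real q" for q using p1 nc1 by (simp add: wsum_def one_cyc_def)
  have "Abs_fps (\<lambda>q. real q) * (1 - fps_X) ^ 2 = fps_X"
  proof -
    have "Abs_fps (\<lambda>q. real q) * (1 - fps_X) = Abs_fps (\<lambda>q. if q = 0 then 0 else 1)"
      by (rule fps_ext) (simp add: algebra_simps of_nat_diff)
    moreover have "Abs_fps (\<lambda>q. if q = 0 then 0 else 1) * (1 - fps_X) = (fps_X :: real fps)"
      by (rule fps_ext) (simp add: right_diff_distrib fps_X_nth)
    ultimately show ?thesis by (simp add: power2_eq_square mult.assoc[symmetric])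
  qed
  then have "Abs_fps (\<lambda>q. real q) * (1 - fps_X) ^ (1 + 2) = fps_X * (1 - fps_X)"
    by (simp add: eval_nat_numeral mult.assoc[symmetric])
  moreover have p: "p = id" using 1 p1 by blast
  ultimately show ?case unfolding p w c by simp
next
  case (Suc n)
  define X :: "real fps" where "X = fps_X"
  define E where "E = 1 - X"
  define F where "F p = Abs_fps (\<lambda>q. wsum n q p)" for p
  define c :: "real fps" where "c = fact (n - 1)"
  have IH: "F r * E ^ (n + 2) = c * X * cyc_poly X n r" if "r \<in> perms n" for r
    using Suc.IH[OF that] by (simp add: F_def E_def X_def c_def)
  have fact: "fact (Suc n - 1) = of_nat n * c"
    using Suc.hyps fact_reduce[of n, where ?'a = "real fps"] by (simp add: c_def)
  from Suc.prems show ?case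
  proof (cases rule: perms_Suc_cases)
    case 1
    have "Abs_fps (\<lambda>q. wsum (Suc n) q p) = of_nat n * F p"
      by (rule fps_ext) (simp add: F_def wsum_Suc[OF 1 Suc.hyps] flip: fps_of_nat)
    moreover have "cyc_poly X (Suc n) p = E * cyc_poly X n p"
      using 1 wt_insert_fix[of p "{..<n}" n "\<lambda>l. 1 - X ^ l"]
      by (simp add: perms_def cyc_poly_def lessThan_Suc E_def)
    ultimately show ?thesis using IH[OF 1] unfolding fact E_def[symmetric] X_def[symmetric]
      by (simp add: mult_ac)
  next
    case (2 r j)
    note r = 2(1) and j = 2(2)
    define L where "L = card (orbit r j)"
    define R where "R = (\<Prod>C\<in>cycs {..<n} r - {orbit r j}. 1 - X ^ card C)"
    define D where "D = cyc_poly X n r"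
    define S where "S = (\<Sum>i\<in>{..<n} - {j}. cyc_poly X n (r \<circ> swap i j))"
    have rp: "r permutes {..<n}" using r by (simp add: perms_def)
    \<comment> \<open>The factor \<open>q\<close> of \<open>wsum_Suc_swap\<close> acts on generating
      functions as \<open>X d/dX\<close>.\<close>
    have F: "Abs_fps (\<lambda>q. wsum (Suc n) q p) = X * fps_deriv (F r) + (\<Sum>i\<in>{..<n} - {j}. F (r \<circ> swap i j))"
    proof (rule fps_ext)
      fix q
      have "fps_nth (X * fps_deriv (F r)) q = real q * wsum n q r"
        by (cases q) (simp_all add: X_def F_def)
      then show "fps_nth (Abs_fps (\<lambda>q. wsum (Suc n) q p)) q = fps_nth (X * fps_deriv (F r) + (\<Sum>i\<in>{..<n} - {j}. F (r \<circ> swap i j))) q"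
        unfolding 2(3) by (simp add: wsum_Suc_swap[OF r Suc.hyps j] F_def fps_sum_nth del: o_apply)
    qed
    have D_eq: "D = (1 - X ^ L) * R"
      unfolding D_def R_def L_def cyc_poly_def wt_def
      using j by (intro prod.remove) (auto simp: cycs_def)
    have D': "cyc_poly X (Suc n) p = (1 - X ^ Suc L) * R"
      using wt_insert_swap[OF rp, of n j "\<lambda>l. 1 - X ^ l"] j
      unfolding 2(3) by (simp add: cyc_poly_def lessThan_Suc L_def R_def)
    \<comment> \<open>The induction hypothesis is differentiated as a product, without division. The
      derivative of \<open>E ^ (n + 2)\<close> has one power of \<open>E\<close> less, so one more
      multiplication by \<open>E\<close> makes the hypothesis applicable again.\<close>
    have deriv: "fps_deriv (F r) * E ^ (n + 3) = c * E * (D + X * fps_deriv D) + of_nat (n + 2) * c * X * D"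
    proof -
      have c: "fps_deriv c = 0" unfolding c_def by (subst of_nat_fact[symmetric]) (rule fps_deriv_of_nat)
      have E: "fps_deriv (E ^ (n + 2)) = - of_nat (n + 2) * E ^ (n + 1)"
        by (simp only: fps_deriv_power') (simp add: E_def X_def)
      have "F r * fps_deriv (E ^ (n + 2)) + fps_deriv (F r) * E ^ (n + 2) = fps_deriv (c * X * D)"
        unfolding fps_deriv_mult[symmetric] IH[OF r] D_def ..
      also have "\<dots> = c * (D + X * fps_deriv D)" by (simp add: c X_def algebra_simps)
      finally have "fps_deriv (F r) * E ^ (n + 2) - of_nat (n + 2) * (F r * E ^ (n + 1)) = c * (D + X * fps_deriv D)"
        unfolding E by (simp only: algebra_simps minus_mult_left[symmetric] minus_mult_right[symmetric] add_uminus_conv_diff)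
      then have "(fps_deriv (F r) * E ^ (n + 2) - of_nat (n + 2) * (F r * E ^ (n + 1))) * E = c * (D + X * fps_deriv D) * E"
        by simp
      then have "fps_deriv (F r) * E ^ (n + 3) - of_nat (n + 2) * (F r * E ^ (n + 2)) = c * (D + X * fps_deriv D) * E"
        by (simp add: algebra_simps eval_nat_numeral)
      then show ?thesis unfolding IH[OF r] D_def[symmetric] by (simp add: algebra_simps)
    qed
    have "(\<Sum>i\<in>{..<n} - {j}. F (r \<circ> swap i j)) * E ^ (n + 2) = c * X * S"
      unfolding S_def sum_distrib_right sum_distrib_left
      by (intro sum.cong refl IH perms_comp r perms_transpose j) auto
    then have "(\<Sum>i\<in>{..<n} - {j}. F (r \<circ> swap i j)) * E ^ (n + 3) = c * X * S * E"
      by (simp add: eval_nat_numeral mult.assoc[symmetric])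
    then have "Abs_fps (\<lambda>q. wsum (Suc n) q p) * E ^ (n + 3) =
        c * X * (E * (D + (S + X * fps_deriv D)) + of_nat (n + 2) * X * D)"
      unfolding F distrib_right mult.assoc deriv by (simp add: algebra_simps)
    also have "S + X * fps_deriv D = R * (of_nat (n - L) + (\<Sum>s=1..<L. (1 - X ^ s) * (1 - X ^ (L - s))) - of_nat L * X ^ L)"
      unfolding S_def D_def R_def L_def X_def by (rule cyc_poly_swap_sum[OF r j])
    finally have G: "Abs_fps (\<lambda>q. wsum (Suc n) q p) * E ^ (n + 3) = c * X * R *
        (E * (1 - X ^ L) + E * of_nat (n - L) + E * (\<Sum>s=1..<L. (1 - X ^ s) * (1 - X ^ (L - s)))
          - E * of_nat L * X ^ L + of_nat (n + 2) * X * (1 - X ^ L))"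
      unfolding D_eq by (simp add: algebra_simps)
    have L: "0 < L" "L \<le> n"
      unfolding L_def using orbit_funpow_param(3)[OF rp, of j] card_mono[OF _ permutes_orbit_subset[OF rp, of j]] j
      by auto
    have geo: "E * (\<Sum>s=1..<L. (1 - X ^ s) * (1 - X ^ (L - s))) = of_nat (L - 1) * (1 + X ^ L) * E - 2 * (X - X ^ L)"
      unfolding E_def by (rule geometric_pair_sum[OF L(1)])
    \<comment> \<open>Once \<open>R\<close> is split off, only \<open>X\<close>,
      \<open>X ^ L\<close> and the numbers \<open>n\<close>, \<open>L\<close> are left; the bracket
      collapses to \<open>n * (1 - X ^ Suc L)\<close>.\<close>
    have "Abs_fps (\<lambda>q. wsum (Suc n) q p) * E ^ (n + 3) = of_nat n * c * X * ((1 - X ^ Suc L) * R)"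
      unfolding G geo unfolding E_def using L by (simp add: of_nat_diff algebra_simps)
    then show ?thesis unfolding fact D'[symmetric] by (simp add: E_def X_def eval_nat_numeral)
  qed
qed

section \<open>Orthogonality of hook characters\<close>

text \<open>\<open>cyc_index n w / fact n\<close> is the cycle index of the symmetric group, with
  its variables replaced by the values of \<open>w\<close>.\<close>

definition cyc_index :: "nat \<Rightarrow> (nat \<Rightarrow> real) \<Rightarrow> real" where
  "cyc_index n w = (\<Sum>p\<in>perms n. wt w {..<n} p)"

text \<open>The cycle through \<open>x\<close> is kept without its weight, so that it can be
  shortened point by point.\<close>

definition rest_index :: "nat \<Rightarrow> nat \<Rightarrow> (nat \<Rightarrow> real) \<Rightarrow> nat \<Rightarrow> real" where
  "rest_index n l w x = (\<Sum>p\<in>perms n. of_bool (card (orbit p x) = l) *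
     (\<Prod>C\<in>cycs {..<n} p - {orbit p x}. w (card C)))"

lemma cyc_index_Suc_rest:
  "cyc_index (Suc n) w = (\<Sum>l\<le>n. w (Suc l) * rest_index (Suc n) (Suc l) w n)"
proof -
  have "wt w {..<Suc n} p = (\<Sum>l\<le>n. w (Suc l) * (of_bool (card (orbit p n) = Suc l) *
     (\<Prod>C\<in>cycs {..<Suc n} p - {orbit p n}. w (card C))))" if "p \<in> perms (Suc n)" for p
  proof -
    have p: "p permutes {..<Suc n}" using that by (simp add: perms_def)
    have "0 < card (orbit p n)" using orbit_funpow_param(3)[OF p] by simp
    moreover have "card (orbit p n) \<le> Suc n"
      using card_mono[OF _ permutes_orbit_subset[OF p, of n]] by simp
    ultimately obtain m where m: "card (orbit p n) = Suc m" "m \<le> n"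
      by (metis Suc_le_mono gr0_implies_Suc)
    have "wt w {..<Suc n} p = w (card (orbit p n)) * (\<Prod>C\<in>cycs {..<Suc n} p - {orbit p n}. w (card C))"
      unfolding wt_def by (rule prod.remove) (auto simp: cycs_def)
    also have "\<dots> = (\<Sum>l\<le>n. if l = m then w (Suc m) * (\<Prod>C\<in>cycs {..<Suc n} p - {orbit p n}. w (card C)) else 0)"
      using m by simp
    also have "\<dots> = (\<Sum>l\<le>n. w (Suc l) * (of_bool (card (orbit p n) = Suc l) *
     (\<Prod>C\<in>cycs {..<Suc n} p - {orbit p n}. w (card C))))"
      by (intro sum.cong refl) (auto simp: m)
    finally show ?thesis .
  qed
  then show ?thesis unfolding cyc_index_def rest_index_def sum_distrib_left
    by (subst sum.swap) simp
qed

lemma orbit_top: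
  assumes "p \<in> perms n"
  shows "orbit p n = {n}"
  using perms_fix[OF assms, of n] by (simp add: orbit_eq_singleton_iff)

lemma orbit_top_swap:
  assumes p: "p \<in> perms n" and j: "j < n"
  shows "orbit (p \<circ> swap j n) n = insert n (orbit p j)"
    and "cycs {..<Suc n} (p \<circ> swap j n) - {insert n (orbit p j)} = cycs {..<n} p - {orbit p j}"
    and "n \<notin> orbit p j"
proof -
  have p1: "p permutes {..<n}" using p by (simp add: perms_def)
  have p2: "p permutes {..<Suc n}" using perms_Suc[OF p] by (simp add: perms_def)
  show n: "n \<notin> orbit p j" using permutes_orbit_subset[OF p1, of j] j by auto
  show "orbit (p \<circ> swap j n) n = insert n (orbit p j)"
    using orbit_comp_swap[OF p2 _ n, of n] by (simp add: orbit_top[OF p])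
  have "cycs {..<Suc n} (p \<circ> swap j n) =
      insert (insert n (orbit p j)) (cycs {..<Suc n} p - {orbit p j, {n}})"
    using cycs_comp_swap[OF p2 _ _ _ n] j by (simp add: orbit_top[OF p])
  moreover have "cycs {..<Suc n} p = insert {n} (cycs {..<n} p)"
    using cycs_insert_fix[OF p1, of n] by (simp add: lessThan_Suc)
  moreover have "{n} \<notin> cycs {..<n} p" "insert n (orbit p j) \<notin> cycs {..<n} p"
    using cycs_subset[OF p1] by fastforce+
  ultimately show "cycs {..<Suc n} (p \<circ> swap j n) - {insert n (orbit p j)} = cycs {..<n} p - {orbit p j}"
    by auto
qed

lemma rest_index_1: "rest_index (Suc n) (Suc 0) w n = cyc_index n w"
proof -
  have "cycs {..<Suc n} p - {{n}} = cycs {..<n} p" if "p \<in> perms n" for p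
    using that cycs_insert_fix[of p "{..<n}" n] singleton_notin_cycs[of p "{..<n}" n]
    by (auto simp: lessThan_Suc perms_def)
  moreover have "card (insert n (orbit p j)) \<noteq> Suc 0" if "p \<in> perms n" "j < n" for p j
    using orbit_top_swap(3)[OF that] that orbit_funpow_param(3)[of p "{..<n}" j]
    by (simp add: perms_def card_gt_0_iff)
  ultimately show ?thesis
    unfolding rest_index_def cyc_index_def sum_perms_Suc_right
    by (simp add: orbit_top orbit_top_swap(1) wt_def del: o_apply)
qed

text \<open>Deleting the top point shortens its cycle by one and hands the role of distinguished
  point to the \<open>j\<close> after which it had been inserted.\<close>

lemma rest_index_Suc:
  assumes "0 < l"
  shows "rest_index (Suc n) (Suc l) w n = (\<Sum>j<n. rest_index n l w j)"
proof -
  have "card (insert n (orbit p j)) = Suc (card (orbit p j))" if "p \<in> perms n" "j < n" for p j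
    using orbit_top_swap(3)[OF that] that orbit_funpow_param(3)[of p "{..<n}" j]
    by (simp add: perms_def card_gt_0_iff)
  then show ?thesis
    unfolding rest_index_def sum_perms_Suc_right using assms
    by (subst sum.swap) (simp add: orbit_top orbit_top_swap(1,2) del: o_apply)
qed

text \<open>Conjugation by \<open>swap i j\<close> exchanges the distinguished points and preserves
  cycle lengths. It brings the distinguished point back to the top, where it can be deleted.\<close>

lemma rest_index_conj:
  assumes "i < n" "j < n"
  shows "rest_index n l w i = rest_index n l w j"
proof -
  define t where "t = swap i j"
  have t: "t \<in> perms n" using assms by (simp add: t_def perms_transpose)
  have tp: "t permutes {..<n}" using t by (simp add: perms_def)
  have inv: "t \<circ> t = id" "t i = j" by (simp_all add: t_def)
  have "of_bool (card (orbit (t \<circ> p \<circ> t) j) = l) * (\<Prod>C\<in>cycs {..<n} (t \<circ> p \<circ> t) - {orbit (t \<circ> p \<circ> t) j}. w (card C)) =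
      of_bool (card (orbit p i) = l) * (\<Prod>C\<in>cycs {..<n} p - {orbit p i}. w (card C))" if p: "p \<in> perms n" for p
  proof -
    have pp: "p permutes {..<n}" using p by (simp add: perms_def)
    have e: "t \<circ> p \<circ> t = t \<circ> (p \<circ> t)" "(p \<circ> t) \<circ> t = p" using inv by (simp_all add: o_assoc[symmetric])
    have c: "cycs {..<n} (t \<circ> p \<circ> t) = (`) t ` cycs {..<n} p"
      unfolding e(1) using cycs_conj[of t "{..<n}" "p \<circ> t"] perms_comp[OF p t] tp e(2)
      by (simp add: perms_def)
    have "t ` orbit p i = orbit (t \<circ> p \<circ> t) (t i)"
    proof (rule orbit_inverse)
      show "i \<in> orbit p i" using self_in_orbit_permutes[OF pp] by simp
      show "(t \<circ> p \<circ> t) (t x) = t (p x)" for x using fun_cong[OF inv(1), of x] by simp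
    qed
    then have o: "orbit (t \<circ> p \<circ> t) j = t ` orbit p i" using inv by simp
    have injt: "inj ((`) t)" using permutes_inj[OF tp] by (simp add: inj_image_eq_iff inj_def)
    have card: "card (t ` C) = card C" for C using permutes_inj_on[OF tp] card_image by blast
    have "(`) t ` cycs {..<n} p - {t ` orbit p i} = (`) t ` (cycs {..<n} p - {orbit p i})"
      using injt by (simp add: image_set_diff)
    moreover have "inj_on ((`) t) (cycs {..<n} p - {orbit p i})" using injt inj_on_subset by blast
    ultimately show ?thesis unfolding c o by (simp add: card prod.reindex)
  qed
  then have "rest_index n l w i = (\<Sum>p\<in>perms n. of_bool (card (orbit (t \<circ> p \<circ> t) j) = l) *
      (\<Prod>C\<in>cycs {..<n} (t \<circ> p \<circ> t) - {orbit (t \<circ> p \<circ> t) j}. w (card C)))"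
    unfolding rest_index_def by (intro sum.cong) auto
  also have "\<dots> = rest_index n l w j"
    unfolding rest_index_def
    using sum_perms_right[OF t, of "\<lambda>p. of_bool (card (orbit (t \<circ> p) j) = l) *
      (\<Prod>C\<in>cycs {..<n} (t \<circ> p) - {orbit (t \<circ> p) j}. w (card C))"]
      sum_perms_left[OF t, of "\<lambda>p. of_bool (card (orbit p j) = l) *
      (\<Prod>C\<in>cycs {..<n} p - {orbit p j}. w (card C))"]
    by (simp only: o_assoc)
  finally show ?thesis .
qed

text \<open>The quotient of factorials is the number of ordered choices of the \<open>l\<close>
  other points of the cycle.\<close>

lemma rest_index_eq:
  assumes "l \<le> n"
  shows "rest_index (Suc n) (Suc l) w n = fact n / fact (n - l) * cyc_index (n - l) w"
  using assms
proof (induction l arbitrary: n)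
  case 0
  then show ?case by (simp add: rest_index_1)
next
  case (Suc l)
  then obtain m where m: "n = Suc m" "l \<le> m" by (metis Suc_le_D Suc_le_mono)
  have "rest_index (Suc n) (Suc (Suc l)) w n = (\<Sum>j<n. rest_index n (Suc l) w j)"
    by (rule rest_index_Suc) simp
  also have "\<dots> = (\<Sum>j<n. rest_index n (Suc l) w m)"
    by (intro sum.cong refl rest_index_conj) (auto simp: m)
  also have "\<dots> = real n * rest_index (Suc m) (Suc l) w m" by (simp add: m)
  finally show ?case using Suc.IH[OF m(2)] m by simp
qed

text \<open>Newton's recursion, the coefficient form of the exponential formula: the series with
  coefficients \<open>cyc_index n w / fact n\<close> is the exponential of the sum of
  \<open>w l * x^l / l\<close>.\<close>

lemma cyc_index_rec:
  "real (Suc n) * (cyc_index (Suc n) w / fact (Suc n)) =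
    (\<Sum>l\<le>n. w (Suc l) * (cyc_index (n - l) w / fact (n - l)))"
proof -
  have "cyc_index (Suc n) w = fact n * (\<Sum>l\<le>n. w (Suc l) * (cyc_index (n - l) w / fact (n - l)))"
    unfolding cyc_index_Suc_rest sum_distrib_left
    by (intro sum.cong refl) (simp add: rest_index_eq)
  then show ?thesis by (simp add: field_simps del: of_nat_Suc)
qed

lemma hook_convolution_geometric:
  fixes t s :: real
  defines "w \<equiv> \<lambda>l::nat. (1 - t ^ l) * (1 - s ^ l)" and "u \<equiv> t * s" and "a \<equiv> (1 - t) * (1 - s)"
  shows "a * (\<Sum>l\<le>n. w (Suc l) * u ^ (n - l)) =
    a * ((\<Sum>k\<le>n. u ^ k) + real (n + 2) * u ^ Suc n) - w (n + 2) + w (Suc n)"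
proof (induction n)
  case 0
  show ?case by (simp add: w_def u_def a_def algebra_simps power2_eq_square)
next
  case (Suc n)
  have 1: "(\<Sum>l\<le>Suc n. w (Suc l) * u ^ (Suc n - l)) = u * (\<Sum>l\<le>n. w (Suc l) * u ^ (n - l)) + w (n + 2)"
    by (simp add: sum_distrib_left Suc_diff_le mult_ac)
  have 2: "(\<Sum>k\<le>Suc n. u ^ k) = 1 + u * (\<Sum>k\<le>n. u ^ k)"
    by (simp add: sum.atMost_Suc_shift sum_distrib_left del: sum.atMost_Suc)
  \<comment> \<open>Here \<open>w l = 1 - t^l - s^l + u^l\<close>. The linear recursion with
    characteristic roots \<open>t\<close> and \<open>s\<close> annihilates the two middle sequences,
    multiplies the constant one by \<open>a\<close> and the last one by
    \<open>a * u\<close>.\<close>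
  have 3: "w (n + 3) - (t + s) * w (n + 2) + u * w (n + 1) = a + a * u ^ (n + 2)"
    by (simp add: w_def u_def a_def algebra_simps power_mult_distrib eval_nat_numeral)
  have 4: "t + s = 1 + u - a" by (simp add: u_def a_def algebra_simps)
  have "a * (\<Sum>l\<le>Suc n. w (Suc l) * u ^ (Suc n - l)) =
      u * (a * ((\<Sum>k\<le>n. u ^ k) + real (n + 2) * u ^ Suc n) - w (n + 2) + w (Suc n)) + a * w (n + 2)"
    unfolding 1 Suc[symmetric] by (simp add: algebra_simps)
  also have "\<dots> = a * ((\<Sum>k\<le>Suc n. u ^ k) + real (Suc n + 2) * u ^ Suc (Suc n)) - w (Suc n + 2) + w (Suc (Suc n))"
    unfolding 2 using 3 unfolding 4 by (simp add: algebra_simps eval_nat_numeral)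
  finally show ?case .
qed

text \<open>For these weights the exponential formula yields \<open>(1 - t x)(1 - s x) / ((1 - x)(1
  - u x)) = 1 + a x / ((1 - x)(1 - u x))\<close>. The numbers \<open>c\<close> are its coefficients,
  and Newton's recursion is checked for them directly.\<close>

lemma hook_convolution:
  fixes t s :: real
  defines "w \<equiv> \<lambda>l::nat. (1 - t ^ l) * (1 - s ^ l)" and "u \<equiv> t * s" and "a \<equiv> (1 - t) * (1 - s)"
  defines "c \<equiv> \<lambda>m::nat. if m = 0 then 1 else a * (\<Sum>k<m. u ^ k)"
  shows "(\<Sum>l\<le>n. w (Suc l) * c (n - l)) = real (Suc n) * c (Suc n)"
proof (induction n)
  case 0
  show ?case by (simp add: w_def a_def c_def)
next
  case (Suc n)
  \<comment> \<open>The correction is due to \<open>c 0 = 1\<close>, where the empty geometric sum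
    would give 0.\<close>
  have cS: "c (Suc m) = c m + a * u ^ m - of_bool (m = 0)" for m
    by (simp add: c_def algebra_simps)
  have "(\<Sum>l\<le>Suc n. w (Suc l) * c (Suc n - l)) = w (n + 2) + (\<Sum>l\<le>n. w (Suc l) * c (Suc (n - l)))"
    by (simp add: Suc_diff_le c_def)
  also have "(\<Sum>l\<le>n. w (Suc l) * c (Suc (n - l))) =
      (\<Sum>l\<le>n. w (Suc l) * c (n - l)) + a * (\<Sum>l\<le>n. w (Suc l) * u ^ (n - l)) - (\<Sum>l\<le>n. if l = n then w (Suc n) else 0)"
    unfolding cS sum_distrib_left sum.distrib[symmetric] sum_subtractf[symmetric]
    by (intro sum.cong refl) (auto simp: algebra_simps)
  also have "a * (\<Sum>l\<le>n. w (Suc l) * u ^ (n - l)) =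
      a * ((\<Sum>k\<le>n. u ^ k) + real (n + 2) * u ^ Suc n) - w (n + 2) + w (Suc n)"
    unfolding w_def u_def a_def by (rule hook_convolution_geometric)
  finally have "(\<Sum>l\<le>Suc n. w (Suc l) * c (Suc n - l)) =
      real (Suc n) * c (Suc n) + a * ((\<Sum>k\<le>n. u ^ k) + real (n + 2) * u ^ Suc n)"
    using Suc by simp
  also have "\<dots> = real (Suc (Suc n)) * c (Suc (Suc n))"
    by (simp add: c_def lessThan_Suc_atMost algebra_simps)
  finally show ?case .
qed

lemma cyc_index_hook:
  fixes t s :: real
  defines "w \<equiv> \<lambda>l::nat. (1 - t ^ l) * (1 - s ^ l)"
  shows "cyc_index n w / fact n = (if n = 0 then 1 else (1 - t) * (1 - s) * (\<Sum>k<n. (t * s) ^ k))"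
proof (induction n rule: less_induct)
  case (less n)
  define c where "c = (\<lambda>m::nat. if m = 0 then 1 else (1 - t) * (1 - s) * (\<Sum>k<m. (t * s) ^ k))"
  show ?case
  proof (cases n)
    case 0
    then show ?thesis by (simp add: cyc_index_def wt_def cycs_def)
  next
    case (Suc m)
    have "real (Suc m) * (cyc_index (Suc m) w / fact (Suc m)) = (\<Sum>l\<le>m. w (Suc l) * c (m - l))"
      unfolding cyc_index_rec by (intro sum.cong refl) (use less Suc in \<open>simp add: c_def\<close>)
    also have "\<dots> = real (Suc m) * c (Suc m)"
      unfolding w_def c_def by (rule hook_convolution)
    finally have "cyc_index (Suc m) w / fact (Suc m) = c (Suc m)"
      by (rule mult_left_cancel[THEN iffD1, rotated]) simp
    then show ?thesis using Suc by (simp add: c_def)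
  qed
qed

lemma sum_cyc_poly_product:
  fixes t s :: real
  assumes "0 < n"
  shows "(\<Sum>p\<in>perms n. cyc_poly t n p * cyc_poly s n p) = fact n * ((1 - t) * (1 - s) * (\<Sum>k<n. (t * s) ^ k))"
  using cyc_index_hook[of n t s] assms
  by (simp add: cyc_index_def cyc_poly_def wt_def prod.distrib[symmetric] divide_eq_eq mult_ac)

section \<open>Hook polynomials\<close>

lemma poly_cyc_poly: "poly (cyc_poly [:0, 1:] n p) t = cyc_poly t n p"
  by (simp add: cyc_poly_def wt_def poly_prod poly_power)

lemma fps_of_poly_cyc_poly: "fps_of_poly (cyc_poly [:0, 1:] n p) = (cyc_poly fps_X n p :: real fps)"
  by (simp add: cyc_poly_def wt_def fps_of_poly_prod fps_of_poly_diff fps_of_poly_power fps_of_poly_pCons)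

text \<open>For \<open>0 < n\<close> the coefficient of degree \<open>k < n\<close> is
  \<open>(-1)^k\<close> times the character of the hook \<open>(n - k, 1^k)\<close> at
  \<open>p\<close>. No representation is constructed; all that is needed is read off from cycle
  lengths.\<close>

definition hook_poly :: "nat \<Rightarrow> (nat \<Rightarrow> nat) \<Rightarrow> real poly" where
  "hook_poly n p = cyc_poly [:0, 1:] n p div [:1, -1:]"

lemma cyc_poly_hook_poly:
  assumes "0 < n"
  shows "cyc_poly [:0, 1:] n p = [:1, -1:] * hook_poly n p"
proof -
  have "poly (cyc_poly [:0, 1:] n p) (1::real) = 0"
    unfolding poly_cyc_poly using assms by (auto simp: cyc_poly_def wt_def cycs_def card_gt_0_iff)
  then have "[:-1, 1:] dvd (cyc_poly [:0, 1:] n p :: real poly)"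
    by (simp add: poly_eq_0_iff_dvd)
  moreover have "[:1, -1:] = - [:-1, 1 :: real:]" by simp
  ultimately have "[:1, -1:] dvd (cyc_poly [:0, 1:] n p :: real poly)"
    by (metis minus_dvd_iff)
  then show ?thesis unfolding hook_poly_def by (rule dvd_mult_div_cancel[symmetric])
qed

text \<open>After cancelling \<open>(1 - t) * (1 - s)\<close> in
  \<open>sum_cyc_poly_product\<close>, the products of the hook polynomials at \<open>t\<close> and
  \<open>s\<close> sum to \<open>fact n\<close> times the sum of \<open>(t * s) ^ k\<close> over
  \<open>k < n\<close>. Coefficients are compared first in \<open>t\<close>, then in
  \<open>s\<close>.\<close>

lemma hook_poly_orthogonal:
  assumes n: "0 < n"
  shows "(\<Sum>p\<in>perms n. coeff (hook_poly n p) i * coeff (hook_poly n p) j) =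
    (if i = j \<and> i < n then fact n else 0)"
proof -
  let ?h = "hook_poly n"
  have nz: "[:1, -1:] \<noteq> (0 :: real poly)" by simp
  have h: "cyc_poly t n p = (1 - t) * poly (?h p) t" for t p
    using arg_cong[OF cyc_poly_hook_poly[OF n], of "\<lambda>q. poly q t" p] by (simp add: poly_cyc_poly algebra_simps)
  \<comment> \<open>In this comparison \<open>s\<close> is a number, so \<open>1 - s\<close> can be
    cancelled only for \<open>s\<close> different from 1. The later comparison in \<open>s\<close>
    keeps the factor \<open>[:1, -1:]\<close>, which vanishes at the excluded value.\<close>
  have S: "(\<Sum>p\<in>perms n. Polynomial.smult (poly (?h p) s) (?h p)) = (\<Sum>k<n. monom (fact n * s ^ k) k)"
    if s: "s \<noteq> 1" for s
  proof -
    have "[:1, -1:] * (\<Sum>p\<in>perms n. Polynomial.smult (poly (?h p) s) (?h p)) = [:1, -1:] * (\<Sum>k<n. monom (fact n * s ^ k) k)"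
    proof (rule poly_eq_poly_eq_iff[THEN iffD1], rule ext)
      fix t
      have "(1 - s) * ((1 - t) * (\<Sum>p\<in>perms n. poly (?h p) s * poly (?h p) t)) =
          (1 - s) * ((1 - t) * (\<Sum>k<n. fact n * s ^ k * t ^ k))"
        using sum_cyc_poly_product[OF n, of t s] unfolding h
        by (simp add: sum_distrib_left sum_distrib_right power_mult_distrib mult_ac)
      then have "(1 - t) * (\<Sum>p\<in>perms n. poly (?h p) s * poly (?h p) t) = (1 - t) * (\<Sum>k<n. fact n * s ^ k * t ^ k)"
        using s by simp
      then show "poly ([:1, -1:] * (\<Sum>p\<in>perms n. Polynomial.smult (poly (?h p) s) (?h p))) t =
          poly ([:1, -1:] * (\<Sum>k<n. monom (fact n * s ^ k) k)) t"
        by (simp add: poly_sum poly_monom algebra_simps)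
    qed
    then show ?thesis by (simp only: mult_left_cancel[OF nz])
  qed
  have A: "(\<Sum>p\<in>perms n. coeff (?h p) i * poly (?h p) s) = (if i < n then fact n * s ^ i else 0)"
    if "s \<noteq> 1" for s
    using arg_cong[OF S[OF that], of "\<lambda>q. coeff q i"] by (simp add: coeff_sum mult.commute)
  define B where "B = (if i < n then monom (fact n) i else 0 :: real poly)"
  have "[:1, -1:] * (\<Sum>p\<in>perms n. Polynomial.smult (coeff (?h p) i) (?h p)) = [:1, -1:] * B"
  proof (rule poly_eq_poly_eq_iff[THEN iffD1], rule ext)
    fix s
    show "poly ([:1, -1:] * (\<Sum>p\<in>perms n. Polynomial.smult (coeff (?h p) i) (?h p))) s = poly ([:1, -1:] * B) s"
      using A[of s] by (cases "s = 1") (simp_all add: poly_sum poly_monom B_def)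
  qed
  then have "(\<Sum>p\<in>perms n. Polynomial.smult (coeff (?h p) i) (?h p)) = B" by (simp only: mult_left_cancel[OF nz])
  from arg_cong[OF this, of "\<lambda>q. coeff q j"] show ?thesis
    by (auto simp: coeff_sum B_def)
qed

lemma binomial_gf:
  "Abs_fps (\<lambda>k. real ((n + k) choose n)) * (1 - fps_X) ^ Suc n = 1"
proof (induction n)
  case 0
  show ?case by (rule fps_ext) (simp add: right_diff_distrib)
next
  case (Suc n)
  have "Abs_fps (\<lambda>k. real ((Suc n + k) choose Suc n)) * (1 - fps_X) = Abs_fps (\<lambda>k. real ((n + k) choose n))"
  proof (rule fps_ext)
    fix k
    show "fps_nth (Abs_fps (\<lambda>k. real ((Suc n + k) choose Suc n)) * (1 - fps_X)) k = fps_nth (Abs_fps (\<lambda>k. real ((n + k) choose n))) k"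
      by (cases k) (simp_all add: right_diff_distrib)
  qed
  then show ?case using Suc by (simp add: mult.assoc[symmetric])
qed

text \<open>One factor \<open>1 - X\<close> of \<open>cyc_poly\<close> cancels against the
  denominator and leaves \<open>hook_poly\<close>; the remaining power \<open>n + 1\<close> expands
  into binomial coefficients. The factor \<open>X\<close> shifts the index, whence
  \<open>q - 1 - k\<close>.\<close>

lemma wsum_eq:
  assumes n: "0 < n" and p: "p \<in> perms n"
  shows "wsum n q p = fact (n - 1) * (\<Sum>k<q. coeff (hook_poly n p) k * real ((n + (q - 1 - k)) choose n))"
proof -
  define F where "F = Abs_fps (\<lambda>q. wsum n q p)"
  define B where "B = Abs_fps (\<lambda>k. real ((n + k) choose n))"
  define H where "H = fps_of_poly (hook_poly n p)"
  have "fps_of_poly [:1, -1:] = (1 - fps_X :: real fps)" by (simp add: fps_of_poly_pCons)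
  then have D: "cyc_poly fps_X n p = (1 - fps_X) * H"
    unfolding H_def using cyc_poly_hook_poly[OF n, of p] fps_of_poly_cyc_poly[of n p]
    by (metis fps_of_poly_mult)
  have c: "fps_const (fact m) = (fact m :: real fps)" for m by (metis fps_of_nat of_nat_fact)
  have "F * (1 - fps_X) ^ (n + 2) = fact (n - 1) * fps_X * ((1 - fps_X) * H)"
    using wsum_gf[OF n p] by (simp add: F_def D)
  then have "(F * (1 - fps_X) ^ Suc n) * (1 - fps_X) = (fact (n - 1) * fps_X * H) * (1 - fps_X)"
    by (simp add: mult_ac)
  moreover have "(1 - fps_X :: real fps) \<noteq> 0"
    by (metis fps_X_nth fps_sub_nth fps_one_nth fps_zero_nth diff_zero zero_neq_one)
  ultimately have "F * (1 - fps_X) ^ Suc n = fact (n - 1) * fps_X * H" by (metis mult_right_cancel)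
  then have "F * (B * (1 - fps_X) ^ Suc n) = fact (n - 1) * fps_X * (H * B)"
    by (simp add: mult_ac)
  then have F: "F = fps_const (fact (n - 1)) * (fps_X * (H * B))"
    unfolding B_def binomial_gf by (simp add: mult.assoc c)
  show ?thesis
  proof (cases q)
    case 0
    then show ?thesis using arg_cong[OF F, of "\<lambda>f. fps_nth f q"] by (simp add: F_def)
  next
    case (Suc m)
    have "wsum n q p = fact (n - 1) * fps_nth (H * B) m"
      using arg_cong[OF F, of "\<lambda>f. fps_nth f q"] by (simp add: F_def Suc)
    then have "wsum n q p = fact (n - 1) * (\<Sum>k=0..m. fps_nth H k * fps_nth B (m - k))"
      by (simp only: fps_mult_nth)
    then show ?thesis by (simp add: Suc H_def B_def atLeast0AtMost lessThan_Suc_atMost)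
  qed
qed

lemma sum_wsum_product:
  assumes n: "0 < n"
  shows "(\<Sum>p\<in>perms n. wsum n a p * wsum n b p) = (fact (n - 1))\<^sup>2 * fact n *
    (\<Sum>k<n. real ((a + (n - 1 - k)) choose n) * real ((b + (n - 1 - k)) choose n))"
proof -
  define c where "c q k = real ((n + (q - 1 - k)) choose n)" for q k
  let ?h = "\<lambda>p k. coeff (hook_poly n p) k"
  have "(\<Sum>p\<in>perms n. wsum n a p * wsum n b p) =
      (\<Sum>p\<in>perms n. (fact (n - 1))\<^sup>2 * (\<Sum>k<a. \<Sum>l<b. (?h p k * ?h p l) * (c a k * c b l)))"
    unfolding c_def
    by (intro sum.cong refl) (simp add: wsum_eq[OF n] sum_product power2_eq_square mult_ac)
  also have "\<dots> = (fact (n - 1))\<^sup>2 * (\<Sum>k<a. \<Sum>l<b. (\<Sum>p\<in>perms n. ?h p k * ?h p l) * (c a k * c b l))"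
    unfolding sum_distrib_left[symmetric] sum_distrib_right
    by (subst sum.swap, rule arg_cong[of _ _ "(*) _"], rule sum.cong[OF refl], rule sum.swap)
  also have "\<dots> = (fact (n - 1))\<^sup>2 * (\<Sum>k<a. \<Sum>l<b. if k = l then (if k < n then fact n * (c a k * c b k) else 0) else 0)"
    unfolding hook_poly_orthogonal[OF n]
    by (intro arg_cong[of _ _ "(*) _"] sum.cong refl) auto
  also have "(\<Sum>k<a. \<Sum>l<b. if k = l then (if k < n then fact n * (c a k * c b k) else 0) else 0) =
      (\<Sum>k<a. if k < b \<and> k < n then fact n * (c a k * c b k) else 0)"
    by (intro sum.cong refl) (simp add: sum.delta)
  \<comment> \<open>For \<open>k < a\<close> and \<open>k < n\<close> both forms of the upper
    argument agree. For \<open>a \<le> k < n\<close> the argument is below \<open>n\<close> and the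
    binomial coefficient vanishes, likewise for \<open>b\<close>; so the range becomes independent
    of \<open>a\<close> and \<open>b\<close>.\<close>
  also have "\<dots> = (\<Sum>k<n. fact n * (real ((a + (n - 1 - k)) choose n) * real ((b + (n - 1 - k)) choose n)))"
  proof (rule sum.mono_neutral_cong)
    fix k assume "k \<in> {..<a} \<inter> {..<n}"
    then show "(if k < b \<and> k < n then fact n * (c a k * c b k) else 0) =
      fact n * (real ((a + (n - 1 - k)) choose n) * real ((b + (n - 1 - k)) choose n))"
      by (auto simp: c_def binomial_eq_0 algebra_simps)
  qed (auto simp: binomial_eq_0)
  finally show ?thesis by (simp add: sum_distrib_left mult_ac)
qed

section \<open>The sums over the symmetric group behind \<open>mu\<close>\<close>

definition pair_count :: "nat \<Rightarrow> nat \<Rightarrow> nat \<Rightarrow> (nat \<Rightarrow> nat) \<Rightarrow> real" where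
  "pair_count n a b x = (\<Sum>p\<in>perms n. real a ^ nc n p * real b ^ nc n (x \<circ> p))"

text \<open>\<open>s\<close> plays the long cycle from the first class of each sequence, and
  \<open>x\<close> the product of the permutations from the other classes.\<close>

definition triple_sum :: "nat \<Rightarrow> nat \<Rightarrow> nat \<Rightarrow> (nat \<Rightarrow> nat) \<Rightarrow> real" where
  "triple_sum n a b x = (\<Sum>s\<in>perms n. one_cyc n s * pair_count n a b (s \<circ> x))"

lemma one_cyc_inv: "p \<in> perms n \<Longrightarrow> one_cyc n (inv_into UNIV p) = one_cyc n p"
  by (simp add: one_cyc_def nc_inv)

lemma near_cyc_conj:
  assumes p: "p \<in> perms n" and q: "q \<in> perms n"
  shows "near_cyc n (p \<circ> q) = near_cyc n (q \<circ> p)"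
proof -
  have "bij_betw q {a. a < n \<and> (p \<circ> q) a = a} {a. a < n \<and> (q \<circ> p) a = a}"
    by (rule bij_betw_byWitness[of _ p]) (use p q in \<open>auto simp: perms_less\<close>)
  then show ?thesis unfolding near_cyc_def nc_conj[OF p q] by (simp add: bij_betw_same_card)
qed

lemma perms_comp_inv:
  assumes "p \<in> perms n"
  shows "p \<circ> (inv_into UNIV p \<circ> q) = q" "inv_into UNIV p \<circ> (p \<circ> q) = q" "q \<circ> inv_into UNIV p \<circ> p = q" "q \<circ> p \<circ> inv_into UNIV p = q"
  using assms by (simp_all add: fun_eq_iff)

text \<open>Replacing \<open>p\<close> by the inverse of \<open>x\<close> times \<open>p\<close>
  removes \<open>x\<close> from the second power. The two long cycles then occur in different
  factors and are summed separately; the inverse of an \<open>n\<close>-cycle is again one.\<close>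

lemma sum_one_cyc_triple_sum:
  assumes n: "0 < n"
  shows "(\<Sum>x\<in>perms n. one_cyc n x * triple_sum n a b x) = (\<Sum>p\<in>perms n. wsum n a p * wsum n b p)"
proof -
  have "triple_sum n a b x = (\<Sum>p\<in>perms n. real a ^ nc n (inv_into UNIV x \<circ> p) * wsum n b p)" if x: "x \<in> perms n" for x
  proof -
    have "(\<Sum>p\<in>perms n. real a ^ nc n p * real b ^ nc n (s \<circ> x \<circ> p)) =
        (\<Sum>p\<in>perms n. real a ^ nc n (inv_into UNIV x \<circ> p) * real b ^ nc n (p \<circ> s))" if s: "s \<in> perms n" for s
    proof -
      have "(\<Sum>p\<in>perms n. real a ^ nc n p * real b ^ nc n (s \<circ> x \<circ> p)) =
          (\<Sum>p\<in>perms n. real a ^ nc n (inv_into UNIV x \<circ> p) * real b ^ nc n (s \<circ> x \<circ> (inv_into UNIV x \<circ> p)))"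
        by (rule sum_perms_left[OF perms_inv[OF x], symmetric])
      also have "\<dots> = (\<Sum>p\<in>perms n. real a ^ nc n (inv_into UNIV x \<circ> p) * real b ^ nc n (p \<circ> s))"
      proof (rule sum.cong[OF refl])
        fix p assume p: "p \<in> perms n"
        have "s \<circ> x \<circ> (inv_into UNIV x \<circ> p) = s \<circ> p" using x by (simp add: fun_eq_iff)
        then show "real a ^ nc n (inv_into UNIV x \<circ> p) * real b ^ nc n (s \<circ> x \<circ> (inv_into UNIV x \<circ> p)) =
            real a ^ nc n (inv_into UNIV x \<circ> p) * real b ^ nc n (p \<circ> s)"
          using nc_conj[OF s p] by simp
      qed
      finally show ?thesis .
    qed
    then have "triple_sum n a b x = (\<Sum>s\<in>perms n. one_cyc n s * (\<Sum>p\<in>perms n. real a ^ nc n (inv_into UNIV x \<circ> p) * real b ^ nc n (p \<circ> s)))"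
      unfolding triple_sum_def pair_count_def by (intro sum.cong refl) (simp del: o_apply)
    also have "\<dots> = (\<Sum>p\<in>perms n. real a ^ nc n (inv_into UNIV x \<circ> p) * wsum n b p)"
      unfolding wsum_def sum_distrib_left by (subst sum.swap) (simp add: mult_ac del: o_apply)
    finally show ?thesis .
  qed
  then have "(\<Sum>x\<in>perms n. one_cyc n x * triple_sum n a b x) =
      (\<Sum>x\<in>perms n. one_cyc n (inv_into UNIV x) * (\<Sum>p\<in>perms n. real a ^ nc n (inv_into UNIV x \<circ> p) * wsum n b p))"
    by (intro sum.cong refl) (simp add: one_cyc_inv)
  also have "\<dots> = (\<Sum>x\<in>perms n. one_cyc n x * (\<Sum>p\<in>perms n. real a ^ nc n (x \<circ> p) * wsum n b p))"
    by (rule sum_perms_inv)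
  also have "\<dots> = (\<Sum>x\<in>perms n. one_cyc n x * (\<Sum>p\<in>perms n. real a ^ nc n (p \<circ> x) * wsum n b p))"
    by (intro sum.cong refl) (simp add: nc_conj del: o_apply)
  also have "\<dots> = (\<Sum>p\<in>perms n. wsum n a p * wsum n b p)"
    unfolding wsum_def[of n a] sum_distrib_left sum_distrib_right
    by (subst sum.swap) (simp add: mult_ac del: o_apply)
  finally show ?thesis .
qed

text \<open>Collect the terms with product \<open>p = s o x\<close>: the weighted number of such
  factorizations is what \<open>sum_one_cyc_near_cyc\<close> computes.\<close>

lemma sum_one_cyc_near_cyc_comp:
  assumes n: "2 \<le> n"
  shows "(\<Sum>s\<in>perms n. \<Sum>x\<in>perms n. one_cyc n s * near_cyc n x * g (s \<circ> x)) =
    fact (n - 2) * (\<Sum>p\<in>perms n. (1 - of_int (sign p)) * g p)"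
proof -
  have "(\<Sum>s\<in>perms n. \<Sum>x\<in>perms n. one_cyc n s * near_cyc n x * g (s \<circ> x)) =
      (\<Sum>s\<in>perms n. \<Sum>p\<in>perms n. one_cyc n (inv_into UNIV s) * near_cyc n (inv_into UNIV s \<circ> p) * g p)"
  proof (rule sum.cong[OF refl])
    fix s assume s: "s \<in> perms n"
    have "(\<Sum>x\<in>perms n. one_cyc n s * near_cyc n x * g (s \<circ> x)) =
        (\<Sum>x\<in>perms n. one_cyc n s * near_cyc n (inv_into UNIV s \<circ> x) * g (s \<circ> (inv_into UNIV s \<circ> x)))"
      by (rule sum_perms_left[OF perms_inv[OF s], symmetric])
    then show "(\<Sum>x\<in>perms n. one_cyc n s * near_cyc n x * g (s \<circ> x)) =
        (\<Sum>p\<in>perms n. one_cyc n (inv_into UNIV s) * near_cyc n (inv_into UNIV s \<circ> p) * g p)"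
      by (simp only: perms_comp_inv[OF s] one_cyc_inv[OF s])
  qed
  also have "\<dots> = (\<Sum>s\<in>perms n. \<Sum>p\<in>perms n. one_cyc n s * near_cyc n (s \<circ> p) * g p)"
    by (rule sum_perms_inv)
  also have "\<dots> = (\<Sum>p\<in>perms n. (\<Sum>s\<in>perms n. one_cyc n s * near_cyc n (p \<circ> s)) * g p)"
    by (subst sum.swap) (simp add: sum_distrib_right near_cyc_conj del: o_apply)
  also have "\<dots> = (\<Sum>p\<in>perms n. fact (n - 2) * ((1 - of_int (sign p)) * g p))"
    by (intro sum.cong refl) (simp add: sum_one_cyc_near_cyc[OF n])
  finally show ?thesis by (simp add: sum_distrib_left)
qed

lemma prod_rising: "(\<Prod>i<n. real a + real i) = fact n * real ((a + n - 1) choose n)"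
proof (cases n)
  case (Suc m)
  have "(\<Prod>i<n. real a + real i) = pochhammer (real a) n" by (simp add: pochhammer_prod atLeast0LessThan)
  also have "\<dots> = fact n * ((real a + real n - 1) gchoose n)" by (simp add: gbinomial_pochhammer')
  also have "real a + real n - 1 = real (a + n - 1)" by (simp add: Suc)
  finally show ?thesis by (simp add: binomial_gbinomial)
qed simp

lemma prod_falling: "(\<Prod>i<n. real a - real i) = fact n * real (a choose n)"
  by (simp add: binomial_gbinomial gbinomial_prod_rev atLeast0LessThan)

lemma sum_sign_perms: "2 \<le> n \<Longrightarrow> (\<Sum>p\<in>perms n. real_of_int (sign p)) = 0"
  using sum_sign_power_nc[where n = n and x = "1::real"] prod_zero[of "{..<n}" "\<lambda>i. 1 - real i"]
  by force

lemma sum_one_cyc: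
  assumes "0 < n"
  shows "(\<Sum>s\<in>perms n. one_cyc n s) = fact (n - 1)"
  using assms
proof (induction n rule: nat_induct_non_zero)
  case 1
  have "perms 1 = {id}" by (simp add: perms_def lessThan_Suc)
  moreover have "nc 1 id = 1" using nc_Suc[of id 0] by simp
  ultimately show ?case by (simp add: one_cyc_def id_def)
next
  case (Suc n)
  then show ?case using sum_one_cyc_Suc[OF Suc.hyps, of "\<lambda>_. 1"] fact_reduce[of n, where ?'a = real]
    by (simp add: sum_distrib_right[symmetric])
qed

text \<open>No counting is required: take the constant test function 1 in the preceding lemma, where
  the sum of the signs vanishes.\<close>

lemma sum_near_cyc:
  assumes n: "2 \<le> n"
  shows "(\<Sum>s\<in>perms n. near_cyc n s) = real n * fact (n - 2)"
proof -
  have "(\<Sum>s\<in>perms n. one_cyc n s) * (\<Sum>x\<in>perms n. near_cyc n x) = fact (n - 2) * fact n"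
    using sum_one_cyc_near_cyc_comp[OF n, of "\<lambda>_. 1"] sum_sign_perms[OF n]
    by (simp add: sum_product sum_subtractf card_perms)
  then have "fact (n - 1) * (\<Sum>x\<in>perms n. near_cyc n x) = fact (n - 1) * (real n * fact (n - 2))"
    using sum_one_cyc[of n] fact_reduce[of n, where ?'a = real] n by simp
  then show ?thesis by simp
qed

text \<open>With \<open>c = 1\<close> or \<open>c = -1\<close> the weight is twice the indicator of
  the even or odd permutations. Because the sign is multiplicative, the trivial and the sign part
  each split into a product of two one-variable sums.\<close>

lemma sum_sign_pair_count:
  "(\<Sum>x\<in>perms n. (1 + c * of_int (sign x)) * pair_count n a b x) = (fact n)\<^sup>2 *
    (real ((a + n - 1) choose n) * real ((b + n - 1) choose n) + c * (real (a choose n) * real (b choose n)))"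
proof -
  define R F where "R = (\<Sum>x\<in>perms n. real b ^ nc n x)" and "F = (\<Sum>x\<in>perms n. of_int (sign x) * real b ^ nc n x)"
  have inner: "(\<Sum>x\<in>perms n. (1 + c * of_int (sign x)) * real b ^ nc n (x \<circ> p)) = R + c * of_int (sign p) * F"
    if p: "p \<in> perms n" for p
  proof -
    have "sign x = sign (x \<circ> p) * sign p" if "x \<in> perms n" for x
      using sign_compose[OF perms_permutation[OF that] perms_permutation[OF p]] by (simp add: mult.assoc)
    then have "(\<Sum>x\<in>perms n. (1 + c * of_int (sign x)) * real b ^ nc n (x \<circ> p)) =
        (\<Sum>x\<in>perms n. (1 + c * of_int (sign (x \<circ> p) * sign p)) * real b ^ nc n (x \<circ> p))"
      by (intro sum.cong refl) (simp only:)
    also have "\<dots> = (\<Sum>x\<in>perms n. (1 + c * of_int (sign x * sign p)) * real b ^ nc n x)"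
      by (rule sum_perms_right[OF p])
    also have "\<dots> = R + c * of_int (sign p) * F"
      unfolding R_def F_def sum_distrib_left sum.distrib[symmetric]
      by (intro sum.cong refl) (simp add: algebra_simps)
    finally show ?thesis .
  qed
  have "(\<Sum>x\<in>perms n. (1 + c * of_int (sign x)) * pair_count n a b x) =
      (\<Sum>p\<in>perms n. real a ^ nc n p * (\<Sum>x\<in>perms n. (1 + c * of_int (sign x)) * real b ^ nc n (x \<circ> p)))"
    unfolding pair_count_def sum_distrib_left by (subst sum.swap) (simp add: mult_ac del: o_apply)
  also have "\<dots> = (\<Sum>p\<in>perms n. real a ^ nc n p * R + c * (of_int (sign p) * real a ^ nc n p * F))"
    by (rule sum.cong[OF refl], subst inner) (simp_all add: algebra_simps)
  also have "\<dots> = (\<Sum>p\<in>perms n. real a ^ nc n p) * R + c * ((\<Sum>p\<in>perms n. of_int (sign p) * real a ^ nc n p) * F)"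
    by (simp only: sum.distrib sum_distrib_left sum_distrib_right)
  finally show ?thesis
    unfolding R_def F_def sum_power_nc sum_sign_power_nc prod_rising prod_falling
    by (simp add: algebra_simps power2_eq_square)
qed

lemma sum_near_cyc_triple_sum:
  assumes n: "2 \<le> n"
  shows "(\<Sum>x\<in>perms n. near_cyc n x * triple_sum n a b x) = fact (n - 2) * (fact n)\<^sup>2 *
    (real ((a + n - 1) choose n) * real ((b + n - 1) choose n) - real (a choose n) * real (b choose n))"
proof -
  have "(\<Sum>x\<in>perms n. near_cyc n x * triple_sum n a b x) =
      (\<Sum>s\<in>perms n. \<Sum>x\<in>perms n. one_cyc n s * near_cyc n x * pair_count n a b (s \<circ> x))"
    unfolding triple_sum_def sum_distrib_left by (subst sum.swap) (simp add: mult_ac del: o_apply)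
  then show ?thesis
    using sum_one_cyc_near_cyc_comp[OF n, of "pair_count n a b"]
      sum_sign_pair_count[where n = n and a = a and b = b and c = "-1"] by (simp add: mult.assoc)
qed

text \<open>The product \<open>z\<close> of the outer \<open>s\<close> and \<open>x\<close> is
  uniform on the odd permutations. The long cycle inside \<open>triple_sum\<close> and the near-long
  cycle \<open>y\<close> have opposite signs, so multiplying \<open>z\<close> by both gives a
  uniform even permutation, whatever they are.\<close>

lemma sum_near_near_triple_sum:
  assumes n: "2 \<le> n"
  shows "(\<Sum>y\<in>perms n. near_cyc n y * (\<Sum>x\<in>perms n. near_cyc n x *
      (\<Sum>s\<in>perms n. one_cyc n s * triple_sum n a b (s \<circ> (x \<circ> y))))) =
    fact (n - 2) * (real n * fact (n - 2)) * fact (n - 1) * (fact n)\<^sup>2 *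
    (real ((a + n - 1) choose n) * real ((b + n - 1) choose n) + real (a choose n) * real (b choose n))"
proof -
  define R where "R = (fact n)\<^sup>2 * (real ((a + n - 1) choose n) * real ((b + n - 1) choose n) + real (a choose n) * real (b choose n))"
  have "near_cyc n y * (\<Sum>x\<in>perms n. near_cyc n x * (\<Sum>s\<in>perms n. one_cyc n s * triple_sum n a b (s \<circ> (x \<circ> y)))) =
      near_cyc n y * (fact (n - 2) * fact (n - 1) * R)" if y: "y \<in> perms n" for y
  proof (cases "nc n y = 2")
    case True
    have shift: "(\<Sum>z\<in>perms n. (1 - of_int (sign z)) * pair_count n a b (s \<circ> (z \<circ> y))) = R"
      if s: "s \<in> perms n" and cs: "nc n s = 1" for s
    proof -
      have ss: "sign s * sign y = -1"
        using sign_perms[OF s] sign_perms[OF y] True cs by (simp flip: power_mult_distrib)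
      have "sign z = - sign (s \<circ> (z \<circ> y))" if z: "z \<in> perms n" for z
      proof -
        have "sign (s \<circ> (z \<circ> y)) = (sign s * sign y) * sign z"
          using s z y by (simp add: sign_compose perms_permutation permutation_compose)
        then show ?thesis unfolding ss by simp
      qed
      then have "(\<Sum>z\<in>perms n. (1 - of_int (sign z)) * pair_count n a b (s \<circ> (z \<circ> y))) =
          (\<Sum>z\<in>perms n. (1 - of_int (- sign (s \<circ> (z \<circ> y)))) * pair_count n a b (s \<circ> (z \<circ> y)))"
        by (intro sum.cong refl) (simp only:)
      also have "\<dots> = (\<Sum>z\<in>perms n. (1 - of_int (- sign (s \<circ> z))) * pair_count n a b (s \<circ> z))"
        by (rule sum_perms_right[OF y])
      also have "\<dots> = (\<Sum>z\<in>perms n. (1 - of_int (- sign z)) * pair_count n a b z)"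
        by (rule sum_perms_left[OF s])
      also have "\<dots> = R"
        using sum_sign_pair_count[where n = n and a = a and b = b and c = 1] by (simp add: R_def)
      finally show ?thesis .
    qed
    have "(\<Sum>x\<in>perms n. near_cyc n x * (\<Sum>s\<in>perms n. one_cyc n s * triple_sum n a b (s \<circ> (x \<circ> y)))) =
        (\<Sum>s\<in>perms n. \<Sum>x\<in>perms n. one_cyc n s * near_cyc n x * triple_sum n a b (s \<circ> x \<circ> y))"
      unfolding sum_distrib_left by (subst sum.swap) (simp add: mult_ac o_assoc del: o_apply)
    also have "\<dots> = fact (n - 2) * (\<Sum>z\<in>perms n. (1 - of_int (sign z)) * triple_sum n a b (z \<circ> y))"
      by (rule sum_one_cyc_near_cyc_comp[OF n])
    also have "(\<Sum>z\<in>perms n. (1 - of_int (sign z)) * triple_sum n a b (z \<circ> y)) =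
        (\<Sum>s\<in>perms n. one_cyc n s * (\<Sum>z\<in>perms n. (1 - of_int (sign z)) * pair_count n a b (s \<circ> (z \<circ> y))))"
      unfolding triple_sum_def sum_distrib_left by (subst sum.swap) (simp add: mult_ac del: o_apply)
    also have "\<dots> = (\<Sum>s\<in>perms n. one_cyc n s * R)"
      by (intro sum.cong refl) (use shift in \<open>auto simp: one_cyc_def simp del: o_apply\<close>)
    also have "\<dots> = fact (n - 1) * R"
      using sum_one_cyc[of n] n by (simp add: sum_distrib_right[symmetric])
    finally have e: "(\<Sum>x\<in>perms n. near_cyc n x * (\<Sum>s\<in>perms n. one_cyc n s * triple_sum n a b (s \<circ> (x \<circ> y)))) =
        fact (n - 2) * (fact (n - 1) * R)" .
    show ?thesis unfolding e by (simp only: mult.assoc)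
  qed (simp add: near_cyc_def)
  then have "(\<Sum>y\<in>perms n. near_cyc n y * (\<Sum>x\<in>perms n. near_cyc n x *
      (\<Sum>s\<in>perms n. one_cyc n s * triple_sum n a b (s \<circ> (x \<circ> y))))) =
      (\<Sum>y\<in>perms n. near_cyc n y * (fact (n - 2) * fact (n - 1) * R))"
    by (rule sum.cong[OF refl])
  also have "\<dots> = real n * fact (n - 2) * (fact (n - 2) * fact (n - 1) * R)"
    unfolding sum_distrib_right[symmetric] sum_near_cyc[OF n] ..
  finally show ?thesis by (simp only: R_def mult_ac)
qed

section \<open>Monomial matrices over the group of roots of unity\<close>

lemma sum_PiE_union:
  assumes "A \<inter> B = {}"
  shows "(\<Sum>l\<in>PiE (A \<union> B) T. f l) =
    (\<Sum>l1\<in>PiE A T. \<Sum>l2\<in>PiE B T. f (\<lambda>x. if x \<in> A then l1 x else l2 x))"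
proof -
  have "(\<Sum>l1\<in>PiE A T. \<Sum>l2\<in>PiE B T. f (\<lambda>x. if x \<in> A then l1 x else l2 x)) =
      (\<Sum>(l1, l2)\<in>PiE A T \<times> PiE B T. f (\<lambda>x. if x \<in> A then l1 x else l2 x))"
    by (rule sum.cartesian_product)
  also have "\<dots> = (\<Sum>l\<in>PiE (A \<union> B) T. f l)"
  proof (rule sum.reindex_bij_witness[where
        i = "\<lambda>l. (restrict l A, restrict l B)" and j = "\<lambda>(l1, l2) x. if x \<in> A then l1 x else l2 x"])
    fix x assume "x \<in> PiE A T \<times> PiE B T"
    then obtain l1 l2 where x: "x = (l1, l2)" "l1 \<in> PiE A T" "l2 \<in> PiE B T" by auto
    then show "(\<lambda>l. (restrict l A, restrict l B)) ((\<lambda>(l1, l2) x. if x \<in> A then l1 x else l2 x) x) = x"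
      using assms by (auto simp: fun_eq_iff PiE_def extensional_def restrict_def)
    show "(\<lambda>(l1, l2) x. if x \<in> A then l1 x else l2 x) x \<in> PiE (A \<union> B) T"
      using x by (auto simp: PiE_def extensional_def)
  next
    fix l assume l: "l \<in> PiE (A \<union> B) T"
    show "(\<lambda>(l1, l2) x. if x \<in> A then l1 x else l2 x) ((\<lambda>l. (restrict l A, restrict l B)) l) = l"
      using l by (auto simp: fun_eq_iff PiE_def extensional_def restrict_def)
    show "(\<lambda>l. (restrict l A, restrict l B)) l \<in> PiE A T \<times> PiE B T"
      using l by (auto simp: PiE_def)
  qed auto
  finally show ?thesis by simp
qed

text \<open>Labels belong to columns, in accordance with \<open>perm_mat\<close> and
  \<open>cycle_prod\<close>: the product over a cycle involves \<open>l\<close> alone, as in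
  \<open>block_prod\<close>.\<close>

definition monomial_mat :: "nat \<Rightarrow> (nat \<Rightarrow> nat) \<Rightarrow> (nat \<Rightarrow> complex) \<Rightarrow> complex mat" where
  "monomial_mat n p l = Matrix.mat n n (\<lambda>(i, j). if i = p j then l j else 0)"

lemma monomial_mat_carrier [simp]: "monomial_mat n p l \<in> carrier_mat n n"
  by (simp add: monomial_mat_def)

lemma monomial_mat_index [simp]:
  "i < n \<Longrightarrow> j < n \<Longrightarrow> monomial_mat n p l $$ (i, j) = (if i = p j then l j else 0)"
  by (simp add: monomial_mat_def)

lemma monomial_mat_cong:
  "(\<And>j. j < n \<Longrightarrow> l j = l' j) \<Longrightarrow> monomial_mat n p l = monomial_mat n p l'"
  by (intro eq_matI) (auto simp: monomial_mat_def)

lemma monomial_mat_mult: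
  assumes "p' \<in> perms n"
  shows "monomial_mat n p l * monomial_mat n p' l' = monomial_mat n (p \<circ> p') (\<lambda>j. l (p' j) * l' j)"
proof (rule eq_matI)
  fix i j assume "i < dim_row (monomial_mat n (p \<circ> p') (\<lambda>j. l (p' j) * l' j))"
    "j < dim_col (monomial_mat n (p \<circ> p') (\<lambda>j. l (p' j) * l' j))"
  then have ij: "i < n" "j < n" by (simp_all add: monomial_mat_def)
  have "(monomial_mat n p l * monomial_mat n p' l') $$ (i, j) =
      (\<Sum>k<n. (if i = p k then l k else 0) * (if k = p' j then l' j else 0))"
    using ij by (simp add: monomial_mat_def scalar_prod_def atLeast0LessThan)
  also have "\<dots> = (\<Sum>k<n. if k = p' j then (if i = p k then l k else 0) * l' j else 0)"
    by (intro sum.cong) auto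
  also have "\<dots> = (if i = p (p' j) then l (p' j) else 0) * l' j"
    using perms_less[OF assms ij(2)] by simp
  finally show "(monomial_mat n p l * monomial_mat n p' l') $$ (i, j) =
      monomial_mat n (p \<circ> p') (\<lambda>j. l (p' j) * l' j) $$ (i, j)"
    using ij by simp
qed (simp_all add: monomial_mat_def)

lemma one_mat_monomial: "1\<^sub>m n = monomial_mat n id (\<lambda>_. 1)"
  by (intro eq_matI) (auto simp: monomial_mat_def)

lemma diag_mult_perm_mat_index:
  assumes D: "D \<in> carrier_mat n n" and p: "p permutes {..<n}" and ij: "i < n" "j < n"
  shows "(D * perm_mat n p) $$ (i, j) = D $$ (i, p j)"
proof -
  have pj: "p j < n" using p ij permutes_in_image[of p "{..<n}" j] by simp
  have "(D * perm_mat n p) $$ (i, j) = (\<Sum>k<n. D $$ (i, k) * (if k = p j then 1 else 0))"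
    using D ij by (simp add: perm_mat_def scalar_prod_def atLeast0LessThan)
  also have "\<dots> = (\<Sum>k<n. if k = p j then D $$ (i, k) else 0)"
    by (intro sum.cong) auto
  also have "\<dots> = D $$ (i, p j)" using pj by simp
  finally show ?thesis .
qed

lemma perm_part_monomial_mat:
  assumes p: "p \<in> perms n" and l: "\<And>j. j < n \<Longrightarrow> l j \<noteq> 0"
  shows "perm_part n (monomial_mat n p l) = p"
  unfolding perm_part_def
proof (rule the_equality)
  \<comment> \<open>A diagonal factor on the left scales rows, whereas \<open>l\<close> is indexed
    by columns; hence the inverse of \<open>p\<close>.\<close>
  define D where "D = Matrix.mat n n (\<lambda>(i, j). if i = j then l (inv_into UNIV p i) else (0::complex))"
  have D: "D \<in> carrier_mat n n" by (simp add: D_def)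
  have "monomial_mat n p l = D * perm_mat n p"
  proof (rule eq_matI)
    fix i j assume "i < dim_row (D * perm_mat n p)" "j < dim_col (D * perm_mat n p)"
    then have ij: "i < n" "j < n" by (simp_all add: D_def perm_mat_def)
    then have "(D * perm_mat n p) $$ (i, j) = D $$ (i, p j)"
      using diag_mult_perm_mat_index[OF D] p by (simp add: perms_def)
    then show "monomial_mat n p l $$ (i, j) = (D * perm_mat n p) $$ (i, j)"
      using ij p perms_less[OF p ij(2)] by (simp add: D_def)
  qed (simp_all add: D_def monomial_mat_def perm_mat_def)
  moreover have "diagonal_mat D" by (simp add: diagonal_mat_def D_def)
  ultimately show "p permutes {..<n} \<and> (\<exists>D\<in>carrier_mat n n. diagonal_mat D \<and> monomial_mat n p l = D * perm_mat n p)"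
    using p D by (auto simp: perms_def)
next
  fix q assume "q permutes {..<n} \<and> (\<exists>D\<in>carrier_mat n n. diagonal_mat D \<and> monomial_mat n p l = D * perm_mat n q)"
  then obtain D where q: "q permutes {..<n}" and D: "D \<in> carrier_mat n n" "diagonal_mat D"
    and e: "monomial_mat n p l = D * perm_mat n q" by blast
  have "q j = p j" if j: "j < n" for j
  proof -
    have "p j < n" "q j < n" using perms_less[OF p j] permutes_in_image[OF q, of j] j by auto
    moreover have "D $$ (p j, q j) \<noteq> 0"
      using diag_mult_perm_mat_index[OF D(1) q, of "p j" j] perms_less[OF p j] j l[OF j]
      unfolding e[symmetric] by simp
    moreover have "\<forall>i<n. \<forall>k<n. i \<noteq> k \<longrightarrow> D $$ (i, k) = 0" using D by (simp add: diagonal_mat_def)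
    ultimately show ?thesis by metis
  qed
  moreover have "q j = p j" if "\<not> j < n" for j
    using that perms_fix[OF p, of j] permutes_not_in[OF q, of j] by simp
  ultimately show "q = p" by blast
qed

lemma monomial_mat_inj:
  assumes "p \<in> perms n" "p' \<in> perms n" "l \<in> extensional {..<n}" "l' \<in> extensional {..<n}"
    and "\<And>j. j < n \<Longrightarrow> l j \<noteq> 0" "\<And>j. j < n \<Longrightarrow> l' j \<noteq> 0"
    and eq: "monomial_mat n p l = monomial_mat n p' l'"
  shows "p = p' \<and> l = l'"
proof
  show p: "p = p'" using perm_part_monomial_mat assms by metis
  show "l = l'"
  proof (rule extensionalityI[OF assms(3,4)])
    fix j assume "j \<in> {..<n}"
    then show "l j = l' j"
      using arg_cong[OF eq, of "\<lambda>A. A $$ (p j, j)"] perms_less[OF assms(1), of j] p by simp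
  qed
qed

definition block_prod :: "(nat \<Rightarrow> complex) \<Rightarrow> nat set \<Rightarrow> complex" where
  "block_prod l C = (\<Prod>a\<in>C. l a)"

lemma mat_cycles_monomial_mat:
  assumes "p \<in> perms n" "\<And>j. j < n \<Longrightarrow> l j \<noteq> 0"
  shows "mat_cycles n (monomial_mat n p l) = cycs {..<n} p"
  using perm_part_monomial_mat[OF assms] by (simp add: mat_cycles_def cycs_def)

lemma cycle_prod_monomial_mat:
  assumes "p \<in> perms n" "\<And>j. j < n \<Longrightarrow> l j \<noteq> 0" "C \<in> cycs {..<n} p"
  shows "cycle_prod n (monomial_mat n p l) C = block_prod l C"
proof -
  have "C \<subseteq> {..<n}" using cycs_subset assms(1,3) by (auto simp: perms_def)
  then show ?thesis
    unfolding cycle_prod_def block_prod_def using perm_part_monomial_mat[OF assms(1,2)]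
    by (intro prod.cong refl) (auto simp: perms_less[OF assms(1)])
qed

section \<open>Sums over labels in the cyclic group\<close>

locale root_of_unity =
  fixes r :: nat and \<zeta> :: complex
  assumes r2: "2 \<le> r" and prim: "primitive_root_unity r \<zeta>"
begin

definition Z :: "complex set" where "Z = (\<lambda>m. \<zeta> ^ m) ` {..<r}"

lemma zeta_power_r: "\<zeta> ^ r = 1"
  using prim by (simp add: primitive_root_unity_def)

lemma zeta_nz: "\<zeta> \<noteq> 0"
  using zeta_power_r r2 by (metis not_numeral_le_zero power_0_left zero_neq_one)

lemma zeta_power_mod: "\<zeta> ^ m = \<zeta> ^ (m mod r)"
  by (metis div_mult_mod_eq mult.commute mult_1 power_add power_mult power_one zeta_power_r)

lemma zeta_power_in_Z: "\<zeta> ^ m \<in> Z"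
  using zeta_power_mod[of m] r2 by (auto simp: Z_def)

lemma range_zeta: "range (\<lambda>m. \<zeta> ^ m) = Z"
  using zeta_power_in_Z by (auto simp: Z_def)

lemma zeta_power_inj: "inj_on (\<lambda>m. \<zeta> ^ m) {..<r}"
proof (rule linorder_inj_onI')
  fix i j assume ij: "i \<in> {..<r}" "j \<in> {..<r}" "i < j"
  then have "\<zeta> ^ (j - i) \<noteq> 1" using prim by (auto simp: primitive_root_unity_def)
  moreover have "\<zeta> ^ j = \<zeta> ^ i * \<zeta> ^ (j - i)" using ij by (simp flip: power_add)
  ultimately show "\<zeta> ^ i \<noteq> \<zeta> ^ j" using zeta_nz by simp
qed

lemma card_Z: "card Z = r"
  unfolding Z_def by (simp add: card_image[OF zeta_power_inj])

lemma finite_Z [simp, intro]: "finite Z" by (simp add: Z_def)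

lemma Z_1 [simp]: "1 \<in> Z" using zeta_power_in_Z[of 0] by simp

lemma zeta_in_Z [simp]: "\<zeta> \<in> Z" using zeta_power_in_Z[of 1] by simp

lemma zeta_neq_1: "\<zeta> \<noteq> 1"
  using prim r2 by (auto simp: primitive_root_unity_def dest: spec[of _ 1])

lemma Z_nz: "z \<in> Z \<Longrightarrow> z \<noteq> 0" using zeta_nz by (auto simp: Z_def)

lemma Z_mult: "x \<in> Z \<Longrightarrow> y \<in> Z \<Longrightarrow> x * y \<in> Z"
  unfolding range_zeta[symmetric] by (auto simp flip: power_add)

lemma Z_prod: "(\<And>a. a \<in> C \<Longrightarrow> l a \<in> Z) \<Longrightarrow> (\<Prod>a\<in>C. l a) \<in> Z"
  by (induction C rule: infinite_finite_induct) (auto intro: Z_mult)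

lemma Z_inverse: "x \<in> Z \<Longrightarrow> inverse x \<in> Z"
proof -
  assume "x \<in> Z"
  then obtain m where m: "m < r" "x = \<zeta> ^ m" by (auto simp: Z_def)
  then have "x * \<zeta> ^ (r - m) = 1" using zeta_power_r by (simp flip: power_add)
  then have "inverse x = \<zeta> ^ (r - m)" by (rule inverse_unique)
  then show ?thesis using zeta_power_in_Z by simp
qed

lemma Z_divide: "x \<in> Z \<Longrightarrow> y \<in> Z \<Longrightarrow> x / y \<in> Z"
  by (simp add: divide_inverse Z_mult Z_inverse)

lemma sum_Z_mult:
  assumes "y \<in> Z"
  shows "(\<Sum>x\<in>Z. f (y * x)) = (\<Sum>x\<in>Z. f x)"
  by (rule sum.reindex_bij_witness[of _ "\<lambda>x. x / y" "\<lambda>x. y * x"])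
     (use assms Z_nz in \<open>auto intro: Z_mult Z_divide\<close>)

text \<open>Extensional functions, so that a matrix determines its label function and not only its
  values below \<open>n\<close>.\<close>

definition Lab :: "nat set \<Rightarrow> (nat \<Rightarrow> complex) set" where
  "Lab A = PiE A (\<lambda>_. Z)"

lemma finite_Lab [simp, intro]: "finite A \<Longrightarrow> finite (Lab A)"
  by (simp add: Lab_def finite_PiE)

lemma Lab_in_Z: "l \<in> Lab A \<Longrightarrow> a \<in> A \<Longrightarrow> l a \<in> Z"
  by (auto simp: Lab_def)

lemma Lab_nz: "l \<in> Lab {..<n} \<Longrightarrow> j < n \<Longrightarrow> l j \<noteq> 0"
  using Lab_in_Z Z_nz by blast

lemma card_Lab: "finite A \<Longrightarrow> card (Lab A) = r ^ card A"
  by (simp add: Lab_def card_PiE card_Z)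

lemma block_prod_Lab: "l \<in> Lab A \<Longrightarrow> C \<subseteq> A \<Longrightarrow> block_prod l C \<in> Z"
  unfolding block_prod_def by (rule Z_prod) (use Lab_in_Z in blast)

text \<open>The product of independent uniform labels on a nonempty block is uniform on
  \<open>Z\<close>, because each further label only translates the sum.\<close>

lemma sum_Lab_block:
  fixes F :: "complex \<Rightarrow> real"
  assumes "finite C" "C \<noteq> {}"
  shows "(\<Sum>l\<in>Lab C. F (block_prod l C)) = real r ^ (card C - 1) * (\<Sum>z\<in>Z. F z)"
  using assms
proof (induction C arbitrary: F rule: finite_ne_induct)
  case (singleton x)
  have "(\<Sum>l\<in>Lab {x}. F (l x)) = (\<Sum>z\<in>Z. F z)"
    by (rule sum.reindex_bij_witness[of _ "\<lambda>z. restrict (\<lambda>_. z) {x}" "\<lambda>l. l x"])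
       (auto simp: Lab_def PiE_def extensional_def fun_eq_iff)
  then show ?case by (simp add: block_prod_def)
next
  case (insert x C)
  have d: "{x} \<inter> C = {}" using insert.hyps by simp
  have "(\<Sum>l\<in>Lab (insert x C). F (block_prod l (insert x C))) =
      (\<Sum>l1\<in>Lab {x}. \<Sum>l2\<in>Lab C. F (l1 x * block_prod l2 C))"
  proof -
    have "block_prod (\<lambda>y. if y \<in> {x} then l1 y else l2 y) (insert x C) = l1 x * block_prod l2 C" for l1 l2
    proof -
      have "(\<Prod>a\<in>C. if a \<in> {x} then l1 a else l2 a) = (\<Prod>a\<in>C. l2 a)"
        using insert.hyps by (intro prod.cong) auto
      then show ?thesis using insert.hyps by (simp add: block_prod_def)
    qed
    then show ?thesis
      using sum_PiE_union[OF d, of "\<lambda>l. F (block_prod l (insert x C))" "\<lambda>_. Z"] by (simp add: Lab_def)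
  qed
  also have "\<dots> = (\<Sum>l1\<in>Lab {x}. real r ^ (card C - 1) * (\<Sum>z\<in>Z. F (l1 x * z)))"
    by (intro sum.cong refl insert.IH)
  also have "\<dots> = (\<Sum>l1\<in>Lab {x}. real r ^ (card C - 1) * (\<Sum>z\<in>Z. F z))"
    by (intro sum.cong refl) (simp add: sum_Z_mult[OF Lab_in_Z])
  also have "\<dots> = real r ^ card C * (\<Sum>z\<in>Z. F z)"
    using insert.hyps by (simp add: card_Lab card_gt_0_iff flip: power_Suc mult.assoc)
  finally show ?case using insert.hyps by simp
qed

text \<open>Give a block weight \<open>r m + 1\<close> if its product is 1, and weight 1 otherwise.
  The mean weight against the trivial character is \<open>m + 1\<close>, against any other character
  \<open>m\<close>; the \<open>r - 1\<close> nontrivial characters add up at \<open>d\<close> to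
  \<open>r * of_bool (d = 1) - 1\<close>.\<close>

definition twist :: "nat \<Rightarrow> complex \<Rightarrow> nat \<Rightarrow> real" where
  "twist m d c = (real m + 1) ^ c + real m ^ c * (real r * of_bool (d = 1) - 1)"

text \<open>Conditioned on their total product, the products of uniformly random labels over the blocks of a
  partition are again uniform; \<open>twist\<close> evaluates the resulting sum by characters of the cyclic group.\<close>

lemma sum_Lab_partition:
  fixes m :: nat
  defines "w \<equiv> \<lambda>z. if z = 1 then real (r * m + 1) else 1"
  assumes "finite P" "\<And>C. C \<in> P \<Longrightarrow> finite C \<and> C \<noteq> {}" "disjoint P" "d \<in> Z"
  shows "(\<Sum>l\<in>Lab (\<Union>P). of_bool (block_prod l (\<Union>P) = d) * (\<Prod>C\<in>P. w (block_prod l C))) =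
    real r ^ card (\<Union>P) / real r * twist m d (card P)"
  using assms(2-)
proof (induction P arbitrary: d rule: finite_induct)
  case empty
  then show ?case using r2 by (auto simp: Lab_def block_prod_def twist_def field_simps)
next
  case (insert C P)
  define B where "B = \<Union>P"
  have C: "finite C" "C \<noteq> {}" using insert.prems(1)[of C] by auto
  have B: "finite B" unfolding B_def using insert.hyps insert.prems(1) by (intro finite_Union) auto
  have dis: "C \<inter> B = {}" unfolding B_def using insert.prems(2) insert.hyps(2)
    by (auto simp: pairwise_insert disjnt_def)
  have PB: "D \<subseteq> B" if "D \<in> P" for D using that by (auto simp: B_def)
  let ?j = "\<lambda>l1 l2 x. if x \<in> C then l1 x else l2 x"
  have jC: "block_prod (?j l1 l2) C = block_prod l1 C" for l1 l2
    unfolding block_prod_def by (intro prod.cong) auto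
  have jB: "block_prod (?j l1 l2) D = block_prod l2 D" if "D \<subseteq> B" for l1 l2 D
    unfolding block_prod_def using that dis by (intro prod.cong) auto
  have jCB: "block_prod (?j l1 l2) (C \<union> B) = block_prod l1 C * block_prod l2 B" for l1 l2
    using prod.union_disjoint[OF C(1) B dis, of "?j l1 l2"] jC[of l1 l2] jB[of B l1 l2]
    by (simp add: block_prod_def)
  have IH: "(\<Sum>l\<in>Lab B. of_bool (block_prod l B = d') * (\<Prod>D\<in>P. w (block_prod l D))) =
      real r ^ card B / real r * twist m d' (card P)" if "d' \<in> Z" for d'
    unfolding B_def using insert.prems that by (intro insert.IH) (auto simp: pairwise_insert)
  have "(\<Sum>l\<in>Lab (C \<union> B). of_bool (block_prod l (C \<union> B) = d) * (\<Prod>D\<in>insert C P. w (block_prod l D))) =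
      (\<Sum>l1\<in>Lab C. \<Sum>l2\<in>Lab B. of_bool (block_prod l1 C * block_prod l2 B = d) *
        (w (block_prod l1 C) * (\<Prod>D\<in>P. w (block_prod l2 D))))"
    unfolding Lab_def sum_PiE_union[OF dis] using insert.hyps
    by (intro sum.cong refl) (simp add: jC jCB jB[OF PB])
  also have "\<dots> = (\<Sum>l1\<in>Lab C. w (block_prod l1 C) * (real r ^ card B / real r * twist m (d / block_prod l1 C) (card P)))"
  proof (rule sum.cong[OF refl])
    fix l1 assume l1: "l1 \<in> Lab C"
    have b: "block_prod l1 C \<in> Z" by (rule block_prod_Lab[OF l1]) simp
    have "block_prod l1 C * y = d \<longleftrightarrow> y = d / block_prod l1 C" for y using Z_nz[OF b] by (auto simp: field_simps)
    then show "(\<Sum>l2\<in>Lab B. of_bool (block_prod l1 C * block_prod l2 B = d) *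
        (w (block_prod l1 C) * (\<Prod>D\<in>P. w (block_prod l2 D)))) =
        w (block_prod l1 C) * (real r ^ card B / real r * twist m (d / block_prod l1 C) (card P))"
      unfolding IH[OF Z_divide[OF insert.prems(3) b], symmetric] sum_distrib_left
      by (intro sum.cong refl) simp
  qed
  also have "\<dots> = real r ^ (card C - 1) * (\<Sum>z\<in>Z. w z * (real r ^ card B / real r * twist m (d / z) (card P)))"
    by (rule sum_Lab_block[OF C, where F = "\<lambda>z. w z * (real r ^ card B / real r * twist m (d / z) (card P))"])
  also have "(\<Sum>z\<in>Z. w z * (real r ^ card B / real r * twist m (d / z) (card P))) =
      real r ^ card B / real r * (real r * twist m d (Suc (card P)))"
  proof -
    have w1: "(\<Sum>z\<in>Z. w z) = real r * (real m + 1)"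
    proof -
      have "w z = 1 + (if z = 1 then real (r * m) else 0)" for z by (simp add: w_def)
      then show ?thesis by (simp add: sum.distrib card_Z algebra_simps)
    qed
    \<comment> \<open>As a function of \<open>z\<close>, \<open>twist m (d / z)\<close> is a
      constant plus a spike at \<open>z = d\<close>. The spike leaves
      \<open>w d = 1 + r m * of_bool (d = 1)\<close>, which restores the shape of
      \<open>twist\<close> with one more block.\<close>
    have eq: "w z * twist m (d / z) (card P) =
        ((real m + 1) ^ card P - real m ^ card P) * w z + real m ^ card P * real r * (if z = d then w d else 0)" if "z \<in> Z" for z
    proof -
      have "d / z = 1 \<longleftrightarrow> z = d" using Z_nz[OF that] by (auto simp: field_simps)
      then show ?thesis by (simp add: twist_def algebra_simps)
    qed
    have "(\<Sum>z\<in>Z. w z * twist m (d / z) (card P)) =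
        ((real m + 1) ^ card P - real m ^ card P) * (real r * (real m + 1)) + real m ^ card P * real r * w d"
      using insert.prems(3) by (simp add: eq sum.distrib w1 flip: sum_distrib_left)
    also have "\<dots> = real r * twist m d (Suc (card P))"
      by (simp add: twist_def w_def algebra_simps)
    finally have "(\<Sum>z\<in>Z. w z * twist m (d / z) (card P)) = real r * twist m d (Suc (card P))" .
    moreover have "(\<Sum>z\<in>Z. w z * (c * twist m (d / z) (card P))) = c * (\<Sum>z\<in>Z. w z * twist m (d / z) (card P))" for c
      by (simp add: sum_distrib_left mult_ac)
    ultimately show ?thesis by (simp only:)
  qed
  finally have "(\<Sum>l\<in>Lab (C \<union> B). of_bool (block_prod l (C \<union> B) = d) * (\<Prod>D\<in>insert C P. w (block_prod l D))) =
      real r ^ (card C - 1) * real r ^ card B * twist m d (Suc (card P))" using r2 by simp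
  moreover have "real r ^ (card C + card B) / real r = real r ^ (card C - 1) * real r ^ card B"
    using C r2 by (cases "card C") (auto simp: power_add)
  ultimately show ?case
    using insert.hyps card_Un_disjoint[OF C(1) B dis] by (simp add: B_def)
qed

section \<open>Parametrisation of the group by permutations and labels\<close>

lemma monomial_mat_in_G:
  assumes p: "p \<in> perms n" and l: "\<And>j. j < n \<Longrightarrow> l j \<in> Z"
  shows "monomial_mat n p l \<in> G_grp \<zeta> n"
proof -
  have nz: "l j \<noteq> 0" if "j < n" for j using l Z_nz that by blast
  have 1: "\<exists>!j. j < n \<and> monomial_mat n p l $$ (i, j) \<noteq> 0" if i: "i < n" for i
  proof (rule ex1I[of _ "inv_into UNIV p i"])
    show "inv_into UNIV p i < n \<and> monomial_mat n p l $$ (i, inv_into UNIV p i) \<noteq> 0"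
      using i p nz perms_less[OF perms_inv[OF p] i] by simp
    show "j = inv_into UNIV p i" if "j < n \<and> monomial_mat n p l $$ (i, j) \<noteq> 0" for j
      using that i p by (auto split: if_splits)
  qed
  have 2: "\<exists>!i. i < n \<and> monomial_mat n p l $$ (i, j) \<noteq> 0" if j: "j < n" for j
    by (rule ex1I[of _ "p j"]) (use j p nz perms_less[OF p j] in \<open>auto split: if_splits\<close>)
  show ?thesis unfolding G_grp_def range_zeta using 1 2 l by auto
qed

lemma G_imp_monomial_mat:
  assumes x: "x \<in> G_grp \<zeta> n"
  shows "\<exists>p\<in>perms n. \<exists>l\<in>Lab {..<n}. x = monomial_mat n p l"
proof -
  have xc: "x \<in> carrier_mat n n"
    and row: "\<And>i. i < n \<Longrightarrow> \<exists>!j. j < n \<and> x $$ (i, j) \<noteq> 0"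
    and col: "\<And>j. j < n \<Longrightarrow> \<exists>!i. i < n \<and> x $$ (i, j) \<noteq> 0"
    and ent: "\<And>i j. i < n \<Longrightarrow> j < n \<Longrightarrow> x $$ (i, j) \<noteq> 0 \<Longrightarrow> x $$ (i, j) \<in> Z"
    using x unfolding G_grp_def range_zeta mem_Collect_eq by simp_all
  define p where "p j = (if j < n then (THE i. i < n \<and> x $$ (i, j) \<noteq> 0) else j)" for j
  define l where "l = restrict (\<lambda>j. x $$ (p j, j)) {..<n}"
  have pj: "p j < n \<and> x $$ (p j, j) \<noteq> 0" if j: "j < n" for j
    unfolding p_def using theI'[OF col[OF j]] j by simp
  have pu: "i = p j" if "j < n" "i < n" "x $$ (i, j) \<noteq> 0" for i j
    using col[OF that(1)] pj[OF that(1)] that by blast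
  have "inj_on p {..<n}"
  proof (rule inj_onI)
    fix a b assume ab: "a \<in> {..<n}" "b \<in> {..<n}" "p a = p b"
    then have "a < n \<and> x $$ (p a, a) \<noteq> 0" "b < n \<and> x $$ (p a, b) \<noteq> 0" "p a < n" using pj[of a] pj[of b] by auto
    then show "a = b" using row[of "p a"] by blast
  qed
  moreover have "p ` {..<n} \<subseteq> {..<n}" using pj by auto
  ultimately have "bij_betw p {..<n} {..<n}"
    by (simp add: bij_betw_def endo_inj_surj)
  then have "p permutes {..<n}" by (rule bij_imp_permutes) (simp add: p_def)
  then have p: "p \<in> perms n" by (simp add: perms_def)
  have l: "l \<in> Lab {..<n}" using pj ent by (auto simp: Lab_def l_def)
  have "x = monomial_mat n p l"
  proof (rule eq_matI)
    fix i j assume "i < dim_row (monomial_mat n p l)" "j < dim_col (monomial_mat n p l)"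
    then have ij: "i < n" "j < n" by (simp_all add: monomial_mat_def)
    show "x $$ (i, j) = monomial_mat n p l $$ (i, j)"
      using ij pu[of j i] by (auto simp: l_def)
  qed (use xc in \<open>auto simp: monomial_mat_def\<close>)
  then show ?thesis using p l by blast
qed

lemma inj_on_monomial_mat:
  "inj_on (\<lambda>(p, l). monomial_mat n p l) (perms n \<times> Lab {..<n})"
proof (rule inj_onI, clarify)
  fix p l p' l'
  assume "p \<in> perms n" "l \<in> Lab {..<n}" "p' \<in> perms n" "l' \<in> Lab {..<n}"
    "monomial_mat n p l = monomial_mat n p' l'"
  then show "p = p' \<and> l = l'"
    by (intro monomial_mat_inj[of p n p' l l']) (auto simp: Lab_nz, auto simp: Lab_def PiE_def)
qed

lemma G_grp_eq: "G_grp \<zeta> n = (\<lambda>(p, l). monomial_mat n p l) ` (perms n \<times> Lab {..<n})"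
  using G_imp_monomial_mat[of _ n] monomial_mat_in_G[of _ n] Lab_in_Z[of _ "{..<n}"] by (force simp: image_iff)

lemma finite_G [simp, intro]: "finite (G_grp \<zeta> n)"
  unfolding G_grp_eq by (intro finite_imageI finite_cartesian_product) auto

lemma sum_G: "(\<Sum>x\<in>G_grp \<zeta> n. F x) = (\<Sum>p\<in>perms n. \<Sum>l\<in>Lab {..<n}. F (monomial_mat n p l))"
  unfolding G_grp_eq sum.reindex[OF inj_on_monomial_mat] sum.cartesian_product
  by (intro sum.cong) auto

lemma card_G: "card (G_grp \<zeta> n) = fact n * r ^ n"
  unfolding G_grp_eq card_image[OF inj_on_monomial_mat] by (simp add: card_cartesian_product card_perms card_Lab)

lemma sum_subset_G:
  fixes F :: "complex mat \<Rightarrow> real"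
  assumes "K \<subseteq> G_grp \<zeta> n"
  shows "(\<Sum>x\<in>K. F x) = (\<Sum>p\<in>perms n. \<Sum>l\<in>Lab {..<n}. of_bool (monomial_mat n p l \<in> K) * F (monomial_mat n p l))"
proof -
  have "(\<Sum>x\<in>K. F x) = (\<Sum>x\<in>G_grp \<zeta> n. of_bool (x \<in> K) * F x)"
    using assms by (intro sum.mono_neutral_cong_left) auto
  then show ?thesis unfolding sum_G .
qed

lemma ell_monomial_mat:
  assumes "p \<in> perms n" "\<And>j. j < n \<Longrightarrow> l j \<in> Z"
  shows "ell r \<zeta> n (monomial_mat n p l) = card {C \<in> cycs {..<n} p. block_prod l C = 1}"
proof -
  have nz: "\<And>j. j < n \<Longrightarrow> l j \<noteq> 0" using assms(2) Z_nz by blast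
  have "{C \<in> mat_cycles n (monomial_mat n p l). cycle_prod n (monomial_mat n p l) C = 1} =
      {C \<in> cycs {..<n} p. block_prod l C = 1}"
    using mat_cycles_monomial_mat[OF assms(1) nz] cycle_prod_monomial_mat[OF assms(1) nz] by auto
  then show ?thesis using r2 by (simp add: ell_def cycle_type_def)
qed

lemma ell_le: "x \<in> G_grp \<zeta> n \<Longrightarrow> ell r \<zeta> n x \<le> n"
proof -
  assume "x \<in> G_grp \<zeta> n"
  then obtain p l where x: "p \<in> perms n" "l \<in> Lab {..<n}" "x = monomial_mat n p l"
    using G_imp_monomial_mat by blast
  have "ell r \<zeta> n x = card {C \<in> cycs {..<n} p. block_prod l C = 1}"
    unfolding x(3) using x Lab_in_Z by (intro ell_monomial_mat) auto
  also have "\<dots> \<le> nc n p" unfolding ncyc_def by (intro card_mono) auto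
  finally show ?thesis using nc_le[of n p] by simp
qed

lemma power_ell_monomial_mat:
  assumes "p \<in> perms n" "\<And>j. j < n \<Longrightarrow> l j \<in> Z"
  shows "c ^ ell r \<zeta> n (monomial_mat n p l) = (\<Prod>C\<in>cycs {..<n} p. if block_prod l C = 1 then c else (1::real))"
  using ell_monomial_mat[OF assms] by (simp add: prod.If_cases Int_def)

text \<open>\<open>ell\<close> counts the cycles with product 1, so the power is a product over the
  cycles and \<open>sum_Lab_partition\<close> applies to the partition into cycles.\<close>

lemma sum_Lab_ell:
  assumes n: "0 < n" and p: "p \<in> perms n" and d: "d \<in> Z"
  shows "(\<Sum>l\<in>Lab {..<n}. of_bool (block_prod l {..<n} = d) * real (r * m + 1) ^ ell r \<zeta> n (monomial_mat n p l)) =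
    real r ^ (n - 1) * twist m d (nc n p)"
proof -
  have pp: "p permutes {..<n}" using p by (simp add: perms_def)
  note part = partition_on_cycs[OF pp finite_lessThan]
  have U: "\<Union>(cycs {..<n} p) = {..<n}" by (rule Union_cycs[OF pp finite_lessThan])
  have "(\<Sum>l\<in>Lab {..<n}. of_bool (block_prod l {..<n} = d) * real (r * m + 1) ^ ell r \<zeta> n (monomial_mat n p l)) =
    (\<Sum>l\<in>Lab {..<n}. of_bool (block_prod l {..<n} = d) * (\<Prod>C\<in>cycs {..<n} p. if block_prod l C = 1 then real (r * m + 1) else 1))"
    by (intro sum.cong refl arg_cong2[of _ _ _ _ times] power_ell_monomial_mat[OF p]) (auto intro: Lab_in_Z)
  also have "\<dots> = real r ^ card {..<n} / real r * twist m d (card (cycs {..<n} p))"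
    using sum_Lab_partition[of "cycs {..<n} p" d m] part d finite_elements[OF _ part] cycs_subset[OF pp]
    unfolding U by (auto simp: partition_on_def intro: finite_subset)
  also have "real r ^ card {..<n} / real r = real r ^ (n - 1)"
    using n r2 by (cases n) auto
  finally show ?thesis by (simp add: ncyc_def)
qed

section \<open>Multiplication by a random labelled long cycle\<close>

text \<open>Permuting and translating labels is a bijection that only changes the total product, by
  that of \<open>c\<close>. This is why the labels of the other factor matter only through their
  product.\<close>

lemma sum_Lab_shift:
  fixes F :: "complex mat \<Rightarrow> real"
  assumes u: "u \<in> perms n" and c: "\<And>j. j < n \<Longrightarrow> c j \<in> Z"
  shows "(\<Sum>l\<in>Lab {..<n}. of_bool (block_prod l {..<n} = d) * F (monomial_mat n q (\<lambda>j. l (u j) * c j))) =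
    (\<Sum>l\<in>Lab {..<n}. of_bool (block_prod l {..<n} = d * block_prod c {..<n}) * F (monomial_mat n q l))"
proof (rule sum.reindex_bij_witness[where
      i = "\<lambda>l. restrict (\<lambda>j. l (inv_into UNIV u j) / c (inv_into UNIV u j)) {..<n}"
      and j = "\<lambda>l. restrict (\<lambda>j. l (u j) * c j) {..<n}"])
  have cn: "c j \<noteq> 0" if "j < n" for j using c[OF that] Z_nz by blast
  note ul = perms_less[OF u] and iul = perms_less[OF perms_inv[OF u]]
  fix l assume l: "l \<in> Lab {..<n}"
  then have le: "l \<in> extensional {..<n}" by (simp add: Lab_def PiE_def)
  show "restrict (\<lambda>j. restrict (\<lambda>j. l (u j) * c j) {..<n} (inv_into UNIV u j) / c (inv_into UNIV u j)) {..<n} = l"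
    by (rule extensionalityI[OF _ le]) (use u ul iul cn in auto)
  show "restrict (\<lambda>j. restrict (\<lambda>j. l (inv_into UNIV u j) / c (inv_into UNIV u j)) {..<n} (u j) * c j) {..<n} = l"
    by (rule extensionalityI[OF _ le]) (use u ul iul cn in auto)
  show "restrict (\<lambda>j. l (u j) * c j) {..<n} \<in> Lab {..<n}"
    unfolding Lab_def using ul c Lab_in_Z[OF l] by (auto intro!: Z_mult)
  show "restrict (\<lambda>j. l (inv_into UNIV u j) / c (inv_into UNIV u j)) {..<n} \<in> Lab {..<n}"
    unfolding Lab_def using iul c Lab_in_Z[OF l] by (auto intro!: Z_divide)
  have "(\<Prod>j<n. l (u j)) = (\<Prod>j<n. l j)"
    by (rule prod.reindex_bij_betw[OF perms_bij[OF u]])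
  then have "block_prod (restrict (\<lambda>j. l (u j) * c j) {..<n}) {..<n} = block_prod l {..<n} * block_prod c {..<n}"
    by (simp add: block_prod_def prod.distrib)
  moreover have "block_prod c {..<n} \<noteq> 0" using cn by (simp add: block_prod_def)
  moreover have "monomial_mat n q (restrict (\<lambda>j. l (u j) * c j) {..<n}) = monomial_mat n q (\<lambda>j. l (u j) * c j)"
    by (rule monomial_mat_cong) simp
  ultimately show "of_bool (block_prod (restrict (\<lambda>j. l (u j) * c j) {..<n}) {..<n} = d * block_prod c {..<n}) *
      F (monomial_mat n q (restrict (\<lambda>j. l (u j) * c j) {..<n})) =
      of_bool (block_prod l {..<n} = d) * F (monomial_mat n q (\<lambda>j. l (u j) * c j))"
    by simp
qed

definition cyc_class :: "nat \<Rightarrow> complex \<Rightarrow> complex mat set" where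
  "cyc_class n z = {monomial_mat n p l | p l. p \<in> perms n \<and> l \<in> Lab {..<n} \<and> nc n p = 1 \<and> block_prod l {..<n} = z}"

lemma cyc_class_subset: "cyc_class n z \<subseteq> G_grp \<zeta> n"
  unfolding cyc_class_def G_grp_eq by auto

lemma mem_class_iff:
  assumes "p \<in> perms n" "l \<in> Lab {..<n}"
  shows "monomial_mat n p l \<in> {monomial_mat n p l | p l. p \<in> perms n \<and> l \<in> Lab {..<n} \<and> Q p l} \<longleftrightarrow> Q p l"
proof
  assume "monomial_mat n p l \<in> {monomial_mat n p l | p l. p \<in> perms n \<and> l \<in> Lab {..<n} \<and> Q p l}"
  then obtain p' l' where "p' \<in> perms n" "l' \<in> Lab {..<n}" "Q p' l'" "monomial_mat n p l = monomial_mat n p' l'" by auto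
  then show "Q p l" using inj_onD[OF inj_on_monomial_mat[of n], of "(p, l)" "(p', l')"] assms by auto
qed (use assms in blast)

lemma mem_cyc_class_iff:
  assumes "p \<in> perms n" "l \<in> Lab {..<n}"
  shows "monomial_mat n p l \<in> cyc_class n z \<longleftrightarrow> nc n p = 1 \<and> block_prod l {..<n} = z"
  unfolding cyc_class_def by (rule mem_class_iff[OF assms])

lemma sum_cyc_class:
  fixes F :: "complex mat \<Rightarrow> real"
  shows "(\<Sum>x\<in>cyc_class n z. F x) =
    (\<Sum>p\<in>perms n. one_cyc n p * (\<Sum>l\<in>Lab {..<n}. of_bool (block_prod l {..<n} = z) * F (monomial_mat n p l)))"
  unfolding sum_subset_G[OF cyc_class_subset] sum_distrib_left
  by (intro sum.cong refl) (simp add: mem_cyc_class_iff one_cyc_def)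

text \<open>Orthogonality of characters: the convolution keeps matching characters only. The trivial
  one gives the first term; the others share one value, weighted by the sum of their values at
  \<open>d2\<close>, which is \<open>r - 1\<close> or \<open>-1\<close>.\<close>

lemma sum_twist:
  assumes d2: "d2 \<in> Z"
  shows "(\<Sum>d\<in>Z. twist m d a * twist w (d2 * d) b) =
    real r * ((real m + 1) ^ a * (real w + 1) ^ b + (if d2 = 1 then real r - 1 else -1) * (real m ^ a * real w ^ b))"
proof -
  have iff: "d2 * d = 1 \<longleftrightarrow> d = inverse d2" if "d \<in> Z" for d
    using Z_nz[OF d2] Z_nz[OF that] by (auto simp: field_simps)
  have s1: "(\<Sum>d\<in>Z. of_bool (d = 1) :: real) = 1" "(\<Sum>d\<in>Z. of_bool (d2 * d = 1) :: real) = 1"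
  proof -
    show "(\<Sum>d\<in>Z. of_bool (d = 1) :: real) = 1" by (simp add: of_bool_def)
    have "(\<Sum>d\<in>Z. of_bool (d2 * d = 1) :: real) = (\<Sum>d\<in>Z. if d = inverse d2 then 1 else 0)"
      by (intro sum.cong) (auto simp: iff)
    then show "(\<Sum>d\<in>Z. of_bool (d2 * d = 1) :: real) = 1" using Z_inverse[OF d2] by simp
  qed
  have s2: "(\<Sum>d\<in>Z. of_bool (d = 1) * of_bool (d2 * d = 1) :: real) = of_bool (d2 = 1)"
  proof -
    have "(\<Sum>d\<in>Z. of_bool (d = 1) * of_bool (d2 * d = 1) :: real) = (\<Sum>d\<in>Z. if d = 1 then of_bool (d2 = 1) else 0)"
      by (intro sum.cong) auto
    then show ?thesis by simp
  qed
  define A B M W where "A = (real m + 1) ^ a" and "B = (real w + 1) ^ b" and "M = real m ^ a" and "W = real w ^ b"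
  have "twist m d a * twist w (d2 * d) b =
      (A - M) * (B - W) + (A - M) * W * real r * of_bool (d2 * d = 1) +
      M * (B - W) * real r * of_bool (d = 1) + M * W * real r ^ 2 * (of_bool (d = 1) * of_bool (d2 * d = 1))" for d
    by (simp add: twist_def A_def B_def M_def W_def algebra_simps power2_eq_square)
  then have "(\<Sum>d\<in>Z. twist m d a * twist w (d2 * d) b) =
      real r * ((A - M) * (B - W)) + (A - M) * W * real r + M * (B - W) * real r + M * W * real r ^ 2 * of_bool (d2 = 1)"
    by (simp only: sum.distrib sum_distrib_left[symmetric] s1 s2) (simp add: card_Z)
  also have "\<dots> = real r * (A * B + (if d2 = 1 then real r - 1 else -1) * (M * W))"
    by (simp add: algebra_simps power2_eq_square)
  finally show ?thesis by (simp add: A_def B_def M_def W_def)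
qed

text \<open>The labels of the long cycle are summed first, for a fixed \<open>x\<close>; this leaves
  a \<open>twist\<close> at the total label of the product. The labels of \<open>x\<close> then give
  a second \<open>twist\<close>, and the two are convolved by \<open>sum_twist\<close>.\<close>

lemma sum_cyc_class_G:
  assumes n: "0 < n" and t: "t \<in> perms n" and l2: "l2 \<in> Lab {..<n}"
  shows "(\<Sum>k\<in>cyc_class n 1. \<Sum>x\<in>G_grp \<zeta> n. real (r * m + 1) ^ ell r \<zeta> n x *
      real (r * w + 1) ^ ell r \<zeta> n (k * (monomial_mat n t l2 * x))) =
    real r ^ (2 * n - 1) * (triple_sum n (m + 1) (w + 1) t +
      (if block_prod l2 {..<n} = 1 then real r - 1 else -1) * triple_sum n m w t)"
proof -
  let ?N = "{..<n}" and ?d2 = "block_prod l2 {..<n}"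
  have d2: "?d2 \<in> Z" by (rule block_prod_Lab[OF l2]) simp
  have inner: "(\<Sum>l1\<in>Lab ?N. of_bool (block_prod l1 ?N = 1) * real (r * w + 1) ^ ell r \<zeta> n (monomial_mat n s l1 * (monomial_mat n t l2 * monomial_mat n p l))) =
      real r ^ (n - 1) * twist w (?d2 * block_prod l ?N) (nc n (s \<circ> t \<circ> p))"
    if s: "s \<in> perms n" and p: "p \<in> perms n" and l: "l \<in> Lab ?N" for s p l
  proof -
    define c where "c j = l2 (p j) * l j" for j
    have tp: "t \<circ> p \<in> perms n" using t p by (rule perms_comp)
    have c: "c j \<in> Z" if "j < n" for j
      unfolding c_def using Lab_in_Z[OF l2] Lab_in_Z[OF l] perms_less[OF p that] that by (auto intro: Z_mult)
    have "(\<Prod>j<n. l2 (p j)) = (\<Prod>j<n. l2 j)" by (rule prod.reindex_bij_betw[OF perms_bij[OF p]])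
    then have bc: "block_prod c ?N = ?d2 * block_prod l ?N" by (simp add: block_prod_def c_def prod.distrib)
    have mm: "monomial_mat n s l1 * (monomial_mat n t l2 * monomial_mat n p l) =
        monomial_mat n (s \<circ> t \<circ> p) (\<lambda>j. l1 ((t \<circ> p) j) * c j)" for l1
      unfolding monomial_mat_mult[OF p] monomial_mat_mult[OF tp] c_def by (simp add: o_assoc)
    have "(\<Sum>l1\<in>Lab ?N. of_bool (block_prod l1 ?N = 1) * real (r * w + 1) ^ ell r \<zeta> n (monomial_mat n s l1 * (monomial_mat n t l2 * monomial_mat n p l))) =
      (\<Sum>l'\<in>Lab ?N. of_bool (block_prod l' ?N = 1 * block_prod c ?N) * real (r * w + 1) ^ ell r \<zeta> n (monomial_mat n (s \<circ> t \<circ> p) l'))"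
      unfolding mm by (rule sum_Lab_shift[OF tp c])
    also have "\<dots> = real r ^ (n - 1) * twist w (block_prod c ?N) (nc n (s \<circ> t \<circ> p))"
      unfolding mult_1 by (rule sum_Lab_ell[OF n]) (use s t p c in \<open>auto intro: perms_comp simp: block_prod_def intro!: Z_prod\<close>)
    finally show ?thesis unfolding bc .
  qed
  \<comment> \<open>The total label \<open>d\<close> of \<open>x\<close> becomes a summation
    variable, so that \<open>sum_Lab_ell\<close> can be applied for each \<open>d\<close>
    separately.\<close>
  have outer: "(\<Sum>l\<in>Lab ?N. real (r * m + 1) ^ ell r \<zeta> n (monomial_mat n p l) *
      (real r ^ (n - 1) * twist w (?d2 * block_prod l ?N) b)) =
      real r ^ (2 * n - 1) * ((real m + 1) ^ nc n p * (real w + 1) ^ b +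
        (if ?d2 = 1 then real r - 1 else -1) * (real m ^ nc n p * real w ^ b))" if p: "p \<in> perms n" for p b
  proof -
    have "(\<Sum>l\<in>Lab ?N. real (r * m + 1) ^ ell r \<zeta> n (monomial_mat n p l) *
      (real r ^ (n - 1) * twist w (?d2 * block_prod l ?N) b)) =
      (\<Sum>l\<in>Lab ?N. \<Sum>d\<in>Z. if d = block_prod l ?N then real (r * m + 1) ^ ell r \<zeta> n (monomial_mat n p l) *
      (real r ^ (n - 1) * twist w (?d2 * d) b) else 0)"
      by (intro sum.cong refl) (simp add: block_prod_Lab)
    also have "\<dots> = (\<Sum>d\<in>Z. (\<Sum>l\<in>Lab ?N. of_bool (block_prod l ?N = d) * real (r * m + 1) ^ ell r \<zeta> n (monomial_mat n p l)) *
      (real r ^ (n - 1) * twist w (?d2 * d) b))"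
      unfolding sum_distrib_right by (subst sum.swap) (intro sum.cong refl, auto)
    also have "\<dots> = (\<Sum>d\<in>Z. (real r ^ (n - 1) * twist m d (nc n p)) * (real r ^ (n - 1) * twist w (?d2 * d) b))"
      by (rule sum.cong[OF refl], rule arg_cong2[of _ _ _ _ times], rule sum_Lab_ell[OF n p]) auto
    also have "\<dots> = (real r ^ (n - 1) * real r ^ (n - 1)) * (\<Sum>d\<in>Z. twist m d (nc n p) * twist w (?d2 * d) b)"
      by (simp add: sum_distrib_left mult_ac)
    also have "\<dots> = (real r ^ (n - 1) * real r ^ (n - 1) * real r) * ((real m + 1) ^ nc n p * (real w + 1) ^ b +
        (if ?d2 = 1 then real r - 1 else -1) * (real m ^ nc n p * real w ^ b))"
      unfolding sum_twist[OF d2] by (simp only: mult.assoc)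
    also have "real r ^ (n - 1) * real r ^ (n - 1) * real r = real r ^ (2 * n - 1)"
    proof -
      have "2 * n - 1 = (n - 1) + (n - 1) + 1" using n by simp
      then show ?thesis by (simp only: power_add power_one_right)
    qed
    finally show ?thesis .
  qed
  have "(\<Sum>k\<in>cyc_class n 1. \<Sum>x\<in>G_grp \<zeta> n. real (r * m + 1) ^ ell r \<zeta> n x *
      real (r * w + 1) ^ ell r \<zeta> n (k * (monomial_mat n t l2 * x))) =
    (\<Sum>s\<in>perms n. one_cyc n s * (\<Sum>p\<in>perms n. \<Sum>l\<in>Lab ?N. real (r * m + 1) ^ ell r \<zeta> n (monomial_mat n p l) *
      (\<Sum>l1\<in>Lab ?N. of_bool (block_prod l1 ?N = 1) * real (r * w + 1) ^ ell r \<zeta> n (monomial_mat n s l1 * (monomial_mat n t l2 * monomial_mat n p l)))))"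
    unfolding sum_cyc_class sum_G sum_distrib_left
    by (rule sum.cong[OF refl], subst sum.swap, rule sum.cong[OF refl], subst sum.swap, intro sum.cong refl) (simp only: mult_ac)
  also have "\<dots> = (\<Sum>s\<in>perms n. one_cyc n s * (\<Sum>p\<in>perms n. real r ^ (2 * n - 1) *
      ((real m + 1) ^ nc n p * (real w + 1) ^ nc n (s \<circ> t \<circ> p) +
        (if ?d2 = 1 then real r - 1 else -1) * (real m ^ nc n p * real w ^ nc n (s \<circ> t \<circ> p)))))"
    by (intro sum.cong refl, rule arg_cong2[of _ _ _ _ times], rule refl, intro sum.cong refl)
       (simp only: inner outer cong: sum.cong)
  also have "\<dots> = real r ^ (2 * n - 1) * (triple_sum n (m + 1) (w + 1) t +
      (if ?d2 = 1 then real r - 1 else -1) * triple_sum n m w t)"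
    unfolding triple_sum_def pair_count_def
    by (simp add: sum_distrib_left sum.distrib distrib_left mult_ac add.commute del: o_apply)
  finally show ?thesis .
qed

end

section \<open>Averages over conjugacy classes\<close>

lemma mset_set_card_single:
  assumes "finite S" "image_mset card (mset_set S) = {#k#}"
  obtains C where "S = {C}" "card C = k"
proof -
  have "card S = 1" using arg_cong[OF assms(2), of size] by simp
  then obtain C where "S = {C}" by (auto simp: card_1_singleton_iff)
  then show thesis using assms(2) that by simp
qed

lemma two_cycles:
  assumes p: "p \<in> perms n" and a: "a < n" "p a = a" and nc: "nc n p = 2"
  shows "cycs {..<n} p = {{a}, {..<n} - {a}}" "{a} \<noteq> {..<n} - {a}"
proof -
  have pp: "p permutes {..<n}" using p by (simp add: perms_def)
  have "{a} \<in> cycs {..<n} p" using a by (force simp: cycs_def orbit_eq_singleton_iff[THEN iffD2])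
  moreover obtain C D where CD: "cycs {..<n} p = {C, D}" "C \<noteq> D"
    using nc by (auto simp: ncyc_def card_2_iff)
  ultimately obtain E where E: "cycs {..<n} p = {{a}, E}" "E \<noteq> {a}" by fastforce
  have "{a} \<inter> E = {}" using partition_onD2[OF partition_on_cycs[OF pp finite_lessThan]] E
    by (simp add: disjoint_def)
  moreover have "{a} \<union> E = {..<n}" using Union_cycs[OF pp finite_lessThan] E by simp
  ultimately have "E = {..<n} - {a}" by blast
  then show "cycs {..<n} p = {{a}, {..<n} - {a}}" "{a} \<noteq> {..<n} - {a}" using E by auto
qed

lemma one_cycle:
  assumes p: "p \<in> perms n" and nc: "nc n p = 1"
  shows "cycs {..<n} p = {{..<n}}"
proof -
  obtain C where C: "cycs {..<n} p = {C}" using nc by (auto simp: ncyc_def card_1_singleton_iff)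
  then have "C = {..<n}" using Union_cycs[of p "{..<n}"] p by (simp add: perms_def)
  then show ?thesis using C by simp
qed

lemma cycle_card_1:
  assumes p: "p \<in> perms n" and C: "C \<in> cycs {..<n} p" "card C = 1"
  obtains a where "C = {a}" "a < n" "p a = a"
proof -
  obtain x where x: "x < n" "C = orbit p x" using C by (auto simp: cycs_def)
  have "x \<in> orbit p x" using p self_in_orbit_permutes[of p "{..<n}"] by (simp add: perms_def)
  then have "orbit p x = {x}" using C x by (auto simp: card_1_singleton_iff)
  moreover from this have "p x = x" by (simp only: orbit_eq_singleton_iff)
  ultimately show thesis using that[of x] x by simp
qed

section \<open>Iterated averages in place of product measures\<close>

definition avg :: "'a set \<Rightarrow> ('a \<Rightarrow> real) \<Rightarrow> real" where
  "avg K F = (\<Sum>x\<in>K. F x) / real (card K)"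

lemma avg_cong: "(\<And>x. x \<in> K \<Longrightarrow> F x = G x) \<Longrightarrow> avg K F = avg K G"
  by (simp add: avg_def cong: sum.cong)

lemma avg_linear: "(\<Sum>i\<in>I. c i * avg K (F i)) = avg K (\<lambda>x. \<Sum>i\<in>I. c i * F i x)"
proof -
  have "(\<Sum>x\<in>K. \<Sum>i\<in>I. c i * F i x) = (\<Sum>i\<in>I. c i * (\<Sum>x\<in>K. F i x))"
    by (subst sum.swap) (simp add: sum_distrib_left)
  then show ?thesis unfolding avg_def by (simp add: divide_inverse sum_distrib_right mult.assoc)
qed

lemma expectation_Pi_pmf_Suc:
  fixes F :: "(nat \<Rightarrow> 'a) \<Rightarrow> real"
  assumes K: "\<And>u. u \<le> m \<Longrightarrow> finite (K u) \<and> K u \<noteq> {}"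
  shows "measure_pmf.expectation (Pi_pmf {..<Suc m} d (\<lambda>u. pmf_of_set (K u))) F =
    avg (K m) (\<lambda>x. measure_pmf.expectation (Pi_pmf {..<m} d (\<lambda>u. pmf_of_set (K u))) (\<lambda>f. F (f(m := x))))"
proof -
  let ?P = "Pi_pmf {..<m} d (\<lambda>u. pmf_of_set (K u))"
  have fin: "finite (set_pmf ?P)"
    using K by (subst set_Pi_pmf) (auto intro!: finite_PiE_dflt)
  have "Pi_pmf {..<Suc m} d (\<lambda>u. pmf_of_set (K u)) = pmf_of_set (K m) \<bind> (\<lambda>x. map_pmf (\<lambda>f. f(m := x)) ?P)"
    unfolding lessThan_Suc by (subst Pi_pmf_insert') (simp_all add: map_pmf_def)
  also have "measure_pmf.expectation \<dots> F = (\<Sum>x\<in>K m. measure_pmf.expectation (map_pmf (\<lambda>f. f(m := x)) ?P) F /\<^sub>R real (card (K m)))"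
    using K[of m] fin by (subst pmf_expectation_bind_pmf_of_set) auto
  finally show ?thesis by (simp add: avg_def divide_inverse mult.commute sum_distrib_left fun_upd_def)
qed

text \<open>The first class is averaged innermost, with the elements of the later classes held
  fixed; this is the order in which the leading long cycle is to be summed.\<close>

primrec avgs :: "'a set list \<Rightarrow> ('a list \<Rightarrow> real) \<Rightarrow> real" where
  "avgs [] F = F []"
| "avgs (K # Ks) F = avgs Ks (\<lambda>xs. avg K (\<lambda>x. F (x # xs)))"

lemma avgs_snoc: "avgs (Ks @ [K]) F = avg K (\<lambda>x. avgs Ks (\<lambda>xs. F (xs @ [x])))"
  by (induction Ks arbitrary: F) simp_all

lemma avgs_cong: "(\<And>xs. list_all2 (\<in>) xs Ks \<Longrightarrow> F xs = G xs) \<Longrightarrow> avgs Ks F = avgs Ks G"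
proof (induction Ks arbitrary: F G)
  case (Cons K Ks)
  show ?case unfolding avgs.simps by (intro Cons.IH avg_cong Cons.prems) simp
qed simp

lemma avg_linear2:
  "(\<Sum>i\<in>I. \<Sum>j\<in>J. c i j * avg K (F i j)) = avg K (\<lambda>x. \<Sum>i\<in>I. \<Sum>j\<in>J. c i j * F i j x)"
  using avg_linear[where I = I and c = "\<lambda>_. 1" and K = K and F = "\<lambda>i x. \<Sum>j\<in>J. c i j * F i j x"]
  by (simp add: avg_linear)

lemma avgs_linear2:
  "(\<Sum>i\<in>I. \<Sum>j\<in>J. c i j * avgs Ks (F i j)) = avgs Ks (\<lambda>xs. \<Sum>i\<in>I. \<Sum>j\<in>J. c i j * F i j xs)"
  by (induction Ks arbitrary: F) (simp_all add: avg_linear2)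

lemma avgs_divide: "avgs Ks (\<lambda>xs. F xs / c) = avgs Ks F / c"
proof (induction Ks arbitrary: F)
  case (Cons K Ks)
  have "avg K (\<lambda>x. F (x # xs) / c) = avg K (\<lambda>x. F (x # xs)) / c" for xs
    by (simp add: avg_def sum_divide_distrib[symmetric] mult.commute)
  then show ?case by (simp add: Cons)
qed simp

text \<open>Reverse induction, because the product measure on \<open>{..<Suc m}\<close> splits off
  its last coordinate; \<open>avgs_snoc\<close> is the matching step for
  \<open>avgs\<close>.\<close>

lemma expectation_Pi_pmf_list:
  fixes F :: "'a list \<Rightarrow> real"
  assumes "\<And>K. K \<in> set Ks \<Longrightarrow> finite K \<and> K \<noteq> {}"
  shows "measure_pmf.expectation (Pi_pmf {..<length Ks} d (\<lambda>u. pmf_of_set (Ks ! u))) (\<lambda>k. F (map k [0..<length Ks])) = avgs Ks F"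
  using assms
proof (induction Ks arbitrary: F rule: rev_induct)
  case (snoc K Ks)
  let ?m = "length Ks"
  have upd: "map (f(?m := x)) [0..<Suc ?m] = map f [0..<?m] @ [x]" for f and x :: 'a by simp
  have "finite ((Ks @ [K]) ! u) \<and> (Ks @ [K]) ! u \<noteq> {}" if "u \<le> ?m" for u
    using snoc.prems nth_mem[of u "Ks @ [K]"] that by (simp del: set_append)
  then have "measure_pmf.expectation (Pi_pmf {..<Suc ?m} d (\<lambda>u. pmf_of_set ((Ks @ [K]) ! u))) (\<lambda>k. F (map k [0..<Suc ?m])) =
      avg ((Ks @ [K]) ! ?m) (\<lambda>x. measure_pmf.expectation (Pi_pmf {..<?m} d (\<lambda>u. pmf_of_set ((Ks @ [K]) ! u)))
        (\<lambda>f. F (map (f(?m := x)) [0..<Suc ?m])))"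
    by (rule expectation_Pi_pmf_Suc)
  also have "Pi_pmf {..<?m} d (\<lambda>u. pmf_of_set ((Ks @ [K]) ! u)) = Pi_pmf {..<?m} d (\<lambda>u. pmf_of_set (Ks ! u))"
    by (intro Pi_pmf_cong) (auto simp: nth_append)
  finally show ?case unfolding upd
    using snoc.IH[of "\<lambda>xs. F (xs @ [x])" for x] snoc.prems by (simp add: avgs_snoc)
qed simp

context root_of_unity begin

section \<open>Cycle types of the classes that occur in \<open>mu\<close>\<close>

definition type_part :: "nat \<Rightarrow> (nat \<Rightarrow> nat) \<Rightarrow> (nat \<Rightarrow> complex) \<Rightarrow> complex \<Rightarrow> nat multiset" where
  "type_part n p l z = image_mset card (mset_set {C \<in> cycs {..<n} p. block_prod l C = z})"

lemma finite_block_set [simp]: "finite {C \<in> cycs {..<n} p. block_prod l C = z}"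
  by simp

lemma cycle_type_eq_iff:
  assumes p: "p \<in> perms n" and l: "l \<in> Lab {..<n}" and len: "length \<Lambda> = r"
  shows "cycle_type r \<zeta> n (monomial_mat n p l) = \<Lambda> \<longleftrightarrow> (\<forall>m<r. type_part n p l (\<zeta> ^ m) = \<Lambda> ! m)"
proof -
  have nz: "\<And>j. j < n \<Longrightarrow> l j \<noteq> 0" using Lab_nz[OF l] by blast
  have "{C \<in> mat_cycles n (monomial_mat n p l). cycle_prod n (monomial_mat n p l) C = z} =
      {C \<in> cycs {..<n} p. block_prod l C = z}" for z
    using mat_cycles_monomial_mat[OF p nz] cycle_prod_monomial_mat[OF p nz] by auto
  then have "cycle_type r \<zeta> n (monomial_mat n p l) = map (\<lambda>m. type_part n p l (\<zeta> ^ m)) [0..<r]"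
    unfolding cycle_type_def type_part_def by simp
  then show ?thesis using len by (simp add: list_eq_iff_nth_eq)
qed

lemma type_part_empty_iff:
  "type_part n p l z = {#} \<longleftrightarrow> (\<forall>C\<in>cycs {..<n} p. block_prod l C \<noteq> z)"
  unfolding type_part_def by (auto simp: mset_set_empty_iff)

lemma block_prod_cycle:
  assumes "p \<in> perms n" "l \<in> Lab {..<n}" "C \<in> cycs {..<n} p"
  obtains m where "m < r" "block_prod l C = \<zeta> ^ m"
proof -
  have "C \<subseteq> {..<n}" using cycs_subset assms(1,3) by (auto simp: perms_def)
  then have "block_prod l C \<in> Z" by (rule block_prod_Lab[OF assms(2)])
  then show thesis using that by (auto simp: Z_def)
qed

lemma zeta_power_eq_iff: "a < r \<Longrightarrow> b < r \<Longrightarrow> \<zeta> ^ a = \<zeta> ^ b \<longleftrightarrow> a = b"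
  using inj_onD[OF zeta_power_inj, of a b] by auto

text \<open>Treats both classes of a single long cycle, \<open>i = 0\<close> and
  \<open>i = 1\<close>. A cycle with another product would make another entry of the type
  nonempty.\<close>

lemma cycle_type_cyc:
  assumes p: "p \<in> perms n" and l: "l \<in> Lab {..<n}" and i: "i < r"
    and \<Lambda>: "length \<Lambda> = r" "\<Lambda> ! i = {#n#}" "\<And>m. m < r \<Longrightarrow> m \<noteq> i \<Longrightarrow> \<Lambda> ! m = {#}"
  shows "cycle_type r \<zeta> n (monomial_mat n p l) = \<Lambda> \<longleftrightarrow> nc n p = 1 \<and> block_prod l {..<n} = \<zeta> ^ i"
  unfolding cycle_type_eq_iff[OF p l \<Lambda>(1)]
proof
  assume A: "\<forall>m<r. type_part n p l (\<zeta> ^ m) = \<Lambda> ! m"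
  have all: "block_prod l C = \<zeta> ^ i" if C: "C \<in> cycs {..<n} p" for C
  proof -
    obtain m where m: "m < r" "block_prod l C = \<zeta> ^ m" using block_prod_cycle[OF p l C] .
    then have "type_part n p l (\<zeta> ^ m) \<noteq> {#}" using C by (auto simp: type_part_empty_iff)
    then have "m = i" using A m \<Lambda>(3)[of m] by metis
    then show ?thesis using m by simp
  qed
  then have eq: "{C \<in> cycs {..<n} p. block_prod l C = \<zeta> ^ i} = cycs {..<n} p" by auto
  have "type_part n p l (\<zeta> ^ i) = {#n#}" using A i \<Lambda>(2) by simp
  then have "image_mset card (mset_set (cycs {..<n} p)) = {#n#}"
    unfolding type_part_def eq .
  then obtain C where "cycs {..<n} p = {C}" by (rule mset_set_card_single[rotated]) auto
  then have nc: "nc n p = 1" by (simp add: ncyc_def)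
  then show "nc n p = 1 \<and> block_prod l {..<n} = \<zeta> ^ i" using all one_cycle[OF p nc] by simp
next
  assume A: "nc n p = 1 \<and> block_prod l {..<n} = \<zeta> ^ i"
  show "\<forall>m<r. type_part n p l (\<zeta> ^ m) = \<Lambda> ! m"
  proof (intro allI impI)
    fix m assume m: "m < r"
    have c: "cycs {..<n} p = {{..<n}}" using one_cycle[OF p] A by blast
    show "type_part n p l (\<zeta> ^ m) = \<Lambda> ! m"
    proof (cases "m = i")
      case True
      have "{C \<in> cycs {..<n} p. block_prod l C = \<zeta> ^ m} = {{..<n}}" using c A True by auto
      then show ?thesis using True \<Lambda>(2) by (simp add: type_part_def)
    next
      case False
      then have "\<zeta> ^ i \<noteq> \<zeta> ^ m" using zeta_power_eq_iff[OF i m] by auto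
      then show ?thesis using \<Lambda>(3)[OF m False] c A by (simp add: type_part_empty_iff)
    qed
  qed
qed

text \<open>The two parts lie in different entries, so the cycles are told apart by their products,
  even for \<open>n = 2\<close>, when both parts are 1.\<close>

lemma cycle_type_near_zeta:
  assumes p: "p \<in> perms n" and l: "l \<in> Lab {..<n}" and n: "2 \<le> n"
  shows "cycle_type r \<zeta> n (monomial_mat n p l) = {#n - 1#} # {#1#} # replicate (r - 2) {#} \<longleftrightarrow>
    nc n p = 2 \<and> (\<exists>a<n. p a = a \<and> l a = \<zeta> \<and> block_prod l ({..<n} - {a}) = 1)" (is "_ = ?\<Lambda> \<longleftrightarrow> _")
proof -
  have len: "length ?\<Lambda> = r" using r2 by simp
  have L: "?\<Lambda> ! 0 = {#n - 1#}" "?\<Lambda> ! 1 = {#1#}" "m < r \<Longrightarrow> m \<noteq> 0 \<Longrightarrow> m \<noteq> 1 \<Longrightarrow> ?\<Lambda> ! m = {#}" for m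
    by (simp_all add: nth_Cons')
  show ?thesis unfolding cycle_type_eq_iff[OF p l len]
  proof
    assume A: "\<forall>m<r. type_part n p l (\<zeta> ^ m) = ?\<Lambda> ! m"
    have t0: "type_part n p l 1 = {#n - 1#}" using A[rule_format, of 0] r2 L(1) by simp
    have t1: "type_part n p l \<zeta> = {#1#}" using A[rule_format, of 1] r2 L(2) by simp
    have all: "block_prod l C = 1 \<or> block_prod l C = \<zeta>" if C: "C \<in> cycs {..<n} p" for C
    proof -
      obtain m where m: "m < r" "block_prod l C = \<zeta> ^ m" using block_prod_cycle[OF p l C] .
      then have "type_part n p l (\<zeta> ^ m) \<noteq> {#}" using C by (auto simp: type_part_empty_iff)
      then have "m = 0 \<or> m = 1" using A m L(3)[of m] by metis
      then show ?thesis using m by auto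
    qed
    obtain C0 where C0: "{C \<in> cycs {..<n} p. block_prod l C = 1} = {C0}" "card C0 = n - 1"
      by (rule mset_set_card_single[OF finite_block_set t0[unfolded type_part_def]])
    obtain C1 where C1: "{C \<in> cycs {..<n} p. block_prod l C = \<zeta>} = {C1}" "card C1 = 1"
      by (rule mset_set_card_single[OF finite_block_set t1[unfolded type_part_def]])
    have C: "C0 \<in> cycs {..<n} p" "block_prod l C0 = 1" "C1 \<in> cycs {..<n} p" "block_prod l C1 = \<zeta>"
      using C0 C1 by blast+
    then have ne: "C0 \<noteq> C1" using zeta_neq_1 by auto
    have "cycs {..<n} p \<subseteq> {C0, C1}" using all C0 C1 by blast
    then have cyc: "cycs {..<n} p = {C0, C1}" using C by blast
    then have nc: "nc n p = 2" using ne by (simp add: ncyc_def)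
    obtain a where a: "C1 = {a}" "a < n" "p a = a" using cycle_card_1[OF p C(3) C1(2)] .
    then have "C0 = {..<n} - {a}" using two_cycles[OF p a(2,3) nc] cyc ne by (auto simp: doubleton_eq_iff)
    then show "nc n p = 2 \<and> (\<exists>a<n. p a = a \<and> l a = \<zeta> \<and> block_prod l ({..<n} - {a}) = 1)"
      using nc a C by (auto simp: block_prod_def)
  next
    assume A: "nc n p = 2 \<and> (\<exists>a<n. p a = a \<and> l a = \<zeta> \<and> block_prod l ({..<n} - {a}) = 1)"
    then obtain a where a: "a < n" "p a = a" "l a = \<zeta>" "block_prod l ({..<n} - {a}) = 1" and nc: "nc n p = 2" by blast
    define B where "B = {..<n} - {a}"
    note tc = two_cycles[OF p a(1,2) nc, folded B_def] and bB = a(4)[folded B_def]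
    have cB: "card B = n - 1" using a(1) by (simp add: B_def)
    have ba: "block_prod l {a} = \<zeta>" using a by (simp add: block_prod_def)
    have bz: "block_prod l B \<noteq> \<zeta>" "block_prod l {a} \<noteq> 1" using bB ba zeta_neq_1 by simp_all
    show "\<forall>m<r. type_part n p l (\<zeta> ^ m) = ?\<Lambda> ! m"
    proof (intro allI impI)
      fix m assume m: "m < r"
      consider "m = 0" | "m = 1" | "m \<noteq> 0" "m \<noteq> 1" by blast
      then show "type_part n p l (\<zeta> ^ m) = ?\<Lambda> ! m"
      proof cases
        case 1
        have "{C \<in> cycs {..<n} p. block_prod l C = 1} = {B}" unfolding tc(1) using bB bz by blast
        then show ?thesis using 1 cB by (simp add: type_part_def)
      next
        case 2
        have "{C \<in> cycs {..<n} p. block_prod l C = \<zeta>} = {{a}}" unfolding tc(1) using ba bz by blast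
        then show ?thesis using 2 by (simp add: type_part_def)
      next
        case 3
        have "\<zeta> ^ m \<noteq> 1" "\<zeta> ^ m \<noteq> \<zeta>"
          using 3 m r2 zeta_power_eq_iff[of m 0] zeta_power_eq_iff[of m 1] by auto
        then have "type_part n p l (\<zeta> ^ m) = {#}" unfolding type_part_empty_iff tc(1) using bB ba by simp
        then show ?thesis using L(3)[OF m 3] by simp
      qed
    qed
  qed
qed

lemma cycle_type_near_1:
  assumes p: "p \<in> perms n" and l: "l \<in> Lab {..<n}" and n: "2 \<le> n"
  shows "cycle_type r \<zeta> n (monomial_mat n p l) = {#n - 1, 1#} # replicate (r - 1) {#} \<longleftrightarrow>
    nc n p = 2 \<and> (\<exists>a<n. p a = a \<and> l a = 1 \<and> block_prod l ({..<n} - {a}) = 1)" (is "_ = ?\<Lambda> \<longleftrightarrow> _")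
proof -
  have len: "length ?\<Lambda> = r" using r2 by simp
  have L: "?\<Lambda> ! 0 = {#n - 1, 1#}" "m < r \<Longrightarrow> m \<noteq> 0 \<Longrightarrow> ?\<Lambda> ! m = {#}" for m
    by (simp_all add: nth_Cons')
  show ?thesis unfolding cycle_type_eq_iff[OF p l len]
  proof
    assume A: "\<forall>m<r. type_part n p l (\<zeta> ^ m) = ?\<Lambda> ! m"
    have all: "block_prod l C = 1" if C: "C \<in> cycs {..<n} p" for C
    proof -
      obtain m where m: "m < r" "block_prod l C = \<zeta> ^ m" using block_prod_cycle[OF p l C] .
      then have "type_part n p l (\<zeta> ^ m) \<noteq> {#}" using C by (auto simp: type_part_empty_iff)
      then have "m = 0" using A m L(2)[of m] by metis
      then show ?thesis using m by auto
    qed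
    then have eq: "{C \<in> cycs {..<n} p. block_prod l C = 1} = cycs {..<n} p" by auto
    have "type_part n p l 1 = {#n - 1, 1#}" using A[rule_format, of 0] r2 L(1) by simp
    then have t: "image_mset card (mset_set (cycs {..<n} p)) = {#n - 1, 1#}"
      unfolding type_part_def eq .
    have nc: "nc n p = 2" using arg_cong[OF t, of size] by (simp add: ncyc_def)
    \<comment> \<open>Both parts lie in the same entry, so the fixed point is found by its length;
      the other cycle is then its complement.\<close>
    have "1 \<in># image_mset card (mset_set (cycs {..<n} p))" unfolding t by simp
    then obtain C1 where C1: "C1 \<in> cycs {..<n} p" "card C1 = 1" by auto
    obtain a where a: "C1 = {a}" "a < n" "p a = a" using cycle_card_1[OF p C1] .
    show "nc n p = 2 \<and> (\<exists>a<n. p a = a \<and> l a = 1 \<and> block_prod l ({..<n} - {a}) = 1)"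
      using nc a all[OF C1(1)] all[of "{..<n} - {a}"] two_cycles[OF p a(2,3) nc] by (auto simp: block_prod_def)
  next
    assume A: "nc n p = 2 \<and> (\<exists>a<n. p a = a \<and> l a = 1 \<and> block_prod l ({..<n} - {a}) = 1)"
    then obtain a where a: "a < n" "p a = a" "l a = 1" "block_prod l ({..<n} - {a}) = 1" and nc: "nc n p = 2" by blast
    define B where "B = {..<n} - {a}"
    note tc = two_cycles[OF p a(1,2) nc, folded B_def] and bB = a(4)[folded B_def]
    have cB: "card B = n - 1" using a(1) by (simp add: B_def)
    have ba: "block_prod l {a} = 1" using a by (simp add: block_prod_def)
    show "\<forall>m<r. type_part n p l (\<zeta> ^ m) = ?\<Lambda> ! m"
    proof (intro allI impI)
      fix m assume m: "m < r"
      show "type_part n p l (\<zeta> ^ m) = ?\<Lambda> ! m"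
      proof (cases "m = 0")
        case True
        have "{C \<in> cycs {..<n} p. block_prod l C = 1} = {{a}, B}" unfolding tc(1) using bB ba by blast
        then show ?thesis using True cB tc(2) by (simp add: type_part_def)
      next
        case False
        then have "\<zeta> ^ m \<noteq> 1" using m r2 zeta_power_eq_iff[of m 0] by auto
        then have "type_part n p l (\<zeta> ^ m) = {#}" unfolding type_part_empty_iff tc(1) using bB ba by simp
        then show ?thesis using L(2)[OF m False] by simp
      qed
    qed
  qed
qed

section \<open>Law of permutation and total label on a class\<close>

text \<open>All that averages over \<open>K\<close> need: on \<open>K\<close> the permutation has a
  law proportional to \<open>W\<close>, and the total label is always \<open>z\<close>. The factor
  \<open>c\<close> is left unspecified because it cancels.\<close>

definition class_law :: "nat \<Rightarrow> complex mat set \<Rightarrow> ((nat \<Rightarrow> nat) \<Rightarrow> real) \<Rightarrow> complex \<Rightarrow> bool" where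
  "class_law n K W z \<longleftrightarrow> K \<subseteq> G_grp \<zeta> n \<and> 0 < (\<Sum>p\<in>perms n. W p) \<and>
     (\<exists>c>0. \<forall>p\<in>perms n. (\<Sum>l\<in>Lab {..<n}. of_bool (monomial_mat n p l \<in> K)) = c * W p) \<and>
     (\<forall>p\<in>perms n. \<forall>l\<in>Lab {..<n}. monomial_mat n p l \<in> K \<longrightarrow> block_prod l {..<n} = z)"

lemma class_law_avg:
  assumes K: "class_law n K W z"
    and F: "\<And>p l. p \<in> perms n \<Longrightarrow> l \<in> Lab {..<n} \<Longrightarrow> block_prod l {..<n} = z \<Longrightarrow> F (monomial_mat n p l) = \<phi> p"
  shows "avg K F = (\<Sum>p\<in>perms n. W p * \<phi> p) / (\<Sum>p\<in>perms n. W p)"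
proof -
  have sub: "K \<subseteq> G_grp \<zeta> n" using K by (simp add: class_law_def)
  obtain c where c: "c > 0" "\<And>p. p \<in> perms n \<Longrightarrow> (\<Sum>l\<in>Lab {..<n}. of_bool (monomial_mat n p l \<in> K)) = c * W p"
    using K by (auto simp: class_law_def)
  \<comment> \<open>Proved for every \<open>F\<close>, since the constant function 1 gives the
    cardinality of \<open>K\<close> with the same \<open>c\<close>.\<close>
  have S: "(\<Sum>x\<in>K. F x) = c * (\<Sum>p\<in>perms n. W p * \<phi> p)"
    if "\<And>p l. p \<in> perms n \<Longrightarrow> l \<in> Lab {..<n} \<Longrightarrow> block_prod l {..<n} = z \<Longrightarrow> F (monomial_mat n p l) = \<phi> p" for F \<phi>
  proof -
    have "(\<Sum>x\<in>K. F x) = (\<Sum>p\<in>perms n. (\<Sum>l\<in>Lab {..<n}. of_bool (monomial_mat n p l \<in> K)) * \<phi> p)"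
      unfolding sum_subset_G[OF sub] sum_distrib_right
      by (intro sum.cong refl) (use K that in \<open>auto simp: class_law_def\<close>)
    also have "\<dots> = (\<Sum>p\<in>perms n. c * (W p * \<phi> p))"
      by (intro sum.cong refl) (simp add: c(2) del: sum_of_bool_eq)
    finally show ?thesis by (simp add: sum_distrib_left)
  qed
  have "real (card K) = c * (\<Sum>p\<in>perms n. W p)" using S[of "\<lambda>_. 1" "\<lambda>_. 1"] by simp
  moreover have "(\<Sum>x\<in>K. F x) = c * (\<Sum>p\<in>perms n. W p * \<phi> p)" by (rule S) (rule F)
  ultimately show ?thesis unfolding avg_def using c by simp
qed

lemma class_law_finite: "class_law n K W z \<Longrightarrow> finite K"
  using finite_subset[OF _ finite_G] by (auto simp: class_law_def)

lemma class_law_nonempty: "class_law n K W z \<Longrightarrow> K \<noteq> {}"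
proof
  assume K: "class_law n K W z" and "K = {}"
  then obtain c where c: "c > 0" "\<forall>p\<in>perms n. 0 = c * W p" by (auto simp: class_law_def)
  then have "(\<Sum>p\<in>perms n. W p) = 0" by (intro sum.neutral) auto
  then show False using K by (simp add: class_law_def)
qed

lemma sum_Lab_prod_eq:
  assumes "finite C" "C \<noteq> {}" "z \<in> Z"
  shows "(\<Sum>l\<in>Lab C. of_bool (block_prod l C = z) :: real) = real r ^ (card C - 1)"
proof -
  have "(\<Sum>l\<in>Lab C. of_bool (block_prod l C = z) :: real) = real r ^ (card C - 1) * (\<Sum>y\<in>Z. of_bool (y = z))"
    by (rule sum_Lab_block[OF assms(1,2)])
  also have "(\<Sum>y\<in>Z. of_bool (y = z) :: real) = 1" using assms(3) by (simp add: of_bool_def)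
  finally show ?thesis by simp
qed

lemma class_law_cyc:
  assumes n: "0 < n" and z: "z \<in> Z"
  shows "class_law n (cyc_class n z) (one_cyc n) z"
proof -
  have "(\<Sum>l\<in>Lab {..<n}. of_bool (monomial_mat n p l \<in> cyc_class n z)) = real r ^ (n - 1) * one_cyc n p" if p: "p \<in> perms n" for p
  proof -
    have "(\<Sum>l\<in>Lab {..<n}. of_bool (monomial_mat n p l \<in> cyc_class n z)) =
        (\<Sum>l\<in>Lab {..<n}. of_bool (block_prod l {..<n} = z) * one_cyc n p)"
      by (intro sum.cong refl) (auto simp: mem_cyc_class_iff[OF p] one_cyc_def)
    also have "\<dots> = real r ^ (n - 1) * one_cyc n p"
      unfolding sum_distrib_right[symmetric] using n z by (subst sum_Lab_prod_eq) auto
    finally show ?thesis .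
  qed
  then show ?thesis unfolding class_law_def
    using cyc_class_subset sum_one_cyc[OF n] r2
    by (auto simp: mem_cyc_class_iff intro!: exI[of _ "real r ^ (n - 1)"])
qed

text \<open>The label at \<open>a\<close> is prescribed, and the other \<open>n - 1\<close> labels
  have a prescribed product.\<close>

lemma sum_Lab_fix:
  assumes n: "2 \<le> n" and a: "a < n" and z: "z \<in> Z"
  shows "(\<Sum>l\<in>Lab {..<n}. of_bool (l a = z \<and> block_prod l ({..<n} - {a}) = 1) :: real) = real r ^ (n - 2)"
proof -
  let ?B = "{..<n} - {a}"
  have d: "{a} \<inter> ?B = {}" and U: "{..<n} = {a} \<union> ?B" using a by auto
  have bp: "block_prod (\<lambda>x. if x \<in> {a} then l1 x else l2 x) ?B = block_prod l2 ?B" for l1 l2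
    unfolding block_prod_def by (intro prod.cong) auto
  have "(\<Sum>l\<in>Lab {..<n}. of_bool (l a = z \<and> block_prod l ?B = 1) :: real) =
      (\<Sum>l\<in>PiE ({a} \<union> ?B) (\<lambda>_. Z). of_bool (l a = z \<and> block_prod l ?B = 1))"
    unfolding Lab_def U[symmetric] ..
  also have "\<dots> = (\<Sum>l1\<in>Lab {a}. \<Sum>l2\<in>Lab ?B. of_bool (block_prod l1 {a} = z) * of_bool (block_prod l2 ?B = 1))"
    unfolding sum_PiE_union[OF d] bp Lab_def by (intro sum.cong refl) (auto simp: block_prod_def)
  also have "\<dots> = (\<Sum>l1\<in>Lab {a}. of_bool (block_prod l1 {a} = z)) * (\<Sum>l2\<in>Lab ?B. of_bool (block_prod l2 ?B = 1))"
    by (simp add: sum_product del: sum_of_bool_eq)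
  also have "\<dots> = real r ^ (card ?B - 1)"
  proof -
    have "card ?B = n - 1" using a by simp
    then have "?B \<noteq> {}" using n by (metis One_nat_def card.empty diff_is_0_eq not_less_eq_eq numeral_2_eq_2)
    then show ?thesis using z by (simp add: sum_Lab_prod_eq del: card_Diff_insert sum_of_bool_eq)
  qed
  also have "card ?B - 1 = n - 2" using a by simp
  finally show ?thesis .
qed

definition near_class :: "nat \<Rightarrow> complex \<Rightarrow> complex mat set" where
  "near_class n z = {monomial_mat n p l | p l. p \<in> perms n \<and> l \<in> Lab {..<n} \<and>
     nc n p = 2 \<and> (\<exists>a<n. p a = a \<and> l a = z \<and> block_prod l ({..<n} - {a}) = 1)}"

lemma mem_near_class_iff:
  assumes "p \<in> perms n" "l \<in> Lab {..<n}"
  shows "monomial_mat n p l \<in> near_class n z \<longleftrightarrow>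
    nc n p = 2 \<and> (\<exists>a<n. p a = a \<and> l a = z \<and> block_prod l ({..<n} - {a}) = 1)"
  unfolding near_class_def by (rule mem_class_iff[OF assms])

text \<open>For \<open>n = 2\<close> and \<open>z = 1\<close> both points of the identity can play the role of the fixed point,
  whence the factor \<open>1 / 2\<close>.\<close>

lemma class_law_near:
  assumes n: "2 \<le> n" and z: "z \<in> Z"
  shows "class_law n (near_class n z) (near_cyc n) z"
proof -
  define c :: real where "c = (if n = 2 \<and> z = 1 then 1 / 2 else 1)"
  have "(\<Sum>l\<in>Lab {..<n}. of_bool (monomial_mat n p l \<in> near_class n z)) = c * real r ^ (n - 2) * near_cyc n p" if p: "p \<in> perms n" for p
  proof (cases "nc n p = 2")
    case False
    then show ?thesis by (simp add: mem_near_class_iff[OF p] near_cyc_def)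
  next
    case True
    define Fx where "Fx = {a. a < n \<and> p a = a}"
    define Q where "Q a l \<longleftrightarrow> l a = z \<and> block_prod l ({..<n} - {a}) = 1" for a l
    have fin: "finite Fx" by (simp add: Fx_def)
    \<comment> \<open>Two fixed points already exhaust the two cycles.\<close>
    have other: "n = 2 \<and> {..<n} - {a} = {b}" if "a \<in> Fx" "b \<in> Fx" "a \<noteq> b" for a b
    proof -
      have "{b} \<in> cycs {..<n} p" using that by (force simp: cycs_def Fx_def orbit_eq_singleton_iff[THEN iffD2])
      then have e: "{..<n} - {a} = {b}" using two_cycles[OF p _ _ True, of a] that by (auto simp: Fx_def)
      have "card ({..<n} - {a}) = n - 1" using that by (simp add: Fx_def)
      then have "n - 1 = 1" unfolding e by simp
      then show ?thesis using e by simp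
    qed
    \<comment> \<open>Existence and number differ only if two fixed points qualify. Then
      \<open>n = 2\<close>, and the label at either point is both \<open>z\<close> and 1, so
      \<open>z = 1\<close>; conversely, in that case both points qualify as soon as one does, and
      the sum is 2.\<close>
    have count: "of_bool (\<exists>a\<in>Fx. Q a l) = c * (\<Sum>a\<in>Fx. of_bool (Q a l))" for l
    proof (cases "\<exists>a\<in>Fx. Q a l")
      case True
      then obtain a where a: "a \<in> Fx" "Q a l" by blast
      show ?thesis
      proof (cases "n = 2 \<and> z = 1")
        case False
        have "\<not> Q b l" if b: "b \<in> Fx" "b \<noteq> a" for b
        proof
          assume Qb: "Q b l"
          have o: "n = 2" "{..<n} - {a} = {b}" using other[OF a(1) b(1)] b by auto
          then have "l b = 1" using a by (simp add: Q_def block_prod_def)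
          then show False using Qb False o by (simp add: Q_def)
        qed
        then have "(\<Sum>a\<in>Fx. of_bool (Q a l)) = (\<Sum>b\<in>Fx. if b = a then 1 else (0::real))"
          using a by (intro sum.cong) auto
        then show ?thesis using False True a fin by (simp add: c_def)
      next
        case two: True
        define b where "b = 1 - a"
        have a2: "a < 2" using a two by (simp add: Fx_def)
        then have ab: "a < 2" "b < 2" "a \<noteq> b" unfolding b_def by arith+
        have rest: "{..<n} - {a} = {b}" "{..<n} - {b} = {a}" using ab two by auto
        have "p b = b"
          using perms_less[OF p, of b] perms_inj_iff[OF p, of a b] a ab two by (auto simp: Fx_def less_2_cases_iff)
        then have bF: "b \<in> Fx" using ab two by (simp add: Fx_def)
        have "Fx = {a, b}" using a bF ab two by (auto simp: Fx_def less_2_cases_iff)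
        moreover have "Q b l" using a two rest by (simp add: Q_def block_prod_def)
        ultimately show ?thesis using a ab two True by (simp add: c_def)
      qed
    qed (auto simp: c_def)
    have "(\<Sum>l\<in>Lab {..<n}. of_bool (monomial_mat n p l \<in> near_class n z)) = (\<Sum>l\<in>Lab {..<n}. of_bool (\<exists>a\<in>Fx. Q a l))"
      by (intro sum.cong refl) (auto simp: mem_near_class_iff[OF p] True Fx_def Q_def)
    also have "\<dots> = c * (\<Sum>a\<in>Fx. \<Sum>l\<in>Lab {..<n}. of_bool (Q a l))"
      unfolding count sum_distrib_left[symmetric] by (subst sum.swap) simp
    also have "\<dots> = c * (\<Sum>a\<in>Fx. real r ^ (n - 2))"
      unfolding Q_def by (intro arg_cong2[of _ _ _ _ times] sum.cong refl sum_Lab_fix n z) (simp add: Fx_def)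
    finally show ?thesis using True by (simp add: near_cyc_def Fx_def)
  qed
  moreover have "block_prod l {..<n} = z" if "a < n" "l a = z" "block_prod l ({..<n} - {a}) = 1" for l a
    using that prod.remove[of "{..<n}" a l] by (simp add: block_prod_def)
  moreover have "near_class n z \<subseteq> G_grp \<zeta> n" unfolding near_class_def G_grp_eq by auto
  moreover have "0 < (\<Sum>p\<in>perms n. near_cyc n p)" using sum_near_cyc[OF n] n by simp
  moreover have "c * real r ^ (n - 2) > 0" using r2 by (simp add: c_def)
  ultimately show ?thesis unfolding class_law_def
    by (auto simp: mem_near_class_iff intro!: exI[of _ "c * real r ^ (n - 2)"])
qed

lemma K_class_eqI:
  assumes "\<And>p l. p \<in> perms n \<Longrightarrow> l \<in> Lab {..<n} \<Longrightarrow> cycle_type r \<zeta> n (monomial_mat n p l) = \<Lambda> \<longleftrightarrow> Q p l"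
  shows "K_class r \<zeta> n \<Lambda> = {monomial_mat n p l | p l. p \<in> perms n \<and> l \<in> Lab {..<n} \<and> Q p l}"
  unfolding K_class_def G_grp_eq using assms by auto

lemma K_class_n: "K_class r \<zeta> n ({#n#} # replicate (r - 1) {#}) = cyc_class n 1"
  unfolding cyc_class_def
proof (rule K_class_eqI)
  fix p l assume "p \<in> perms n" "l \<in> Lab {..<n}"
  then show "cycle_type r \<zeta> n (monomial_mat n p l) = {#n#} # replicate (r - 1) {#} \<longleftrightarrow> nc n p = 1 \<and> block_prod l {..<n} = 1"
    using r2 cycle_type_cyc[of p n l 0 "{#n#} # replicate (r - 1) {#}"] by (simp add: nth_Cons')
qed

lemma K_class_0_n: "K_class r \<zeta> n ({#} # {#n#} # replicate (r - 2) {#}) = cyc_class n \<zeta>"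
  unfolding cyc_class_def
proof (rule K_class_eqI)
  fix p l assume "p \<in> perms n" "l \<in> Lab {..<n}"
  then show "cycle_type r \<zeta> n (monomial_mat n p l) = {#} # {#n#} # replicate (r - 2) {#} \<longleftrightarrow> nc n p = 1 \<and> block_prod l {..<n} = \<zeta>"
    using r2 cycle_type_cyc[of p n l 1 "{#} # {#n#} # replicate (r - 2) {#}"] by (simp add: nth_Cons')
qed

lemma K_class_n1_1: "2 \<le> n \<Longrightarrow> K_class r \<zeta> n ({#n - 1#} # {#1#} # replicate (r - 2) {#}) = near_class n \<zeta>"
  unfolding near_class_def by (rule K_class_eqI) (rule cycle_type_near_zeta)

lemma K_class_n11: "2 \<le> n \<Longrightarrow> K_class r \<zeta> n ({#n - 1, 1#} # replicate (r - 1) {#}) = near_class n 1"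
  unfolding near_class_def by (rule K_class_eqI) (rule cycle_type_near_1)

section \<open>The bilinear form given by \<open>mu_seq\<close>\<close>

lemma G_carrier: "x \<in> G_grp \<zeta> n \<Longrightarrow> x \<in> carrier_mat n n"
  by (simp add: G_grp_def)

lemma G_mult:
  assumes "x \<in> G_grp \<zeta> n" "y \<in> G_grp \<zeta> n"
  shows "x * y \<in> G_grp \<zeta> n"
proof -
  obtain p l where x: "p \<in> perms n" "l \<in> Lab {..<n}" "x = monomial_mat n p l" using G_imp_monomial_mat[OF assms(1)] by blast
  obtain q k where y: "q \<in> perms n" "k \<in> Lab {..<n}" "y = monomial_mat n q k" using G_imp_monomial_mat[OF assms(2)] by blast
  show ?thesis unfolding x(3) y(3) monomial_mat_mult[OF y(1)]
    using x y Lab_in_Z by (intro monomial_mat_in_G perms_comp Z_mult) (auto simp: perms_less)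
qed

lemma G_left_inverse:
  assumes "x \<in> G_grp \<zeta> n"
  obtains y where "y \<in> carrier_mat n n" "y * x = 1\<^sub>m n"
proof -
  obtain p l where x: "p \<in> perms n" "l \<in> Lab {..<n}" "x = monomial_mat n p l" using G_imp_monomial_mat[OF assms] by blast
  define k where "k j = inverse (l (inv_into UNIV p j))" for j
  have "monomial_mat n (inv_into UNIV p) k * x = monomial_mat n (inv_into UNIV p \<circ> p) (\<lambda>j. k (p j) * l j)"
    unfolding x(3) by (rule monomial_mat_mult[OF x(1)])
  also have "inv_into UNIV p \<circ> p = id" using x(1) by (simp add: fun_eq_iff)
  also have "monomial_mat n id (\<lambda>j. k (p j) * l j) = monomial_mat n id (\<lambda>_. 1)"
    by (rule monomial_mat_cong) (use x Lab_nz in \<open>simp add: k_def\<close>)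
  finally show thesis using that[of "monomial_mat n (inv_into UNIV p) k"] by (simp add: one_mat_monomial)
qed

text \<open>Left multiplication by \<open>g\<close> is injective, so each cardinality counts the
  \<open>x\<close> with \<open>ell\<close> equal to \<open>i\<close> at \<open>x\<close> and to
  \<open>j\<close> at \<open>g * x\<close>. As \<open>ell\<close> is at most \<open>n\<close>, every
  \<open>x\<close> occurs for exactly one pair of indices.\<close>

lemma sum_card_C_set:
  fixes f h :: "nat \<Rightarrow> real"
  assumes g: "g \<in> G_grp \<zeta> n"
  shows "(\<Sum>i=0..n. \<Sum>j=0..n. f i * h j * real (card ((\<lambda>c. g * c) ` C_set r \<zeta> n i \<inter> C_set r \<zeta> n j))) =
    (\<Sum>x\<in>G_grp \<zeta> n. f (ell r \<zeta> n x) * h (ell r \<zeta> n (g * x)))"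
proof -
  obtain y where y: "y \<in> carrier_mat n n" "y * g = 1\<^sub>m n" using G_left_inverse[OF g] .
  have inj: "inj_on (\<lambda>c. g * c) (G_grp \<zeta> n)"
  proof (rule inj_onI)
    fix a b assume ab: "a \<in> G_grp \<zeta> n" "b \<in> G_grp \<zeta> n" "g * a = g * b"
    have "y * (g * c) = c" if "c \<in> G_grp \<zeta> n" for c
      using assoc_mult_mat[OF y(1) G_carrier[OF g] G_carrier[OF that]] y(2) left_mult_one_mat[OF G_carrier[OF that]] by simp
    then show "a = b" using ab by metis
  qed
  have card: "real (card ((\<lambda>c. g * c) ` C_set r \<zeta> n i \<inter> C_set r \<zeta> n j)) =
      (\<Sum>x\<in>G_grp \<zeta> n. of_bool (ell r \<zeta> n x = i) * of_bool (ell r \<zeta> n (g * x) = j))" for i j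
  proof -
    let ?S = "{x \<in> G_grp \<zeta> n. ell r \<zeta> n x = i \<and> ell r \<zeta> n (g * x) = j}"
    have "(\<lambda>c. g * c) ` C_set r \<zeta> n i \<inter> C_set r \<zeta> n j = (\<lambda>c. g * c) ` ?S"
      using G_mult[OF g] by (auto simp: C_set_def)
    moreover have "inj_on (\<lambda>c. g * c) ?S" by (rule inj_on_subset[OF inj]) auto
    ultimately have "card ((\<lambda>c. g * c) ` C_set r \<zeta> n i \<inter> C_set r \<zeta> n j) = card ?S" by (simp add: card_image)
    also have "real (card ?S) = (\<Sum>x\<in>G_grp \<zeta> n. of_bool (ell r \<zeta> n x = i \<and> ell r \<zeta> n (g * x) = j))"
      by (simp add: Int_def)
    finally show ?thesis by (simp only: of_bool_conj)
  qed
  have "(\<Sum>i=0..n. \<Sum>j=0..n. f i * h j * real (card ((\<lambda>c. g * c) ` C_set r \<zeta> n i \<inter> C_set r \<zeta> n j))) =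
      (\<Sum>i=0..n. \<Sum>j=0..n. \<Sum>x\<in>G_grp \<zeta> n. f i * h j * (of_bool (ell r \<zeta> n x = i) * of_bool (ell r \<zeta> n (g * x) = j)))"
    unfolding card sum_distrib_left ..
  also have "\<dots> = (\<Sum>i=0..n. \<Sum>x\<in>G_grp \<zeta> n. \<Sum>j=0..n. f i * h j * (of_bool (ell r \<zeta> n x = i) * of_bool (ell r \<zeta> n (g * x) = j)))"
    by (rule sum.cong[OF refl], rule sum.swap)
  also have "\<dots> = (\<Sum>x\<in>G_grp \<zeta> n. \<Sum>i=0..n. \<Sum>j=0..n. f i * h j * (of_bool (ell r \<zeta> n x = i) * of_bool (ell r \<zeta> n (g * x) = j)))"
    by (rule sum.swap)
  also have "\<dots> = (\<Sum>x\<in>G_grp \<zeta> n. f (ell r \<zeta> n x) * h (ell r \<zeta> n (g * x)))"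
  proof (rule sum.cong[OF refl])
    fix x assume x: "x \<in> G_grp \<zeta> n"
    let ?a = "ell r \<zeta> n x" and ?b = "ell r \<zeta> n (g * x)"
    have le: "?a \<le> n" "?b \<le> n" using ell_le[OF x] ell_le[OF G_mult[OF g x]] by auto
    have "(\<Sum>i=0..n. \<Sum>j=0..n. f i * h j * (of_bool (?a = i) * of_bool (?b = j))) =
        (\<Sum>i=0..n. \<Sum>j=0..n. if j = ?b then (if i = ?a then f i * h j else 0) else 0)"
      by (intro sum.cong refl) auto
    also have "\<dots> = f ?a * h ?b" using le by simp
    finally show "(\<Sum>i=0..n. \<Sum>j=0..n. f i * h j * (of_bool (?a = i) * of_bool (?b = j))) = f ?a * h ?b" .
  qed
  finally show ?thesis .
qed

definition pair_sum :: "nat \<Rightarrow> nat \<Rightarrow> nat \<Rightarrow> complex mat \<Rightarrow> real" where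
  "pair_sum n m w y = (\<Sum>k\<in>cyc_class n 1. \<Sum>x\<in>G_grp \<zeta> n.
     real (r * m + 1) ^ ell r \<zeta> n x * real (r * w + 1) ^ ell r \<zeta> n (k * (y * x)))"

definition twisted :: "nat \<Rightarrow> nat \<Rightarrow> nat \<Rightarrow> complex \<Rightarrow> (nat \<Rightarrow> nat) \<Rightarrow> real" where
  "twisted n m w z t = real r ^ (2 * n - 1) * (triple_sum n (m + 1) (w + 1) t +
      (if z = 1 then real r - 1 else -1) * triple_sum n m w t)"

lemma pair_sum_monomial_mat:
  "0 < n \<Longrightarrow> t \<in> perms n \<Longrightarrow> l \<in> Lab {..<n} \<Longrightarrow>
    pair_sum n m w (monomial_mat n t l) = twisted n m w (block_prod l {..<n}) t"
  unfolding pair_sum_def twisted_def by (rule sum_cyc_class_G)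

lemma sum_mult_twisted:
  "(\<Sum>p\<in>S. W p * twisted n m w z (g p)) = real r ^ (2 * n - 1) *
    ((\<Sum>p\<in>S. W p * triple_sum n (m + 1) (w + 1) (g p)) +
     (if z = 1 then real r - 1 else -1) * (\<Sum>p\<in>S. W p * triple_sum n m w (g p)))"
proof -
  have "(\<Sum>p\<in>S. W p * twisted n m w z (g p)) = (\<Sum>p\<in>S. real r ^ (2 * n - 1) *
     (W p * triple_sum n (m + 1) (w + 1) (g p) + (if z = 1 then real r - 1 else -1) * (W p * triple_sum n m w (g p))))"
    unfolding twisted_def by (intro sum.cong refl) (simp add: algebra_simps del: o_apply)
  then show ?thesis by (simp only: sum_distrib_left[symmetric] sum.distrib)
qed

lemma one_in_G: "1\<^sub>m n \<in> G_grp \<zeta> n"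
  unfolding one_mat_monomial by (rule monomial_mat_in_G) (simp_all add: perms_def permutes_id)

lemma foldr_in_G: "set xs \<subseteq> G_grp \<zeta> n \<Longrightarrow> foldr (*) xs (1\<^sub>m n) \<in> G_grp \<zeta> n"
  by (induction xs) (simp_all add: one_in_G G_mult)

text \<open>The first class is split off because its average alone produces \<open>pair_sum\<close>,
  which sees only the permutation and the total label of the product of the others.\<close>

lemma mu_seq_form:
  assumes n: "0 < n" and Ks: "\<forall>K\<in>set Ks. K \<subseteq> G_grp \<zeta> n \<and> K \<noteq> {}"
  shows "(\<Sum>i=0..n. \<Sum>j=0..n. real (r * m + 1) ^ i * real (r * w + 1) ^ j * mu_seq r \<zeta> n (cyc_class n 1 # Ks) i j) =
    avgs Ks (\<lambda>xs. pair_sum n m w (foldr (*) xs (1\<^sub>m n))) / real (card (cyc_class n 1))"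
proof -
  note C = class_law_cyc[OF n Z_1]
  let ?c = "\<lambda>i j. real (r * m + 1) ^ i * real (r * w + 1) ^ j"
  let ?F = "\<lambda>i j g. real (card ((\<lambda>c. g * c) ` C_set r \<zeta> n i \<inter> C_set r \<zeta> n j))"
  have "finite K \<and> K \<noteq> {}" if "K \<in> set (cyc_class n 1 # Ks)" for K
    using that Ks finite_subset[OF _ finite_G, of K n] class_law_finite[OF C] class_law_nonempty[OF C] by auto
  then have "mu_seq r \<zeta> n (cyc_class n 1 # Ks) i j = avgs (cyc_class n 1 # Ks) (\<lambda>xs. ?F i j (foldr (*) xs (1\<^sub>m n)))" for i j
    unfolding mu_seq_def by (rule expectation_Pi_pmf_list)
  then have "(\<Sum>i=0..n. \<Sum>j=0..n. ?c i j * mu_seq r \<zeta> n (cyc_class n 1 # Ks) i j) =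
      avgs Ks (\<lambda>xs. avg (cyc_class n 1) (\<lambda>k. \<Sum>i=0..n. \<Sum>j=0..n. ?c i j * ?F i j (k * foldr (*) xs (1\<^sub>m n))))"
    by (simp only: avgs_linear2) simp
  also have "\<dots> = avgs Ks (\<lambda>xs. pair_sum n m w (foldr (*) xs (1\<^sub>m n)) / real (card (cyc_class n 1)))"
  proof (rule avgs_cong)
    fix xs assume "list_all2 (\<in>) xs Ks"
    then have "set xs \<subseteq> G_grp \<zeta> n" using Ks by (induction rule: list_all2_induct) auto
    then have y: "foldr (*) xs (1\<^sub>m n) \<in> G_grp \<zeta> n" by (rule foldr_in_G)
    define y where "y = foldr (*) xs (1\<^sub>m n)"
    have "avg (cyc_class n 1) (\<lambda>k. \<Sum>i=0..n. \<Sum>j=0..n. ?c i j * ?F i j (k * y)) =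
        avg (cyc_class n 1) (\<lambda>k. \<Sum>x\<in>G_grp \<zeta> n. real (r * m + 1) ^ ell r \<zeta> n x * real (r * w + 1) ^ ell r \<zeta> n (k * (y * x)))"
    proof (rule avg_cong)
      fix k assume "k \<in> cyc_class n 1"
      then have k: "k \<in> G_grp \<zeta> n" using cyc_class_subset by blast
      show "(\<Sum>i=0..n. \<Sum>j=0..n. ?c i j * ?F i j (k * y)) =
          (\<Sum>x\<in>G_grp \<zeta> n. real (r * m + 1) ^ ell r \<zeta> n x * real (r * w + 1) ^ ell r \<zeta> n (k * (y * x)))"
        unfolding y_def sum_card_C_set[OF G_mult[OF k y]]
        using assoc_mult_mat[OF G_carrier[OF k] G_carrier[OF y] G_carrier] by (intro sum.cong refl) simp
    qed
    then show "avg (cyc_class n 1) (\<lambda>k. \<Sum>i=0..n. \<Sum>j=0..n. ?c i j * ?F i j (k * foldr (*) xs (1\<^sub>m n))) =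
        pair_sum n m w (foldr (*) xs (1\<^sub>m n)) / real (card (cyc_class n 1))"
      unfolding y_def[symmetric] by (simp add: avg_def pair_sum_def)
  qed
  finally show ?thesis unfolding avgs_divide .
qed

lemma class_law_subset: "class_law n K W z \<Longrightarrow> K \<subseteq> G_grp \<zeta> n \<and> K \<noteq> {}"
  using class_law_nonempty by (simp add: class_law_def)

lemma avg_pair_sum:
  assumes n: "0 < n" and K: "class_law n K W z"
  shows "avgs [K] (\<lambda>xs. pair_sum n m w (foldr (*) xs (1\<^sub>m n))) = (\<Sum>p\<in>perms n. W p * twisted n m w z p) / (\<Sum>p\<in>perms n. W p)"
  using class_law_avg[OF K, where F = "\<lambda>x. pair_sum n m w (x * 1\<^sub>m n)"]
  by (simp add: right_mult_one_mat[OF monomial_mat_carrier] pair_sum_monomial_mat[OF n])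

lemma avg_pair_sum_3:
  assumes n: "0 < n" and K: "class_law n K1 W1 z1" "class_law n K2 W2 z2" "class_law n K3 W3 z3"
  shows "avgs [K1, K2, K3] (\<lambda>xs. pair_sum n m w (foldr (*) xs (1\<^sub>m n))) =
    (\<Sum>c\<in>perms n. W3 c * (\<Sum>b\<in>perms n. W2 b * (\<Sum>a\<in>perms n. W1 a * twisted n m w (z1 * (z2 * z3)) (a \<circ> (b \<circ> c))))) /
      ((\<Sum>p\<in>perms n. W1 p) * (\<Sum>p\<in>perms n. W2 p) * (\<Sum>p\<in>perms n. W3 p))"
proof -
  have triple: "pair_sum n m w (monomial_mat n a la * (monomial_mat n b lb * (monomial_mat n c lc * 1\<^sub>m n))) = twisted n m w (z1 * (z2 * z3)) (a \<circ> (b \<circ> c))"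
    if "a \<in> perms n" "la \<in> Lab {..<n}" "block_prod la {..<n} = z1"
       "b \<in> perms n" "lb \<in> Lab {..<n}" "block_prod lb {..<n} = z2"
       "c \<in> perms n" "lc \<in> Lab {..<n}" "block_prod lc {..<n} = z3" for a la b lb c lc
  proof -
    define l where "l = restrict (\<lambda>j. la ((b \<circ> c) j) * (lb (c j) * lc j)) {..<n}"
    have bc: "b \<circ> c \<in> perms n" using that by (simp add: perms_comp)
    have abc: "a \<circ> (b \<circ> c) \<in> perms n" using that bc by (simp add: perms_comp)
    have "monomial_mat n a la * (monomial_mat n b lb * monomial_mat n c lc) = monomial_mat n (a \<circ> (b \<circ> c)) l"
      unfolding monomial_mat_mult[OF that(7)] monomial_mat_mult[OF bc] l_def by (rule monomial_mat_cong) simp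
    moreover have "l \<in> Lab {..<n}"
      unfolding l_def Lab_def[of "{..<n}"] using perms_less[OF that(7)] perms_less[OF bc]
        Lab_in_Z[OF that(2)] Lab_in_Z[OF that(5)] Lab_in_Z[OF that(8)]
      by (auto intro!: Z_mult)
    moreover have "block_prod l {..<n} = z1 * (z2 * z3)"
    proof -
      have "(\<Prod>j<n. la ((b \<circ> c) j)) = (\<Prod>j<n. la j)" by (rule prod.reindex_bij_betw[OF perms_bij[OF bc]])
      moreover have "(\<Prod>j<n. lb (c j)) = (\<Prod>j<n. lb j)" by (rule prod.reindex_bij_betw[OF perms_bij[OF that(7)]])
      ultimately show ?thesis using that by (simp add: block_prod_def l_def prod.distrib)
    qed
    ultimately show ?thesis
      using pair_sum_monomial_mat[OF n abc] right_mult_one_mat[OF monomial_mat_carrier, of n c lc] by simp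
  qed
  \<comment> \<open>\<open>class_law_avg\<close> is applied from the innermost average outwards; at
    each stage the value depends only on the permutations that are still fixed.\<close>
  have 1: "avg K1 (\<lambda>y1. pair_sum n m w (y1 * (monomial_mat n b lb * (monomial_mat n c lc * 1\<^sub>m n)))) =
      (\<Sum>a\<in>perms n. W1 a * twisted n m w (z1 * (z2 * z3)) (a \<circ> (b \<circ> c))) / (\<Sum>p\<in>perms n. W1 p)"
    if "b \<in> perms n" "lb \<in> Lab {..<n}" "block_prod lb {..<n} = z2"
       "c \<in> perms n" "lc \<in> Lab {..<n}" "block_prod lc {..<n} = z3" for b lb c lc
    by (rule class_law_avg[OF K(1)]) (rule triple[OF _ _ _ that])
  have 2: "avg K2 (\<lambda>y2. avg K1 (\<lambda>y1. pair_sum n m w (y1 * (y2 * (monomial_mat n c lc * 1\<^sub>m n))))) =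
      (\<Sum>b\<in>perms n. W2 b * ((\<Sum>a\<in>perms n. W1 a * twisted n m w (z1 * (z2 * z3)) (a \<circ> (b \<circ> c))) / (\<Sum>p\<in>perms n. W1 p))) / (\<Sum>p\<in>perms n. W2 p)"
    if "c \<in> perms n" "lc \<in> Lab {..<n}" "block_prod lc {..<n} = z3" for c lc
    by (rule class_law_avg[OF K(2)]) (rule 1[OF _ _ _ that])
  have "avg K3 (\<lambda>y3. avg K2 (\<lambda>y2. avg K1 (\<lambda>y1. pair_sum n m w (y1 * (y2 * (y3 * 1\<^sub>m n)))))) =
      (\<Sum>c\<in>perms n. W3 c * ((\<Sum>b\<in>perms n. W2 b * ((\<Sum>a\<in>perms n. W1 a * twisted n m w (z1 * (z2 * z3)) (a \<circ> (b \<circ> c))) / (\<Sum>p\<in>perms n. W1 p))) / (\<Sum>p\<in>perms n. W2 p))) / (\<Sum>p\<in>perms n. W3 p)"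
    by (rule class_law_avg[OF K(3)]) (rule 2)
  then have "avg K3 (\<lambda>y3. avg K2 (\<lambda>y2. avg K1 (\<lambda>y1. pair_sum n m w (y1 * (y2 * (y3 * 1\<^sub>m n)))))) =
    (\<Sum>c\<in>perms n. W3 c * (\<Sum>b\<in>perms n. W2 b * (\<Sum>a\<in>perms n. W1 a * twisted n m w (z1 * (z2 * z3)) (a \<circ> (b \<circ> c))))) /
      ((\<Sum>p\<in>perms n. W1 p) * (\<Sum>p\<in>perms n. W2 p) * (\<Sum>p\<in>perms n. W3 p))"
    by (simp only: times_divide_eq_right sum_divide_distrib[symmetric] divide_divide_eq_left mult.assoc)
  then show ?thesis by simp
qed

end

section \<open>The inner product of Foulkes characters\<close>

lemma fps_one_minus_X_power_nth:
  "fps_nth ((1 - fps_X) ^ N :: real fps) m = (-1) ^ m * real (N choose m)"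
proof (induction N arbitrary: m)
  case 0
  then show ?case by (cases m) auto
next
  case (Suc N)
  have "fps_nth ((1 - fps_X) ^ Suc N :: real fps) m = fps_nth ((1 - fps_X) ^ N) m - fps_nth (fps_X * (1 - fps_X) ^ N :: real fps) m"
    by (simp add: left_diff_distrib)
  then show ?case by (cases m) (simp_all add: Suc algebra_simps)
qed

text \<open>The sum is the coefficient of \<open>X^k\<close> in \<open>(1 - X)^(n+1)\<close> times
  \<open>X^k' / (1 - X)^(n+1)\<close>.\<close>

lemma alternating_binomial_inversion:
  assumes "k \<le> n" "k' \<le> n"
  shows "(\<Sum>w=0..k. (-1) ^ (k - w) * real ((n + 1) choose (k - w)) * real ((w + n - k') choose n)) = of_bool (k = k')"
proof -
  have B: "Abs_fps (\<lambda>w. real ((w + n - k') choose n)) = fps_X ^ k' * Abs_fps (\<lambda>j. real ((n + j) choose n))"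
  proof (rule fps_ext)
    fix w
    show "fps_nth (Abs_fps (\<lambda>w. real ((w + n - k') choose n))) w = fps_nth (fps_X ^ k' * Abs_fps (\<lambda>j. real ((n + j) choose n))) w"
      using assms by (cases "w < k'") (auto simp: fps_X_power_mult_nth binomial_eq_0 add.commute)
  qed
  have "(\<Sum>w=0..k. (-1) ^ (k - w) * real ((n + 1) choose (k - w)) * real ((w + n - k') choose n)) =
      fps_nth (Abs_fps (\<lambda>w. real ((w + n - k') choose n)) * (1 - fps_X) ^ (n + 1)) k"
    unfolding fps_mult_nth fps_one_minus_X_power_nth by (simp add: mult_ac)
  also have "\<dots> = fps_nth (fps_X ^ k' * (Abs_fps (\<lambda>j. real ((n + j) choose n)) * (1 - fps_X) ^ Suc n)) k"
    unfolding B by (simp add: mult.assoc)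
  also have "\<dots> = of_bool (k = k')" unfolding binomial_gf by (simp add: fps_X_power_nth)
  finally show ?thesis .
qed

lemma sum_weighted_linear:
  fixes c :: "'i \<Rightarrow> 'j \<Rightarrow> real"
  shows "(\<Sum>i\<in>I. \<Sum>j\<in>J. c i j * (a * F i j)) = a * (\<Sum>i\<in>I. \<Sum>j\<in>J. c i j * F i j)"
  by (simp add: sum_distrib_left mult_ac)

definition hook_sum :: "nat \<Rightarrow> nat \<Rightarrow> nat \<Rightarrow> real" where
  "hook_sum n a b = (\<Sum>k<n. real ((a + (n - 1 - k)) choose n) * real ((b + (n - 1 - k)) choose n))"

lemma fact_eq: "0 < n \<Longrightarrow> fact n = real n * fact (n - 1)"
  by (rule fact_reduce)

context root_of_unity begin

lemma card_cyc_class: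
  assumes n: "0 < n"
  shows "real (card (cyc_class n 1)) = real r ^ (n - 1) * fact (n - 1)"
proof -
  have "real (card (cyc_class n 1)) = (\<Sum>p\<in>perms n. one_cyc n p * (\<Sum>l\<in>Lab {..<n}. of_bool (block_prod l {..<n} = 1)))"
    using sum_cyc_class[of "\<lambda>_. 1" n 1] by simp
  also have "(\<Sum>l\<in>Lab {..<n}. of_bool (block_prod l {..<n} = 1) :: real) = real r ^ (n - 1)"
    using n by (subst sum_Lab_prod_eq) auto
  finally show ?thesis using sum_one_cyc[OF n] by (simp add: sum_distrib_right[symmetric])
qed

text \<open>The hypotheses are normalised so that \<open>r^(2n-1) (n-1)! n!\<close> divided by the
  size \<open>r^(n-1) (n-1)!\<close> of the first class remains, which is the order
  \<open>r^n n!\<close> of the group for any choice of \<open>K\<close>.\<close>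

lemma mu_seq_form_2_eval:
  assumes n: "0 < n" and K: "class_law n K W z"
    and T1: "(\<Sum>p\<in>perms n. W p * triple_sum n (m + 1) (w + 1) p) = (\<Sum>p\<in>perms n. W p) * fact (n - 1) * fact n * B1"
    and T0: "(\<Sum>p\<in>perms n. W p * triple_sum n m w p) = (\<Sum>p\<in>perms n. W p) * fact (n - 1) * fact n * B0"
  shows "(\<Sum>i=0..n. \<Sum>j=0..n. real (r * m + 1) ^ i * real (r * w + 1) ^ j * mu_seq r \<zeta> n [cyc_class n 1, K] i j) =
    real r ^ n * fact n * (B1 + (if z = 1 then real r - 1 else -1) * B0)"
proof -
  define S R where "S = (\<Sum>p\<in>perms n. W p)" and "R = real r ^ (n - 1)"
  have Ks: "\<forall>L\<in>set [K]. L \<subseteq> G_grp \<zeta> n \<and> L \<noteq> {}"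
    using class_law_subset[OF K] by simp
  have S: "S > 0" using K by (simp add: class_law_def S_def)
  have R: "R > 0" using r2 by (simp add: R_def)
  have "2 * n - 1 = (n - 1) + n" using n by simp
  then have r: "real r ^ (2 * n - 1) = R * real r ^ n" by (simp only: power_add R_def)
  show ?thesis
    unfolding mu_seq_form[OF n Ks] avg_pair_sum[OF n K] card_cyc_class[OF n]
      sum_mult_twisted[where g = "\<lambda>p. p"] T1 T0 r S_def[symmetric] R_def[symmetric]
    using S R by (simp add: field_simps)
qed

lemma mu_seq_form_4_eval:
  assumes n: "0 < n" and K: "class_law n K1 W1 z1" "class_law n K2 W2 z2" "class_law n K3 W3 z3"
    and T1: "(\<Sum>c\<in>perms n. W3 c * (\<Sum>b\<in>perms n. W2 b * (\<Sum>a\<in>perms n. W1 a * triple_sum n (m + 1) (w + 1) (a \<circ> (b \<circ> c))))) =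
      (\<Sum>p\<in>perms n. W1 p) * (\<Sum>p\<in>perms n. W2 p) * (\<Sum>p\<in>perms n. W3 p) * fact (n - 1) * fact n * B1"
    and T0: "(\<Sum>c\<in>perms n. W3 c * (\<Sum>b\<in>perms n. W2 b * (\<Sum>a\<in>perms n. W1 a * triple_sum n m w (a \<circ> (b \<circ> c))))) =
      (\<Sum>p\<in>perms n. W1 p) * (\<Sum>p\<in>perms n. W2 p) * (\<Sum>p\<in>perms n. W3 p) * fact (n - 1) * fact n * B0"
  shows "(\<Sum>i=0..n. \<Sum>j=0..n. real (r * m + 1) ^ i * real (r * w + 1) ^ j * mu_seq r \<zeta> n [cyc_class n 1, K1, K2, K3] i j) =
    real r ^ n * fact n * (B1 + (if z1 * (z2 * z3) = 1 then real r - 1 else -1) * B0)"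
proof -
  define S1 S2 S3 R where "S1 = (\<Sum>p\<in>perms n. W1 p)" and "S2 = (\<Sum>p\<in>perms n. W2 p)"
    and "S3 = (\<Sum>p\<in>perms n. W3 p)" and "R = real r ^ (n - 1)"
  define e where "e = (if z1 * (z2 * z3) = 1 then real r - 1 else -1)"
  have Ks: "\<forall>L\<in>set [K1, K2, K3]. L \<subseteq> G_grp \<zeta> n \<and> L \<noteq> {}"
    using class_law_subset[OF K(1)] class_law_subset[OF K(2)] class_law_subset[OF K(3)] by auto
  have S: "S1 > 0" "S2 > 0" "S3 > 0" using K by (simp_all add: class_law_def S1_def S2_def S3_def)
  have R: "R > 0" using r2 by (simp add: R_def)
  have "2 * n - 1 = (n - 1) + n" using n by simp
  then have r: "real r ^ (2 * n - 1) = R * real r ^ n" by (simp only: power_add R_def)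
  have "(\<Sum>c\<in>perms n. W3 c * (\<Sum>b\<in>perms n. W2 b * (\<Sum>a\<in>perms n. W1 a * twisted n m w (z1 * (z2 * z3)) (a \<circ> (b \<circ> c))))) =
    R * real r ^ n * (
      (\<Sum>c\<in>perms n. W3 c * (\<Sum>b\<in>perms n. W2 b * (\<Sum>a\<in>perms n. W1 a * triple_sum n (m + 1) (w + 1) (a \<circ> (b \<circ> c))))) +
      e * (\<Sum>c\<in>perms n. W3 c * (\<Sum>b\<in>perms n. W2 b * (\<Sum>a\<in>perms n. W1 a * triple_sum n m w (a \<circ> (b \<circ> c))))))"
    unfolding sum_mult_twisted r e_def[symmetric]
    by (simp add: sum_distrib_left sum.distrib distrib_left mult_ac del: o_apply)
  then show ?thesis
    unfolding mu_seq_form[OF n Ks] avg_pair_sum_3[OF n K] card_cyc_class[OF n] T1 T0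
      S1_def[symmetric] S2_def[symmetric] S3_def[symmetric] R_def[symmetric] e_def[symmetric]
    using S R by (simp add: field_simps)
qed

lemma mu_form:
  assumes n: "0 < n"
  shows "(\<Sum>i=0..n. \<Sum>j=0..n. real (r * m + 1) ^ i * real (r * w + 1) ^ j * mu r \<zeta> n i j) =
    real r ^ n * fact n * (\<Sum>k=0..n. real ((m + n - k) choose n) * real ((w + n - k) choose n))"
proof -
  define t where "t k = real ((m + n - k) choose n) * real ((w + n - k) choose n)" for k
  define A1 A0 where "A1 = hook_sum n (m + 1) (w + 1)" and "A0 = hook_sum n m w"
  have A1: "A1 = (\<Sum>k<n. t k)"
    unfolding A1_def hook_sum_def t_def
  proof (rule sum.cong[OF refl])
    fix k assume "k \<in> {..<n}"
    then have "m + 1 + (n - 1 - k) = m + n - k" "w + 1 + (n - 1 - k) = w + n - k" by auto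
    then show "real (m + 1 + (n - 1 - k) choose n) * real (w + 1 + (n - 1 - k) choose n) =
        real (m + n - k choose n) * real (w + n - k choose n)" by (simp only:)
  qed
  have A0: "A0 = (\<Sum>k<n. t (Suc k))"
    unfolding A0_def hook_sum_def t_def
  proof (rule sum.cong[OF refl])
    fix k assume "k \<in> {..<n}"
    then have "m + (n - 1 - k) = m + n - Suc k" "w + (n - 1 - k) = w + n - Suc k" by auto
    then show "real (m + (n - 1 - k) choose n) * real (w + (n - 1 - k) choose n) =
        real (m + n - Suc k choose n) * real (w + n - Suc k choose n)" by simp
  qed
  \<comment> \<open>\<open>A1\<close> lacks the last term of the full sum and \<open>A0\<close> the
    first one.\<close>
  have "(\<Sum>k=0..n. t k) = (\<Sum>k<Suc n. t k)" by (simp only: atLeast0AtMost lessThan_Suc_atMost)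
  then have T: "(\<Sum>k=0..n. t k) = A1 + t n" "(\<Sum>k=0..n. t k) = t 0 + A0"
    unfolding A1 A0 by (simp, simp only: sum.lessThan_Suc_shift)
  let ?c = "\<lambda>i j. real (r * m + 1) ^ i * real (r * w + 1) ^ j"
  let ?form = "\<lambda>\<aa>. \<Sum>i=0..n. \<Sum>j=0..n. ?c i j * mu_seq r \<zeta> n \<aa> i j"
  have one: "(\<Sum>p\<in>perms n. one_cyc n p * triple_sum n a b p) = (\<Sum>p\<in>perms n. one_cyc n p) * fact (n - 1) * fact n * hook_sum n a b" for a b
    unfolding sum_one_cyc_triple_sum[OF n] sum_wsum_product[OF n] sum_one_cyc[OF n] hook_sum_def
    by (simp add: power2_eq_square)
  have f1: "?form [cyc_class n 1, cyc_class n 1] = real r ^ n * fact n * (A1 + (real r - 1) * A0)"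
    using mu_seq_form_2_eval[OF n class_law_cyc[OF n Z_1] one one] by (simp add: A1_def A0_def)
  have f2: "?form [cyc_class n 1, cyc_class n \<zeta>] = real r ^ n * fact n * (A1 - A0)"
    using mu_seq_form_2_eval[OF n class_law_cyc[OF n zeta_in_Z] one one] zeta_neq_1 by (simp add: A1_def A0_def)
  show ?thesis
  proof (cases "n = 1")
    case True
    have mu: "mu r \<zeta> n i j = 2 / real r * mu_seq r \<zeta> n [cyc_class n 1, cyc_class n 1] i j +
        (real r - 2) / real r * mu_seq r \<zeta> n [cyc_class n 1, cyc_class n \<zeta>] i j" for i j
      unfolding mu_def Let_def K_class_n K_class_0_n using True by simp
    have "(\<Sum>i=0..n. \<Sum>j=0..n. ?c i j * mu r \<zeta> n i j) =
        2 / real r * (real r ^ n * fact n * (A1 + (real r - 1) * A0)) + (real r - 2) / real r * (real r ^ n * fact n * (A1 - A0))"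
      unfolding mu distrib_left sum.distrib sum_weighted_linear f1 f2 ..
    \<comment> \<open>The weights \<open>2 / r\<close> and \<open>(r - 2) / r\<close> give
      coefficient 1 to \<open>A1\<close> and, as \<open>2 * (r - 1) - (r - 2) = r\<close>, also to
      \<open>A0\<close>, which is the single term \<open>t 1\<close>.\<close>
    also have "\<dots> = real r ^ n * fact n * (A1 + A0)"
      using r2 by (simp add: field_simps)
    also have "A0 = t n" using True by (simp add: A0)
    finally show ?thesis unfolding t_def[symmetric] T(1) .
  next
    case False
    then have n2: "2 \<le> n" using n by simp
    define P Q where "P a b = real ((a + n - 1) choose n) * real ((b + n - 1) choose n)"
      and "Q a b = real (a choose n) * real (b choose n)" for a b
    have fn: "fact n = real n * fact (n - 1)" by (rule fact_eq[OF n])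
    have near: "(\<Sum>p\<in>perms n. near_cyc n p * triple_sum n a b p) =
        (\<Sum>p\<in>perms n. near_cyc n p) * fact (n - 1) * fact n * (P a b - Q a b)" for a b
      unfolding sum_near_cyc_triple_sum[OF n2] sum_near_cyc[OF n2] P_def Q_def
      by (simp add: fn power2_eq_square mult_ac)
    have nn: "(\<Sum>y\<in>perms n. near_cyc n y * (\<Sum>x\<in>perms n. near_cyc n x * (\<Sum>s\<in>perms n. one_cyc n s * triple_sum n a b (s \<circ> (x \<circ> y))))) =
        (\<Sum>p\<in>perms n. one_cyc n p) * (\<Sum>p\<in>perms n. near_cyc n p) * (\<Sum>p\<in>perms n. near_cyc n p) * fact (n - 1) * fact n * (P a b + Q a b)" for a b
      unfolding sum_near_near_triple_sum[OF n2] sum_near_cyc[OF n2] sum_one_cyc[OF n] P_def Q_def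
      by (simp add: fn power2_eq_square mult_ac)
    note C1 = class_law_cyc[OF n Z_1] and N1 = class_law_near[OF n2 Z_1] and Nz = class_law_near[OF n2 zeta_in_Z]
    have f3: "?form [cyc_class n 1, near_class n \<zeta>] = real r ^ n * fact n *
        ((P (m + 1) (w + 1) - Q (m + 1) (w + 1)) - (P m w - Q m w))"
      using mu_seq_form_2_eval[OF n Nz near near] zeta_neq_1 by simp
    have f4: "?form [cyc_class n 1, cyc_class n 1, near_class n 1, near_class n 1] = real r ^ n * fact n *
        ((P (m + 1) (w + 1) + Q (m + 1) (w + 1)) + (real r - 1) * (P m w + Q m w))"
      using mu_seq_form_4_eval[OF n C1 N1 N1 nn nn] by simp
    have f5: "?form [cyc_class n 1, cyc_class n 1, near_class n \<zeta>, near_class n 1] = real r ^ n * fact n *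
        ((P (m + 1) (w + 1) + Q (m + 1) (w + 1)) - (P m w + Q m w))"
      using mu_seq_form_4_eval[OF n C1 Nz N1 nn nn] zeta_neq_1 by simp
    have mu: "mu r \<zeta> n i j = 1 / real r * mu_seq r \<zeta> n [cyc_class n 1, cyc_class n 1] i j +
        (real r - 2) / (2 * real r) * mu_seq r \<zeta> n [cyc_class n 1, cyc_class n \<zeta>] i j +
        1 / 4 * mu_seq r \<zeta> n [cyc_class n 1, near_class n \<zeta>] i j +
        1 / (2 * real r) * mu_seq r \<zeta> n [cyc_class n 1, cyc_class n 1, near_class n 1, near_class n 1] i j +
        (real r - 2) / (4 * real r) * mu_seq r \<zeta> n [cyc_class n 1, cyc_class n 1, near_class n \<zeta>, near_class n 1] i j" for i j
      unfolding mu_def Let_def K_class_n K_class_0_n K_class_n1_1[OF n2] K_class_n11[OF n2] using False by simp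
    have "P (m + 1) (w + 1) = t 0" "Q m w = t n" by (simp_all add: P_def Q_def t_def)
    moreover have "(\<Sum>i=0..n. \<Sum>j=0..n. ?c i j * mu r \<zeta> n i j) =
        1 / real r * (real r ^ n * fact n * (A1 + (real r - 1) * A0)) +
        (real r - 2) / (2 * real r) * (real r ^ n * fact n * (A1 - A0)) +
        1 / 4 * (real r ^ n * fact n * ((P (m + 1) (w + 1) - Q (m + 1) (w + 1)) - (P m w - Q m w))) +
        1 / (2 * real r) * (real r ^ n * fact n * ((P (m + 1) (w + 1) + Q (m + 1) (w + 1)) + (real r - 1) * (P m w + Q m w))) +
        (real r - 2) / (4 * real r) * (real r ^ n * fact n * ((P (m + 1) (w + 1) + Q (m + 1) (w + 1)) - (P m w + Q m w)))"
      unfolding mu distrib_left sum.distrib sum_weighted_linear f1 f2 f3 f4 f5 ..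
    \<comment> \<open>Here \<open>Q (m + 1) (w + 1)\<close> and \<open>P m w\<close> cancel. The
      survivors \<open>P (m + 1) (w + 1) = t 0\<close> and \<open>Q m w = t n\<close> are the terms
      missing in \<open>A0\<close> and \<open>A1\<close>.\<close>
    moreover have "\<dots> = real r ^ n * fact n * ((A1 + A0 + P (m + 1) (w + 1) + Q m w) / 2)"
    proof -
      have "1 / r * (g * (A1 + (r - 1) * A0)) + (r - 2) / (2 * r) * (g * (A1 - A0)) +
          1 / 4 * (g * ((p1 - q1) - (p0 - q0))) + 1 / (2 * r) * (g * ((p1 + q1) + (r - 1) * (p0 + q0))) +
          (r - 2) / (4 * r) * (g * ((p1 + q1) - (p0 + q0))) = g * ((A1 + A0 + p1 + q0) / 2)"
        if "r \<noteq> 0" for r g p1 q1 p0 q0 :: real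
        using that by (simp add: field_simps)
      from this[of "real r" "real r ^ n * fact n"] show ?thesis using r2 by simp
    qed
    moreover have "A1 + A0 + t 0 + t n = 2 * (\<Sum>k=0..n. t k)" using T by linarith
    ultimately show ?thesis unfolding t_def[symmetric] by simp
  qed
qed

section \<open>Evaluation on the Foulkes characters\<close>

text \<open>Needed because \<open>val_on_C\<close> is a definite description, which is determined
  only on a nonempty set. The witness is the diagonal matrix with \<open>i\<close> entries 1
  followed by entries \<open>\<zeta>\<close>.\<close>

lemma C_set_nonempty:
  assumes "i \<le> n"
  shows "C_set r \<zeta> n i \<noteq> {}"
proof -
  define l where "l j = (if j < i then 1 else \<zeta>)" for j :: nat
  have id: "id \<in> perms n" by (simp add: perms_def permutes_id)
  have l: "l j \<in> Z" for j by (simp add: l_def)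
  have "orbit id a = {a}" for a :: nat by (simp add: orbit_eq_singleton_iff)
  then have c: "cycs {..<n} id = (\<lambda>a. {a}) ` {..<n}" by (simp add: cycs_def)
  have "{C \<in> cycs {..<n} id. block_prod l C = 1} = (\<lambda>a. {a}) ` {..<i}"
    unfolding c using assms zeta_neq_1 by (auto simp: block_prod_def l_def split: if_splits)
  then have "ell r \<zeta> n (monomial_mat n id l) = i"
    unfolding ell_monomial_mat[OF id l] by (simp add: card_image)
  moreover have "monomial_mat n id l \<in> G_grp \<zeta> n" by (rule monomial_mat_in_G[OF id l])
  ultimately show ?thesis by (auto simp: C_set_def)
qed

lemma val_on_C_eq:
  assumes "i \<le> n" "\<And>x. x \<in> C_set r \<zeta> n i \<Longrightarrow> \<theta> x = v"
  shows "val_on_C r \<zeta> n \<theta> i = v"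
  unfolding val_on_C_def
proof (rule the_equality)
  show "\<forall>x\<in>C_set r \<zeta> n i. \<theta> x = v" using assms by blast
  show "v' = v" if "\<forall>x\<in>C_set r \<zeta> n i. \<theta> x = v'" for v'
    using that assms C_set_nonempty[OF assms(1)] by fastforce
qed

definition foulkes_coeff :: "nat \<Rightarrow> nat \<Rightarrow> nat \<Rightarrow> real" where
  "foulkes_coeff n i u = (-1) ^ (i - u) * real ((n + 1) choose (i - u))"

definition foulkes_val :: "nat \<Rightarrow> nat \<Rightarrow> nat \<Rightarrow> real" where
  "foulkes_val n i e = (\<Sum>u=0..i. foulkes_coeff n i u * real (r * u + 1) ^ e)"

lemma foulkes_eq:
  assumes "i \<le> n"
  shows "foulkes r \<zeta> n i x = of_real (foulkes_val n i (ell r \<zeta> n x))"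
proof -
  have "foulkes r \<zeta> n i x = (\<Sum>j=0..i. (-1) ^ (i - j) * of_nat ((n + 1) choose (i - j)) * of_nat (r * j + 1) ^ ell r \<zeta> n x)"
    unfolding foulkes_def using assms by (intro sum.mono_neutral_cong_right) auto
  then show ?thesis by (simp add: foulkes_val_def foulkes_coeff_def)
qed

lemma foulkes_inner:
  assumes n: "0 < n" and le: "i \<le> n" "j \<le> n" "k \<le> n"
  shows "CF_inner r \<zeta> n (\<lambda>x. foulkes r \<zeta> n i x * foulkes r \<zeta> n j x) (foulkes r \<zeta> n k) =
    of_real (\<Sum>u=0..i. \<Sum>v=0..j. foulkes_coeff n i u * foulkes_coeff n j v * real ((r * u * v + u + v + n - k) choose n))"
proof -
  let ?g = "real r ^ n * fact n"
  let ?f = "foulkes_coeff n"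
  define c where "c u v = foulkes_coeff n i u * foulkes_coeff n j v" for u v
  have val1: "val_on_C r \<zeta> n (\<lambda>x. foulkes r \<zeta> n i x * foulkes r \<zeta> n j x) a = of_real (foulkes_val n i a * foulkes_val n j a)" if "a \<le> n" for a
    by (rule val_on_C_eq[OF that]) (use le in \<open>simp add: foulkes_eq C_set_def\<close>)
  have val2: "val_on_C r \<zeta> n (foulkes r \<zeta> n k) a = of_real (foulkes_val n k a)" if "a \<le> n" for a
    by (rule val_on_C_eq[OF that]) (use le in \<open>simp add: foulkes_eq C_set_def\<close>)
  have prod: "foulkes_val n i a * foulkes_val n j a = (\<Sum>u=0..i. \<Sum>v=0..j. c u v * real (r * (r * u * v + u + v) + 1) ^ a)" for a
  proof -
    have "real (r * u + 1) ^ a * real (r * v + 1) ^ a = real (r * (r * u * v + u + v) + 1) ^ a" for u v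
    proof -
      have "(r * u + 1) * (r * v + 1) = r * (r * u * v + u + v) + 1" by (simp add: algebra_simps)
      then show ?thesis by (metis of_nat_mult power_mult_distrib)
    qed
    then show ?thesis unfolding foulkes_val_def sum_product c_def
      by (intro sum.cong refl) (metis (no_types, lifting) mult.assoc mult.left_commute)
  qed
  \<comment> \<open>The coefficients of \<open>foulkes_val n k\<close> are those of the binomial
    inversion, so they select the index \<open>k' = k\<close> from the sum in
    \<open>mu_form\<close>.\<close>
  have inner: "(\<Sum>a=0..n. \<Sum>b=0..n. real (r * m + 1) ^ a * foulkes_val n k b * mu r \<zeta> n a b) =
      ?g * real ((m + n - k) choose n)" for m
  proof -
    have "(\<Sum>a=0..n. \<Sum>b=0..n. real (r * m + 1) ^ a * foulkes_val n k b * mu r \<zeta> n a b) =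
        (\<Sum>a=0..n. \<Sum>b=0..n. \<Sum>w=0..k. ?f k w * (real (r * m + 1) ^ a * real (r * w + 1) ^ b * mu r \<zeta> n a b))"
      unfolding foulkes_val_def sum_distrib_left sum_distrib_right by (intro sum.cong refl) (simp only: mult_ac)
    also have "\<dots> = (\<Sum>a=0..n. \<Sum>w=0..k. \<Sum>b=0..n. ?f k w * (real (r * m + 1) ^ a * real (r * w + 1) ^ b * mu r \<zeta> n a b))"
      by (rule sum.cong[OF refl], rule sum.swap)
    also have "\<dots> = (\<Sum>w=0..k. \<Sum>a=0..n. \<Sum>b=0..n. ?f k w * (real (r * m + 1) ^ a * real (r * w + 1) ^ b * mu r \<zeta> n a b))"
      by (rule sum.swap)
    also have "\<dots> = (\<Sum>w=0..k. ?f k w * (?g * (\<Sum>k'=0..n. real ((m + n - k') choose n) * real ((w + n - k') choose n))))"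
      by (simp only: sum_distrib_left[symmetric] mu_form[OF n])
    also have "\<dots> = (\<Sum>w=0..k. \<Sum>k'=0..n. ?g * (real ((m + n - k') choose n) * (?f k w * real ((w + n - k') choose n))))"
      unfolding sum_distrib_left by (intro sum.cong refl) (simp only: mult_ac)
    also have "\<dots> = (\<Sum>k'=0..n. \<Sum>w=0..k. ?g * (real ((m + n - k') choose n) * (?f k w * real ((w + n - k') choose n))))"
      by (rule sum.swap)
    also have "\<dots> = (\<Sum>k'=0..n. ?g * (real ((m + n - k') choose n) * of_bool (k = k')))"
      unfolding sum_distrib_left[symmetric] foulkes_coeff_def
      by (rule arg_cong2[of _ _ _ _ times], rule refl, rule sum.cong[OF refl], rule arg_cong2[of _ _ _ _ times], rule refl,
          rule alternating_binomial_inversion[OF le(3)]) simp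
    also have "\<dots> = (\<Sum>k'=0..n. if k' = k then ?g * real ((m + n - k) choose n) else 0)"
      by (intro sum.cong refl) auto
    also have "\<dots> = ?g * real ((m + n - k) choose n)" using le by simp
    finally show ?thesis .
  qed
  have "(\<Sum>a=0..n. \<Sum>b=0..n. foulkes_val n i a * foulkes_val n j a * foulkes_val n k b * mu r \<zeta> n a b) =
      (\<Sum>a=0..n. \<Sum>b=0..n. \<Sum>u=0..i. \<Sum>v=0..j. c u v * (real (r * (r * u * v + u + v) + 1) ^ a * foulkes_val n k b * mu r \<zeta> n a b))"
    unfolding prod sum_distrib_right by (simp only: mult.assoc)
  also have "\<dots> = (\<Sum>u=0..i. \<Sum>v=0..j. \<Sum>a=0..n. \<Sum>b=0..n. c u v * (real (r * (r * u * v + u + v) + 1) ^ a * foulkes_val n k b * mu r \<zeta> n a b))"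
  proof -
    have s3: "(\<Sum>a\<in>A. \<Sum>b\<in>B. \<Sum>v\<in>V. F a b v) = (\<Sum>v\<in>V. \<Sum>a\<in>A. \<Sum>b\<in>B. F a b v)"
      for A B V :: "nat set" and F :: "nat \<Rightarrow> nat \<Rightarrow> nat \<Rightarrow> real"
    proof -
      have "(\<Sum>a\<in>A. \<Sum>b\<in>B. \<Sum>v\<in>V. F a b v) = (\<Sum>a\<in>A. \<Sum>v\<in>V. \<Sum>b\<in>B. F a b v)"
        by (rule sum.cong[OF refl], rule sum.swap)
      also have "\<dots> = (\<Sum>v\<in>V. \<Sum>a\<in>A. \<Sum>b\<in>B. F a b v)" by (rule sum.swap)
      finally show ?thesis .
    qed
    have sw: "(\<Sum>a\<in>A. \<Sum>b\<in>B. \<Sum>u\<in>U. \<Sum>v\<in>V. F a b u v) = (\<Sum>u\<in>U. \<Sum>v\<in>V. \<Sum>a\<in>A. \<Sum>b\<in>B. F a b u v)"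
      for A B U V :: "nat set" and F :: "nat \<Rightarrow> nat \<Rightarrow> nat \<Rightarrow> nat \<Rightarrow> real"
      by (rule trans[OF s3]) (rule sum.cong[OF refl], rule s3)
    show ?thesis by (rule sw)
  qed
  also have "\<dots> = (\<Sum>u=0..i. \<Sum>v=0..j. c u v * (?g * real ((r * u * v + u + v + n - k) choose n)))"
    by (simp only: sum_distrib_left[symmetric] inner)
  also have "\<dots> = ?g * (\<Sum>u=0..i. \<Sum>v=0..j. c u v * real ((r * u * v + u + v + n - k) choose n))"
    unfolding sum_distrib_left by (intro sum.cong refl) (simp only: mult_ac)
  finally have main: "(\<Sum>a=0..n. \<Sum>b=0..n. foulkes_val n i a * foulkes_val n j a * foulkes_val n k b * mu r \<zeta> n a b) =
      ?g * (\<Sum>u=0..i. \<Sum>v=0..j. c u v * real ((r * u * v + u + v + n - k) choose n))" .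
  have "CF_inner r \<zeta> n (\<lambda>x. foulkes r \<zeta> n i x * foulkes r \<zeta> n j x) (foulkes r \<zeta> n k) =
      1 / of_nat (card (G_grp \<zeta> n)) * (\<Sum>a=0..n. \<Sum>b=0..n.
        of_real (foulkes_val n i a * foulkes_val n j a * foulkes_val n k b * mu r \<zeta> n a b))"
    unfolding CF_inner_def
    by (intro arg_cong2[of _ _ _ _ times] refl sum.cong) (simp add: val1 val2)
  also have "\<dots> = of_real (1 / real (card (G_grp \<zeta> n)) *
      (\<Sum>a=0..n. \<Sum>b=0..n. foulkes_val n i a * foulkes_val n j a * foulkes_val n k b * mu r \<zeta> n a b))"
    by simp
  \<comment> \<open>\<open>?g\<close> is the order of the group and cancels the normalisation of the
    inner product.\<close>
  also have "1 / real (card (G_grp \<zeta> n)) *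
      (\<Sum>a=0..n. \<Sum>b=0..n. foulkes_val n i a * foulkes_val n j a * foulkes_val n k b * mu r \<zeta> n a b) =
      (\<Sum>u=0..i. \<Sum>v=0..j. c u v * real ((r * u * v + u + v + n - k) choose n))"
    unfolding main card_G using r2 by simp
  finally show ?thesis by (simp only: c_def)
qed

end

theorem theorem3p14:
  fixes r n i j k :: nat and \<zeta> :: complex
  assumes "r \<ge> 2" and "n \<ge> 1"
    and "primitive_root_unity r \<zeta>"
    and "i \<le> n" and "j \<le> n" and "k \<le> n"
  shows "CF_inner r \<zeta> n (\<lambda>x. foulkes r \<zeta> n i x * foulkes r \<zeta> n j x) (foulkes r \<zeta> n k) =
    (\<Sum>u=0..i. \<Sum>v=0..j. (-1) ^ (i - u) * (-1) ^ (j - v) *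
       of_nat ((n + 1) choose (i - u)) * of_nat ((n + 1) choose (j - v)) *
       of_nat ((r * u * v + u + v + n - k) choose n))"
proof -
  interpret root_of_unity r \<zeta> by unfold_locales (use assms in auto)
  have "CF_inner r \<zeta> n (\<lambda>x. foulkes r \<zeta> n i x * foulkes r \<zeta> n j x) (foulkes r \<zeta> n k) =
    of_real (\<Sum>u=0..i. \<Sum>v=0..j. foulkes_coeff n i u * foulkes_coeff n j v * real ((r * u * v + u + v + n - k) choose n))"
    using assms by (intro foulkes_inner) auto
  also have "\<dots> = (\<Sum>u=0..i. \<Sum>v=0..j. (-1) ^ (i - u) * (-1) ^ (j - v) *
       of_nat ((n + 1) choose (i - u)) * of_nat ((n + 1) choose (j - v)) *
       of_nat ((r * u * v + u + v + n - k) choose n))"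
    unfolding of_real_sum foulkes_coeff_def by (intro sum.cong refl) (simp add: mult_ac)
  finally show ?thesis .
qed

end
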